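(* Let the kernel $K:\Omega^\circ\to\mathbb{R}^{n\times n}$ satisfy the following two conditions. (1) $K(\tau,\xi)=K_*(\tau,\xi)/(\tau-\xi)^{1-\alpha}$ for all $(\tau,\xi)\in\Omega^\circ$, with $\alpha\in(0,1)$ and a continuous $K_*:\Omega\to\mathbb{R}^{n\times n}$ for which there are $\beta\in(0,1]$, $\lambda>0$ with $\|K_*(\tau,\xi)-K_*(\tau,\xi')\|\le\lambda|\xi-\xi'|^\beta$ for all $(\tau,\xi),(\tau,\xi')\in\Omega$. (2) For every $t\in(0,T]$, if $\ell\in L_\infty([0,t],\mathbb{R}^n)$ and $\int_0^\tau K(\tau,\xi)\ell(\xi)\,d\xi=0$ for all $\tau\in[0,t]$, then $\ell(\xi)=0$ for a.e. $\xi\in[0,t]$. Let $\sigma:C([0,T],\mathbb{R}^n)\to\mathbb{R}$ be given, and suppose that the Hamiltonian $H:[0,T]\times\mathbb{R}^n\times\mathbb{R}^n\to\mathbb{R}$ is continuous and that there exists $c>0$ such that $$|H(t,x,s)-H(t,x,s')|\le c(1+\|x\|)\|s-s'\|\qquad\forall t\in[0,T],\ x,s,s'\in\mathbb{R}^n.$$ Then the Cauchy problem $$\boldsymbol{\partial}_t\varphi(t,w(\cdot))+H\bigl(t,w(t),\boldsymbol{\nabla}\varphi(t,w(\cdot))\bigr)=0\ \ \forall(t,w(\cdot))\in\mathcal{G}^\circ,\qquad \varphi(T,w(\cdot))=\sigma(w(\cdot))\ \ \forall w(\cdot)\in\mathcal{W}[0,T]$$ admits at most one viscosity solution.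
   Context: Data. $n\in\mathbb{N}$, $T>0$; $\mathbb{R}^n$ is Euclidean with inner product $\langle\cdot,\cdot\rangle$ and norm $\|\cdot\|$ (induced norm on $\mathbb{R}^{n\times n}$ denoted the same way); $\Omega=\{(\tau,\xi)\in[0,T]^2:\tau\ge\xi\}$, $\Omega^\circ=\{(\tau,\xi)\in\Omega:\tau>\xi\}$; $y(\cdot)\in C([0,T],\mathbb{R}^n)$ is fixed; $c_0>0$ is a fixed constant. For a function $x$ on $[0,T]$, $x_t(\cdot)$ is its restriction to $[0,t]$. Positions. For $t\in(0,T]$, $\mathcal{W}[0,t]$ is the set of $w:[0,t]\to\mathbb{R}^n$ for which there is $\ell(\cdot)\in L_\infty([0,t],\mathbb{R}^n)$ with $w(\tau)=y(\tau)+\int_0^\tau K(\tau,\xi)\ell(\xi)\,d\xi$ for all $\tau\in[0,t]$; by condition (2) of the claim $\ell$ is unique (a.e.), denoted $\ell(\cdot;t,w(\cdot))$. $\mathcal{W}[0,0]$ consists of the single function $w$ with $w(0)=y(0)$, and $\ell(0;0,w(\cdot)):=0$. $\mathcal{G}=\bigcup_{t\in[0,T]}(\{t\}\times\mathcal{W}[0,t])$ with metric $\operatorname{dist}((t,w),(t',w'))=|t-t'|+\max_{\tau\in[0,T]}\|w(\min\{\tau,t\})-w'(\min\{\tau,t'\})\|$; $\mathcal{G}^\circ=\{(t,w(\cdot))\in\mathcal{G}:t<T\}$. $\mathcal{X}(t,w(\cdot))=\{x(\cdot)\in\mathcal{W}[0,T]:x_t(\cdot)=w(\cdot)\}$. $a(\tau;t,w(\cdot))=w(\tau)$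 for $\tau\in[0,t)$ and $a(\tau;t,w(\cdot))=y(\tau)+\int_0^tK(\tau,\xi)\ell(\xi;t,w(\cdot))\,d\xi$ for $\tau\in[t,T]$. Sets $\mathcal{G}_k$ and class $\Phi$. For $k\in\mathbb{N}$, $\mathcal{G}_k=\{(t,w(\cdot))\in\mathcal{G}:\|\ell(\xi;t,w(\cdot))\|\le kc_0(1+\|w(\xi)\|)\text{ for a.e. }\xi\in[0,t]\}$. $\Phi$ is the set of $\varphi:\mathcal{G}\to\mathbb{R}$ such that for every $k$: (a) $\varphi|_{\mathcal{G}_k}$ is continuous; (b) there is $\lambda>0$ with $|\varphi(t,w)-\varphi(t,w')|\le\lambda\bigl(\|a(T;t,w)-a(T;t,w')\|+\int_0^T\frac{\|a(\tau;t,w)-a(\tau;t,w')\|}{(T-\tau)^{1-\alpha}}\,d\tau\bigr)$ for all $(t,w),(t,w')\in\mathcal{G}_k$. Coinvariant derivatives. $\varphi:\mathcal{G}\to\mathbb{R}$ is $ci$-differentiable at $(t,w(\cdot))\in\mathcal{G}^\circ$ if there are $\boldsymbol{\partial}_t\varphi(t,w(\cdot))\in\mathbb{R}$ and $\boldsymbol{\nabla}\varphi(t,w(\cdot))\in\mathbb{R}^n$ such that for every $x(\cdot)\in\mathcal{X}(t,w(\cdot))$, as $\tau\to t^+$, $\Bigl|\frac{\varphi(\tau,x_\tau(\cdot))-\varphi(t,w(\cdot))}{\tau-t}-\boldsymbol{\partial}_t\varphi(t,w(\cdot))-\bigl\langle\boldsymbol{\nabla}\varphi(t,w(\cdot)),\frac1{\tau-t}\int_t^\tau\ell(\xi;T,x(\cdot))\,d\xi\bigr\rangle\Bigr|\to0$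 (these are then unique). $\varphi$ is $ci$-smooth if it is $ci$-differentiable at every point of $\mathcal{G}^\circ$ and, for every $k$, $\varphi|_{\mathcal{G}_k}$ and the restrictions of $\boldsymbol{\partial}_t\varphi,\boldsymbol{\nabla}\varphi$ to $\mathcal{G}_k\cap\mathcal{G}^\circ$ are continuous. Viscosity solution. A viscosity solution of the Cauchy problem is a functional $\varphi\in\Phi$ satisfying the boundary condition and such that for every $ci$-smooth $\psi:\mathcal{G}\to\mathbb{R}$ and $k\in\mathbb{N}$: if $\varphi-\psi$ attains its minimum on $\mathcal{G}_k$ at $(t,w(\cdot))\in\mathcal{G}_k\cap\mathcal{G}^\circ$, then $\boldsymbol{\partial}_t\psi(t,w(\cdot))+H(t,w(t),\boldsymbol{\nabla}\psi(t,w(\cdot)))\le0$; and if $\varphi-\psi$ attains its maximum on $\mathcal{G}_k$ at $(t,w(\cdot))\in\mathcal{G}_k\cap\mathcal{G}^\circ$, then $\boldsymbol{\partial}_t\psi(t,w(\cdot))+H(t,w(t),\boldsymbol{\nabla}\psi(t,w(\cdot)))\ge0$. *)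

theory Defs
  imports "HOL-Analysis.Analysis"
begin

text \<open>
  A function on \<open>[0,t]\<close> is represented by a total function that is extensional on \<open>{0..t}\<close>
  (value \<open>undefined\<close> elsewhere), so that equality of representatives is equality on \<open>[0,t]\<close>.
  A pair \<open>(t, w)\<close> of a time and such a function is a position.
  Throughout, \<open>T\<close> is the horizon, \<open>y\<close> the inhomogeneity and \<open>K\<close> the kernel; \<open>K \<tau> \<xi>\<close> is meant for
  \<open>0 \<le> \<xi> < \<tau> \<le> T\<close>, and its junk value at \<open>\<xi> = \<tau>\<close> only enters integrals on a null set.
\<close>

type_synonym 'n path = "real \<Rightarrow> real ^ 'n"
type_synonym 'n position = "real \<times> 'n path"

definition closed_triangle :: "real \<Rightarrow> (real \<times> real) set" where
  "closed_triangle T = {(\<tau>, \<xi>). 0 \<le> \<xi> \<and> \<xi> \<le> \<tau> \<and> \<tau> \<le> T}"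

definition open_triangle :: "real \<Rightarrow> (real \<times> real) set" where
  "open_triangle T = {(\<tau>, \<xi>). 0 \<le> \<xi> \<and> \<xi> < \<tau> \<and> \<tau> \<le> T}"

text \<open>Representatives of the elements of \<open>L\<^sub>\<infinity>([0,t], \<real>\<^sup>n)\<close>; values outside \<open>{0..t}\<close> are irrelevant.\<close>
definition Linf :: "real \<Rightarrow> ('n::finite) path set" where
  "Linf t = {l. l \<in> borel_measurable (lebesgue_on {0..t}) \<and>
               (\<exists>M. AE \<xi> in lebesgue_on {0..t}. norm (l \<xi>) \<le> M)}"

text \<open>\<open>volterra K l t \<tau>\<close> is the integral of \<open>K(\<tau>,\<xi>) l(\<xi>)\<close> over \<open>\<xi> \<in> [0,t]\<close>, where \<open>t \<le> \<tau>\<close>.\<close>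
definition volterra ::
  "(real \<Rightarrow> real \<Rightarrow> real ^ 'n ^ 'n) \<Rightarrow> 'n path \<Rightarrow> real \<Rightarrow> real \<Rightarrow> real ^ ('n::finite)" where
  "volterra K l t \<tau> = (LINT \<xi>|lebesgue_on {0..t}. K \<tau> \<xi> *v l \<xi>)"

definition generates ::
  "'n path \<Rightarrow> (real \<Rightarrow> real \<Rightarrow> real ^ 'n ^ 'n) \<Rightarrow> real \<Rightarrow> 'n path \<Rightarrow> ('n::finite) path \<Rightarrow> bool" where
  "generates y K t l w \<longleftrightarrow>
     l \<in> Linf t \<and> (\<forall>\<tau>\<in>{0..t}. w \<tau> = y \<tau> + volterra K l \<tau> \<tau>)"

definition paths ::
  "'n path \<Rightarrow> (real \<Rightarrow> real \<Rightarrow> real ^ 'n ^ 'n) \<Rightarrow> real \<Rightarrow> ('n::finite) path set" where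
  "paths y K t =
     (if t = 0 then {w \<in> extensional {0..0}. w 0 = y 0}
      else {w \<in> extensional {0..t}. \<exists>l. generates y K t l w})"

text \<open>The density \<open>\<ell>(\<cdot>; t, w)\<close>. It is unique only almost everywhere, so a representative is chosen;
  everything below depends on it only through integrals and almost-everywhere statements.\<close>
definition dens ::
  "'n path \<Rightarrow> (real \<Rightarrow> real \<Rightarrow> real ^ 'n ^ 'n) \<Rightarrow> real \<Rightarrow> 'n path \<Rightarrow> ('n::finite) path" where
  "dens y K t w = (if t = 0 then (\<lambda>_. 0) else (SOME l. generates y K t l w))"

definition positions ::
  "real \<Rightarrow> 'n path \<Rightarrow> (real \<Rightarrow> real \<Rightarrow> real ^ 'n ^ 'n) \<Rightarrow> ('n::finite) position set" where
  "positions T y K = (SIGMA t:{0..T}. paths y K t)"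

definition open_positions ::
  "real \<Rightarrow> 'n path \<Rightarrow> (real \<Rightarrow> real \<Rightarrow> real ^ 'n ^ 'n) \<Rightarrow> ('n::finite) position set" where
  "open_positions T y K = {(t, w) \<in> positions T y K. t < T}"

text \<open>On \<open>positions\<close> the paths are continuous, so the supremum is a maximum.\<close>
definition pos_dist :: "real \<Rightarrow> 'n position \<Rightarrow> ('n::finite) position \<Rightarrow> real" where
  "pos_dist T = (\<lambda>(t, w) (t', w').
     \<bar>t - t'\<bar> + (SUP \<tau>\<in>{0..T}. norm (w (min \<tau> t) - w' (min \<tau> t'))))"

definition pos_continuous_on ::
  "real \<Rightarrow> ('n::finite) position set \<Rightarrow> ('n position \<Rightarrow> 'b::metric_space) \<Rightarrow> bool" where
  "pos_continuous_on T S f \<longleftrightarrow>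
     (\<forall>p\<in>S. \<forall>\<epsilon>>0. \<exists>\<delta>>0. \<forall>q\<in>S. pos_dist T p q < \<delta> \<longrightarrow> dist (f p) (f q) < \<epsilon>)"

definition extensions ::
  "real \<Rightarrow> 'n path \<Rightarrow> (real \<Rightarrow> real \<Rightarrow> real ^ 'n ^ 'n) \<Rightarrow> ('n::finite) position \<Rightarrow> 'n path set" where
  "extensions T y K = (\<lambda>(t, w). {x \<in> paths y K T. restrict x {0..t} = w})"

definition prolong ::
  "'n path \<Rightarrow> (real \<Rightarrow> real \<Rightarrow> real ^ 'n ^ 'n) \<Rightarrow> 'n position \<Rightarrow> real \<Rightarrow> real ^ ('n::finite)" where
  "prolong y K = (\<lambda>(t, w) \<tau>.
     if \<tau> < t then w \<tau> else y \<tau> + volterra K (dens y K t w) t \<tau>)"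

definition Gk ::
  "real \<Rightarrow> 'n path \<Rightarrow> (real \<Rightarrow> real \<Rightarrow> real ^ 'n ^ 'n) \<Rightarrow> real \<Rightarrow> nat \<Rightarrow> ('n::finite) position set" where
  "Gk T y K c0 k = {(t, w) \<in> positions T y K.
     AE \<xi> in lebesgue_on {0..t}. norm (dens y K t w \<xi>) \<le> real k * c0 * (1 + norm (w \<xi>))}"

text \<open>The index \<open>k\<close> ranges over the positive integers, here and below. In the integral the junk
  value of the weight at \<open>\<tau> = T\<close> is harmless.\<close>
definition Phi ::
  "real \<Rightarrow> 'n path \<Rightarrow> (real \<Rightarrow> real \<Rightarrow> real ^ 'n ^ 'n) \<Rightarrow> real \<Rightarrow> real \<Rightarrow>
   (('n::finite) position \<Rightarrow> real) set" where
  "Phi T y K c0 \<alpha> = {\<phi>. \<forall>k\<ge>1.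
     pos_continuous_on T (Gk T y K c0 k) \<phi> \<and>
     (\<exists>L>0. \<forall>t w w'. (t, w) \<in> Gk T y K c0 k \<longrightarrow> (t, w') \<in> Gk T y K c0 k \<longrightarrow>
        \<bar>\<phi> (t, w) - \<phi> (t, w')\<bar> \<le>
          L * (norm (prolong y K (t, w) T - prolong y K (t, w') T) +
               (LINT \<tau>|lebesgue_on {0..T}.
                  norm (prolong y K (t, w) \<tau> - prolong y K (t, w') \<tau>)
                    / (T - \<tau>) powr (1 - \<alpha>))))}"

definition has_ci_derivatives ::
  "real \<Rightarrow> 'n path \<Rightarrow> (real \<Rightarrow> real \<Rightarrow> real ^ 'n ^ 'n) \<Rightarrow> ('n position \<Rightarrow> real) \<Rightarrow>
   'n position \<Rightarrow> real \<Rightarrow> real ^ ('n::finite) \<Rightarrow> bool" where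
  "has_ci_derivatives T y K \<phi> = (\<lambda>(t, w) d g.
     \<forall>x \<in> extensions T y K (t, w).
       ((\<lambda>\<tau>. \<bar>(\<phi> (\<tau>, restrict x {0..\<tau>}) - \<phi> (t, w)) / (\<tau> - t) - d
              - inner g ((1 / (\<tau> - t)) *\<^sub>R (LINT \<xi>|lebesgue_on {t..\<tau>}. dens y K T x \<xi>))\<bar>)
          \<longlongrightarrow> 0) (at_right t))"

definition ci_differentiable ::
  "real \<Rightarrow> 'n path \<Rightarrow> (real \<Rightarrow> real \<Rightarrow> real ^ 'n ^ 'n) \<Rightarrow> ('n position \<Rightarrow> real) \<Rightarrow>
   ('n::finite) position \<Rightarrow> bool" where
  "ci_differentiable T y K \<phi> p \<longleftrightarrow> (\<exists>d g. has_ci_derivatives T y K \<phi> p d g)"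

definition ci_dt ::
  "real \<Rightarrow> 'n path \<Rightarrow> (real \<Rightarrow> real \<Rightarrow> real ^ 'n ^ 'n) \<Rightarrow> ('n position \<Rightarrow> real) \<Rightarrow>
   ('n::finite) position \<Rightarrow> real" where
  "ci_dt T y K \<phi> p = (THE d. \<exists>g. has_ci_derivatives T y K \<phi> p d g)"

definition ci_grad ::
  "real \<Rightarrow> 'n path \<Rightarrow> (real \<Rightarrow> real \<Rightarrow> real ^ 'n ^ 'n) \<Rightarrow> ('n position \<Rightarrow> real) \<Rightarrow>
   'n position \<Rightarrow> real ^ ('n::finite)" where
  "ci_grad T y K \<phi> p = (THE g. \<exists>d. has_ci_derivatives T y K \<phi> p d g)"

definition ci_smooth ::
  "real \<Rightarrow> 'n path \<Rightarrow> (real \<Rightarrow> real \<Rightarrow> real ^ 'n ^ 'n) \<Rightarrow> real \<Rightarrow>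
   (('n::finite) position \<Rightarrow> real) \<Rightarrow> bool" where
  "ci_smooth T y K c0 \<psi> \<longleftrightarrow>
     (\<forall>p \<in> open_positions T y K. ci_differentiable T y K \<psi> p) \<and>
     (\<forall>k\<ge>1. pos_continuous_on T (Gk T y K c0 k) \<psi> \<and>
        pos_continuous_on T (Gk T y K c0 k \<inter> open_positions T y K) (ci_dt T y K \<psi>) \<and>
        pos_continuous_on T (Gk T y K c0 k \<inter> open_positions T y K) (ci_grad T y K \<psi>))"

text \<open>Only the values of \<open>\<phi>\<close> and \<open>\<psi>\<close> on \<open>positions T y K\<close> matter.\<close>
definition viscosity_solution ::
  "real \<Rightarrow> 'n path \<Rightarrow> (real \<Rightarrow> real \<Rightarrow> real ^ 'n ^ 'n) \<Rightarrow> real \<Rightarrow> real \<Rightarrow>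
   (real \<Rightarrow> real ^ 'n \<Rightarrow> real ^ 'n \<Rightarrow> real) \<Rightarrow> ('n path \<Rightarrow> real) \<Rightarrow>
   (('n::finite) position \<Rightarrow> real) \<Rightarrow> bool" where
  "viscosity_solution T y K c0 \<alpha> H \<sigma> \<phi> \<longleftrightarrow>
     \<phi> \<in> Phi T y K c0 \<alpha> \<and>
     (\<forall>w \<in> paths y K T. \<phi> (T, w) = \<sigma> w) \<and>
     (\<forall>\<psi> k t w. ci_smooth T y K c0 \<psi> \<longrightarrow> 1 \<le> k \<longrightarrow>
        (t, w) \<in> Gk T y K c0 k \<inter> open_positions T y K \<longrightarrow>
        ((\<forall>q \<in> Gk T y K c0 k. \<phi> (t, w) - \<psi> (t, w) \<le> \<phi> q - \<psi> q) \<longrightarrow>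
           ci_dt T y K \<psi> (t, w) + H t (w t) (ci_grad T y K \<psi> (t, w)) \<le> 0) \<and>
        ((\<forall>q \<in> Gk T y K c0 k. \<phi> q - \<psi> q \<le> \<phi> (t, w) - \<psi> (t, w)) \<longrightarrow>
           ci_dt T y K \<psi> (t, w) + H t (w t) (ci_grad T y K \<psi> (t, w)) \<ge> 0))"

end

theory Submission
  imports Defs "HOL-Complex_Analysis.Great_Picard"
begin

text \<open>
  The proof is the doubling of variables of viscosity theory. Suppose \<open>\<phi>1 - \<phi>2\<close> is positive at some
  position. A growth bound singles out a set \<open>\<G> k\<close> of positions containing it, and
  \<open>\<phi>1 q - \<phi>2 p - A * penalty e (a(q) - a(p)) - N * (fst q - fst p)\<^sup>2 - \<zeta> * (T - fst q)\<close>
  is maximized over pairs \<open>q, p\<close> in \<open>\<G> k\<close>; here \<open>a(q)\<close> is the prolongation of \<open>q\<close> to \<open>[0,T]\<close>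
  and \<open>penalty e\<close> is a smooth approximation, up to a multiple of \<open>e\<close>, of the weighted norm in the
  Lipschitz condition of the class \<open>Phi\<close>. The maximum exists because \<open>\<G> k\<close> is compact
  (\<open>Gk_compact\<close>): a Gronwall estimate bounds densities and paths, the weakly singular kernel makes
  the paths equicontinuous, and a limit path has a density obtained from an almost everywhere
  convergent sequence of nearly norm-minimal densities, so no weak compactness is needed.

  As a function of one of its arguments, the penalty is \<open>ci\<close>-smooth. Its time derivative vanishes,
  since the prolongation does not move while the density is zero, and its gradient is an integral
  of the kernel against a unit-bounded factor; the difference quotient of the smoothed norm
  \<open>v \<mapsto> sqrt (e\<^sup>2 + (norm v)\<^sup>2)\<close> is an exact inner product (\<open>smooth_norm_diff\<close>), so Fubini's theorem
  suffices for the derivative (\<open>J_pairing\<close>, \<open>test_ci_derivative\<close>). The two viscosity inequalities at a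
  maximum (\<open>viscosity_doubling\<close>) differ by \<open>\<zeta>\<close>.

  Letting \<open>N \<rightarrow> \<infinity>\<close> for fixed \<open>e\<close> makes the two times equal and the two gradients coincide
  (\<open>equal_time_maximum\<close>). With \<open>A\<close> twice the Lipschitz constant of \<open>\<phi>2\<close>, the weighted distance of
  the two maximizers is at most a multiple of \<open>e\<close>, while the gradients stay bounded as long as the
  time stays away from \<open>T\<close>, which the boundary condition ensures. Letting \<open>e \<rightarrow> 0\<close>, the maximizers
  merge and the continuity of \<open>H\<close> contradicts the gap \<open>\<zeta> > 0\<close> (\<open>comparison\<close>).
\<close>

section \<open>Two compactness principles and an integral bound\<close>

lemma attains_max_of_seq_compact:
  fixes f :: "'a \<Rightarrow> real"
  assumes "S \<noteq> {}"
    and sub: "\<And>s. (\<And>n::nat. s n \<in> S) \<Longrightarrow>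
                \<exists>r p. strict_mono r \<and> p \<in> S \<and> (\<lambda>n. f (s (r n))) \<longlonglongrightarrow> f p"
  shows "\<exists>p\<in>S. \<forall>q\<in>S. f q \<le> f p"
proof -
  have "seq_compact (f ` S)"
    unfolding seq_compact_def
  proof (intro allI impI)
    fix u assume u: "\<forall>n::nat. u n \<in> f ` S"
    then obtain s where s: "\<And>n. s n \<in> S" "\<And>n. u n = f (s n)"
      unfolding image_iff by metis
    obtain r p where "strict_mono r" "p \<in> S" "(\<lambda>n. f (s (r n))) \<longlonglongrightarrow> f p"
      using sub s(1) by blast
    then show "\<exists>l\<in>f ` S. \<exists>r. strict_mono r \<and> (u \<circ> r) \<longlonglongrightarrow> l"
      using s(2) by (auto simp: comp_def)
  qed
  then have "compact (f ` S)"
    by (simp add: compact_eq_seq_compact_metric)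
  from compact_attains_sup[OF this] \<open>S \<noteq> {}\<close> show ?thesis by auto
qed

text \<open>This replaces weak compactness: nearly minimal elements of the \<open>L\<^sub>2\<close>-norm on the sets \<open>A m\<close>
  form a Cauchy sequence by the parallelogram identity.\<close>
lemma midpoint_convex_AE_limit:
  fixes A :: "nat \<Rightarrow> ('a \<Rightarrow> 'b::euclidean_space) set"
  assumes fin: "finite_measure M"
    and ne: "\<And>m. A m \<noteq> {}" and decr: "\<And>m n. m \<le> n \<Longrightarrow> A n \<subseteq> A m"
    and meas: "\<And>m g. g \<in> A m \<Longrightarrow> g \<in> borel_measurable M"
    and bdd: "\<And>m g. g \<in> A m \<Longrightarrow> AE x in M. norm (g x) \<le> B"
    and mid: "\<And>m g h. g \<in> A m \<Longrightarrow> h \<in> A m \<Longrightarrow> (\<lambda>x. (1/2) *\<^sub>R (g x + h x)) \<in> A m"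
  obtains g r l where "\<And>m. g m \<in> A m" "strict_mono (r :: nat \<Rightarrow> nat)"
    "l \<in> borel_measurable M" "AE x in M. (\<lambda>i. g (r i) x) \<longlonglongrightarrow> l x"
proof -
  interpret finite_measure M by fact
  define e where "e g = (LINT x|M. (norm (g x))\<^sup>2)" for g :: "'a \<Rightarrow> 'b"
  have int2: "integrable M (\<lambda>x. (norm (g x))\<^sup>2)" if "g \<in> borel_measurable M"
    "AE x in M. norm (g x) \<le> C" for g :: "'a \<Rightarrow> 'b" and C
  proof (rule integrable_const_bound[where B = "C\<^sup>2"])
    show "AE x in M. norm ((norm (g x))\<^sup>2) \<le> C\<^sup>2"
      using that(2) by eventually_elim (simp add: power_mono)
  qed (use that in measurable)
  define d where "d m = (INF g\<in>A m. e g)" for m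
  have e0: "e g \<ge> 0" for g by (auto simp: e_def)
  have bb: "bdd_below (e ` A m)" for m
    by (rule bdd_belowI[of _ 0]) (use e0 in auto)
  have dmono: "d m \<le> d n" if "m \<le> n" for m n
    unfolding d_def by (rule cINF_superset_mono) (use ne bb decr that in auto)
  have dle: "d m \<le> e g" if "g \<in> A m" for m g
    unfolding d_def by (rule cINF_lower[OF bb that])
  have "\<exists>g\<in>A m. e g < d m + 1 / (real m + 1)" for m
  proof -
    have "\<exists>x\<in>e ` A m. x < d m + 1 / (real m + 1)"
      by (rule cInf_lessD) (use ne in \<open>auto simp: d_def field_simps\<close>)
    then show ?thesis by auto
  qed
  then obtain g where gA: "\<And>m. g m \<in> A m" and ge: "\<And>m. e (g m) < d m + 1 / (real m + 1)"
    by metis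
  have gm[measurable]: "g m \<in> borel_measurable M" for m using meas gA by blast
  have gb: "AE x in M. norm (g m x) \<le> B" for m using bdd gA by blast
  have dub: "d m \<le> measure M (space M) * B\<^sup>2" for m
  proof -
    have "e (g m) \<le> (LINT x|M. B\<^sup>2)"
      unfolding e_def
    proof (rule integral_mono_AE)
      show "AE x in M. (norm (g m x))\<^sup>2 \<le> B\<^sup>2"
        using gb[of m] by eventually_elim (simp add: power_mono)
    qed (use int2[OF gm gb] in auto)
    then show ?thesis using dle[OF gA, of m] by simp
  qed
  have "convergent d"
  proof (rule Bseq_mono_convergent)
    have "\<bar>d m\<bar> \<le> measure M (space M) * B\<^sup>2 + \<bar>d 0\<bar>" for m
    proof -
      have "0 \<le> measure M (space M) * B\<^sup>2" by simp
      moreover have "d 0 \<le> d m" by (rule dmono) simp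
      ultimately show ?thesis using dub[of m] unfolding abs_le_iff by linarith
    qed
    then show "Bseq d" by (intro BseqI') auto
  qed (use dmono in auto)
  then have "Cauchy d" by (rule convergent_Cauchy)
  have par: "(LINT x|M. (norm (g m x - g n x))\<^sup>2) \<le> 2 * (d n - d m) + 4 / (real m + 1)" if "m \<le> n" for m n
  proof -
    let ?h = "\<lambda>x. (1/2) *\<^sub>R (g m x + g n x)"
    have hA: "?h \<in> A m" using mid[OF gA] gA[of n] decr[OF that] by blast
    have hm[measurable]: "?h \<in> borel_measurable M" by measurable
    have eq: "(norm (g m x - g n x))\<^sup>2 = 2 * (norm (g m x))\<^sup>2 + 2 * (norm (g n x))\<^sup>2 - 4 * (norm (?h x))\<^sup>2" for x
      by (simp add: power2_norm_eq_inner inner_simps inner_commute algebra_simps)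
    have "(LINT x|M. (norm (g m x - g n x))\<^sup>2) = 2 * e (g m) + 2 * e (g n) - 4 * e ?h"
      unfolding eq e_def
      using int2[OF gm gb, of m] int2[OF gm gb, of n] int2[OF hm bdd[OF hA]]
      by (simp del: norm_scaleR)
    also have "\<dots> \<le> 2 * (d m + 1 / (real m + 1)) + 2 * (d n + 1 / (real m + 1)) - 4 * d m"
    proof -
      have "1 / (real n + 1) \<le> 1 / (real m + 1)" using that by (simp add: frac_le)
      moreover have "2 * p + 2 * q - 4 * r \<le> 2 * (dm + u) + 2 * (dn + u) - 4 * dm"
        if "v \<le> u" "p < dm + u" "q < dn + v" "dm \<le> r" for p q r dm dn u v :: real
        using that by argo
      ultimately show ?thesis using ge[of m] ge[of n] dle[OF hA] by blast
    qed
    finally show ?thesis by (simp add: algebra_simps)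
  qed
  have gi: "integrable M (g m)" for m
    by (rule integrable_const_bound[OF gb gm])
  have "\<exists>N. \<forall>i\<ge>N. \<forall>j\<ge>N. LINT x|M. norm (g i x - g j x) < \<epsilon>" if "\<epsilon> > 0" for \<epsilon>
  proof -
    define \<mu> where "\<mu> = measure M (space M)"
    define \<eta> where "\<eta> = \<epsilon> / (2 * (\<mu> + 1))"
    have \<mu>: "\<mu> \<ge> 0" by (simp add: \<mu>_def)
    have \<eta>: "\<eta> > 0" "\<eta> * \<mu> \<le> \<epsilon> / 2"
      using that \<mu> by (auto simp: \<eta>_def divide_simps)
    have "\<epsilon> * \<eta> > 0" using that \<eta> by simp
    then obtain N1 where N1: "\<And>m n. m \<ge> N1 \<Longrightarrow> n \<ge> N1 \<Longrightarrow> \<bar>d m - d n\<bar> < \<epsilon> * \<eta> / 8"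
      using \<open>Cauchy d\<close> unfolding Cauchy_def dist_real_def by (metis divide_pos_pos zero_less_numeral)
    obtain N2 :: nat where N2: "4 / (\<epsilon> * \<eta> / 8) < real N2" using reals_Archimedean2 by blast
    have key: "LINT x|M. norm (g i x - g j x) < \<epsilon>" if "i \<ge> max N1 N2" "j \<ge> i" for i j
    proof -
      have "AE x in M. norm (g i x - g j x) \<le> B + B"
        using gb[of i] gb[of j] by eventually_elim (metis add_mono norm_triangle_ineq4 order_trans)
      note bd = this
      have i2: "integrable M (\<lambda>x. (norm (g i x - g j x))\<^sup>2)"
        by (rule int2[OF _ bd]) measurable
      \<comment> \<open>The mean of the norm is estimated by the mean of its square: the norm is at most \<open>\<eta>\<close> or at
        most its square over \<open>\<eta>\<close>.\<close>
      have ple: "norm (g i x - g j x) \<le> \<eta> + (norm (g i x - g j x))\<^sup>2 / \<eta>" for x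
      proof (cases "norm (g i x - g j x) \<le> \<eta>")
        case True then show ?thesis using \<eta> by (simp add: add_increasing2)
      next
        case False
        then have "norm (g i x - g j x) * \<eta> \<le> (norm (g i x - g j x))\<^sup>2"
          by (simp add: power2_eq_square mult_left_mono)
        then have "norm (g i x - g j x) \<le> (norm (g i x - g j x))\<^sup>2 / \<eta>"
          using \<eta>(1) by (simp add: pos_le_divide_eq)
        then show ?thesis using \<eta>(1) by linarith
      qed
      have "(LINT x|M. norm (g i x - g j x)) \<le> (LINT x|M. \<eta> + (norm (g i x - g j x))\<^sup>2 / \<eta>)"
        by (rule integral_mono) (use gi i2 ple in \<open>auto intro!: integrable_norm\<close>)
      also have "\<dots> = \<eta> * \<mu> + (LINT x|M. (norm (g i x - g j x))\<^sup>2) / \<eta>"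
        using i2 by (simp add: \<mu>_def)
      also have "\<dots> \<le> \<epsilon> / 2 + (2 * (d j - d i) + 4 / (real i + 1)) / \<eta>"
        using \<eta> par[OF \<open>j \<ge> i\<close>] by (intro add_mono divide_right_mono) auto
      also have "\<dots> < \<epsilon> / 2 + (\<epsilon> * \<eta> / 4 + \<epsilon> * \<eta> / 8) / \<eta>"
      proof -
        have "\<bar>d j - d i\<bar> < \<epsilon> * \<eta> / 8" by (rule N1) (use that in auto)
        then have a: "2 * (d j - d i) < \<epsilon> * \<eta> / 4" by argo
        have "4 / (\<epsilon> * \<eta> / 8) < real i + 1" using N2 that by simp
        then have "4 / (real i + 1) < \<epsilon> * \<eta> / 8"
          using \<open>\<epsilon> * \<eta> > 0\<close> by (simp add: field_simps)
        then have "2 * (d j - d i) + 4 / (real i + 1) < \<epsilon> * \<eta> / 4 + \<epsilon> * \<eta> / 8" using a by argo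
        then show ?thesis using \<eta>(1) by (intro add_strict_left_mono divide_strict_right_mono)
      qed
      also have "\<dots> < \<epsilon>" using \<eta> \<open>\<epsilon> > 0\<close> by (simp add: field_simps)
      finally show ?thesis .
    qed
    show ?thesis
    proof (intro exI[of _ "max N1 N2"] allI impI)
      fix i j assume "max N1 N2 \<le> i" "max N1 N2 \<le> j"
      then show "LINT x|M. norm (g i x - g j x) < \<epsilon>"
        using key[of i j] key[of j i] by (cases "i \<le> j") (auto simp: norm_minus_commute)
    qed
  qed
  from cauchy_L1_AE_cauchy_subseq[OF gi this]
  obtain r where r: "strict_mono r" "AE x in M. Cauchy (\<lambda>i. g (r i) x)" by blast
  have "AE x in M. (\<lambda>i. g (r i) x) \<longlonglongrightarrow> lim (\<lambda>i. g (r i) x)"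
    using r(2) by eventually_elim (simp add: Cauchy_convergent_iff convergent_LIMSEQ_iff)
  then show ?thesis
    using that[OF gA r(1), of "\<lambda>x. lim (\<lambda>i. g (r i) x)"] by simp
qed

lemma norm_integral_le_integral:
  fixes f :: "'a \<Rightarrow> 'b::{banach, second_countable_topology}"
  assumes "integrable M f" "integrable M g" "AE x in M. norm (f x) \<le> g x"
  shows "norm (LINT x|M. f x) \<le> (LINT x|M. g x)"
proof -
  have "norm (LINT x|M. f x) \<le> (LINT x|M. norm (f x))" by simp
  also have "\<dots> \<le> (LINT x|M. g x)" by (rule integral_mono_AE) (use assms in auto)
  finally show ?thesis .
qed

section \<open>Estimates for the weakly singular kernel\<close>

lemma bounded_bilinear_matrix_vector_mult:
  "bounded_bilinear ((*v) :: real^'n^'m \<Rightarrow> real^'n \<Rightarrow> real^'m)"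
  unfolding bilinear_conv_bounded_bilinear[symmetric] bilinear_def linear_iff
  by (auto simp: matrix_vector_mult_add_rdistrib matrix_vector_right_distrib
      scaleR_matrix_vector_assoc matrix_vector_mult_scaleR)

lemma bounded_bilinear_vector_matrix_mult:
  "bounded_bilinear ((v*) :: real^'m \<Rightarrow> real^'n^'m \<Rightarrow> real^'n)"
proof -
  have "bilinear ((v*) :: real^'m \<Rightarrow> real^'n^'m \<Rightarrow> real^'n)"
    unfolding bilinear_def linear_iff
    by (auto simp: vec_eq_iff vector_matrix_mult_def sum.distrib algebra_simps sum_distrib_left)
  then show ?thesis by (simp add: bilinear_conv_bounded_bilinear)
qed

lemma nonneg_has_integral_imp_lebesgue:
  fixes f :: "real \<Rightarrow> real"
  assumes "(f has_integral I) {a..b}" and "\<And>x. x \<in> {a..b} \<Longrightarrow> 0 \<le> f x"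
  shows "integrable (lebesgue_on {a..b}) f" "(LINT x|lebesgue_on {a..b}. f x) = I"
proof -
  have "f absolutely_integrable_on {a..b}"
    by (rule nonnegative_absolutely_integrable_1) (use assms in auto)
  then show i: "integrable (lebesgue_on {a..b}) f"
    by (rule absolutely_integrable_imp_integrable) simp
  show "(LINT x|lebesgue_on {a..b}. f x) = I"
    using lebesgue_integral_eq_integral[OF i] assms(1) by (simp add: integral_unique)
qed

text \<open>A kernel \<open>Kst \<tau> \<xi> / (\<tau> - \<xi>) powr (1 - \<alpha>)\<close> with \<open>Kst\<close> continuous on the closed triangle.\<close>
locale weakly_singular_kernel =
  fixes T \<alpha> :: real and K Kst :: "real \<Rightarrow> real \<Rightarrow> real ^ 'n ^ 'n"
  assumes T_pos: "T > 0" and \<alpha>_pos: "0 < \<alpha>" and \<alpha>_less_1: "\<alpha> < 1"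
    and K_eq: "\<And>\<tau> \<xi>. (\<tau>, \<xi>) \<in> open_triangle T \<Longrightarrow>
           K \<tau> \<xi> = (1 / (\<tau> - \<xi>) powr (1 - \<alpha>)) *\<^sub>R Kst \<tau> \<xi>"
    and Kst_cont: "continuous_on (closed_triangle T) (\<lambda>(\<tau>, \<xi>). Kst \<tau> \<xi>)"
begin

text \<open>The singular factor, set to zero off the triangle, and its primitive.\<close>
definition rho :: "real \<Rightarrow> real" where
  "rho u = (if u > 0 then u powr (\<alpha> - 1) else 0)"

definition Rho :: "real \<Rightarrow> real" where
  "Rho u = (if u > 0 then u powr \<alpha> / \<alpha> else 0)"

lemma rho_nonneg [simp]: "rho u \<ge> 0" by (simp add: rho_def)
lemma rho_nonpos [simp]: "u \<le> 0 \<Longrightarrow> rho u = 0" by (simp add: rho_def)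
lemma rho_pos: "u > 0 \<Longrightarrow> rho u > 0" by (simp add: rho_def)
lemma rho_antimono: "0 < u \<Longrightarrow> u \<le> v \<Longrightarrow> rho v \<le> rho u"
  using \<alpha>_less_1 by (simp add: rho_def powr_mono2')
lemma rho_measurable [measurable]: "rho \<in> borel_measurable borel"
  unfolding rho_def by measurable
lemma rho_eq_inverse: "0 < u \<Longrightarrow> rho u = 1 / u powr (1 - \<alpha>)"
  using powr_minus_divide[of u "1 - \<alpha>"] by (simp add: rho_def)

lemma Rho_nonneg [simp]: "Rho u \<ge> 0" using \<alpha>_pos by (simp add: Rho_def)
lemma Rho_nonpos [simp]: "u \<le> 0 \<Longrightarrow> Rho u = 0" by (simp add: Rho_def)
lemma Rho_mono: "u \<le> v \<Longrightarrow> Rho u \<le> Rho v"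
  using \<alpha>_pos unfolding Rho_def by (auto intro!: divide_right_mono powr_mono2)
lemma Rho_eq: "Rho u = max 0 u powr \<alpha> / \<alpha>"
  unfolding Rho_def by (cases "u > 0") simp_all
lemma continuous_on_Rho: "continuous_on S Rho"
proof -
  have "continuous_on S (\<lambda>u. max 0 u powr \<alpha> / \<alpha>)"
    by (intro continuous_intros continuous_on_powr') (use \<alpha>_pos in auto)
  then show ?thesis by (simp add: Rho_eq[abs_def])
qed
lemma Rho_tendsto: "(f \<longlongrightarrow> l) F \<Longrightarrow> ((\<lambda>x. Rho (f x)) \<longlongrightarrow> Rho l) F"
  by (rule continuous_on_tendsto_compose[OF continuous_on_Rho[of UNIV]]) auto

lemma Rho_has_derivative: "u \<noteq> 0 \<Longrightarrow> (Rho has_real_derivative rho u) (at u)"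
proof (cases "u > 0")
  case True
  have "((\<lambda>u. u powr \<alpha> / \<alpha>) has_real_derivative rho u) (at u)"
    using True \<alpha>_pos by (auto intro!: derivative_eq_intros simp: rho_def)
  moreover have "eventually (\<lambda>v. v \<in> {0<..}) (nhds u)"
    by (rule eventually_nhds_in_open) (use True in auto)
  then have ev: "eventually (\<lambda>v. Rho v = v powr \<alpha> / \<alpha>) (nhds u)"
    by eventually_elim (simp add: Rho_def)
  ultimately show ?thesis using DERIV_cong_ev[OF refl ev refl] by blast
next
  case False
  assume "u \<noteq> 0"
  with False have u: "u < 0" by simp
  have "eventually (\<lambda>v. v \<in> {..<0}) (nhds u)"
    by (rule eventually_nhds_in_open) (use u in auto)
  then have ev: "eventually (\<lambda>v. Rho v = 0) (nhds u)"
    by eventually_elim simp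
  moreover have "((\<lambda>_. 0) has_real_derivative rho u) (at u)" using u by simp
  ultimately show ?thesis using DERIV_cong_ev[OF refl ev refl] by blast
qed

lemma rho_right_has_integral:
  assumes "a \<le> b" shows "((\<lambda>s. rho (s - t)) has_integral (Rho (b - t) - Rho (a - t))) {a..b}"
proof (rule fundamental_theorem_of_calculus_interior_strong[where S = "{t}"])
  show "((\<lambda>s. Rho (s - t)) has_vector_derivative rho (x - t)) (at x)" if "x \<in> {a<..<b} - {t}" for x
  proof -
    have "((\<lambda>s. Rho (s - t)) has_real_derivative rho (x - t) * 1) (at x)"
      by (rule DERIV_chain2[where f = Rho and g = "\<lambda>s. s - t", OF Rho_has_derivative])
         (use that in \<open>auto intro!: derivative_eq_intros\<close>)
    then show ?thesis by (simp add: has_real_derivative_iff_has_vector_derivative)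
  qed
  show "continuous_on {a..b} (\<lambda>s. Rho (s - t))"
    by (rule continuous_on_compose2[OF continuous_on_Rho[of UNIV]]) (auto intro!: continuous_intros)
qed (use assms in auto)

lemma rho_left_has_integral:
  assumes "a \<le> b" shows "((\<lambda>\<xi>. rho (\<tau> - \<xi>)) has_integral (Rho (\<tau> - a) - Rho (\<tau> - b))) {a..b}"
  using rho_right_has_integral[of "-b" "-a" "-\<tau>"] assms
    has_integral_reflect_real[of "\<lambda>s. rho (s + \<tau>)" "Rho (\<tau> - a) - Rho (\<tau> - b)" "-a" "-b"]
  by (simp add: algebra_simps)

lemma rho_left_lebesgue:
  assumes "a \<le> b"
  shows "integrable (lebesgue_on {a..b}) (\<lambda>\<xi>. rho (\<tau> - \<xi>))"
    "(LINT \<xi>|lebesgue_on {a..b}. rho (\<tau> - \<xi>)) = Rho (\<tau> - a) - Rho (\<tau> - b)"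
  using nonneg_has_integral_imp_lebesgue[OF rho_left_has_integral[OF assms]] by auto

lemma rho_right_lebesgue:
  assumes "a \<le> b"
  shows "integrable (lebesgue_on {a..b}) (\<lambda>s. rho (s - t))"
    "(LINT s|lebesgue_on {a..b}. rho (s - t)) = Rho (b - t) - Rho (a - t)"
  using nonneg_has_integral_imp_lebesgue[OF rho_right_has_integral[OF assms]] by auto

text \<open>Translation is continuous in the mean for \<open>rho\<close>, with an explicit modulus.\<close>
lemma rho_left_diff_has_integral:
  assumes "a \<le> \<tau>" "\<tau> \<le> \<tau>'" "\<tau>' \<le> b"
  shows "((\<lambda>\<xi>. \<bar>rho (\<tau> - \<xi>) - rho (\<tau>' - \<xi>)\<bar>) has_integral
          (Rho (\<tau> - a) - Rho (\<tau>' - a) + 2 * Rho (\<tau>' - \<tau>))) {a..b}"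
proof -
  have "((\<lambda>\<xi>. rho (\<tau> - \<xi>) - rho (\<tau>' - \<xi>)) has_integral
      ((Rho (\<tau> - a) - Rho (\<tau> - \<tau>)) - (Rho (\<tau>' - a) - Rho (\<tau>' - \<tau>)))) {a..\<tau>}"
    by (intro has_integral_diff rho_left_has_integral assms)
  then have 1: "((\<lambda>\<xi>. \<bar>rho (\<tau> - \<xi>) - rho (\<tau>' - \<xi>)\<bar>) has_integral
      ((Rho (\<tau> - a) - Rho (\<tau> - \<tau>)) - (Rho (\<tau>' - a) - Rho (\<tau>' - \<tau>)))) {a..\<tau>}"
  proof (rule has_integral_spike_finite[where S = "{\<tau>}", rotated 2])
    show "\<bar>rho (\<tau> - x) - rho (\<tau>' - x)\<bar> = rho (\<tau> - x) - rho (\<tau>' - x)" if "x \<in> {a..\<tau>} - {\<tau>}" for x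
      using rho_antimono[of "\<tau> - x" "\<tau>' - x"] that assms by simp
  qed (use assms in auto)
  have "((\<lambda>\<xi>. rho (\<tau>' - \<xi>)) has_integral (Rho (\<tau>' - \<tau>) - Rho (\<tau>' - b))) {\<tau>..b}"
    by (rule rho_left_has_integral) (use assms in simp)
  then have "((\<lambda>\<xi>. \<bar>rho (\<tau> - \<xi>) - rho (\<tau>' - \<xi>)\<bar>) has_integral (Rho (\<tau>' - \<tau>))) {\<tau>..b}"
    by (rule has_integral_eq_rhs[OF has_integral_eq[rotated]]) (use assms in auto)
  from has_integral_combine[OF _ _ 1 this] show ?thesis
    using assms by (simp add: algebra_simps)
qed

lemma rho_left_diff_lebesgue:
  assumes "\<tau> \<in> {0..T}" "\<tau>' \<in> {0..T}"
  shows "integrable (lebesgue_on {0..T}) (\<lambda>\<xi>. \<bar>rho (\<tau> - \<xi>) - rho (\<tau>' - \<xi>)\<bar>)"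
    "(LINT \<xi>|lebesgue_on {0..T}. \<bar>rho (\<tau> - \<xi>) - rho (\<tau>' - \<xi>)\<bar>) \<le> 2 * Rho \<bar>\<tau> - \<tau>'\<bar>"
proof -
  have *: "integrable (lebesgue_on {0..T}) (\<lambda>\<xi>. \<bar>rho (\<tau> - \<xi>) - rho (\<tau>' - \<xi>)\<bar>) \<and>
    (LINT \<xi>|lebesgue_on {0..T}. \<bar>rho (\<tau> - \<xi>) - rho (\<tau>' - \<xi>)\<bar>) \<le> 2 * Rho \<bar>\<tau> - \<tau>'\<bar>"
    if "0 \<le> \<tau>" "\<tau> \<le> \<tau>'" "\<tau>' \<le> T" for \<tau> \<tau>'
    using nonneg_has_integral_imp_lebesgue[OF rho_left_diff_has_integral[OF that]]
      Rho_mono[of \<tau> \<tau>'] that by simp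
  show "integrable (lebesgue_on {0..T}) (\<lambda>\<xi>. \<bar>rho (\<tau> - \<xi>) - rho (\<tau>' - \<xi>)\<bar>)"
    "(LINT \<xi>|lebesgue_on {0..T}. \<bar>rho (\<tau> - \<xi>) - rho (\<tau>' - \<xi>)\<bar>) \<le> 2 * Rho \<bar>\<tau> - \<tau>'\<bar>"
    using *[of \<tau> \<tau>'] *[of \<tau>' \<tau>] assms by (cases "\<tau> \<le> \<tau>'"; simp add: abs_minus_commute)+
qed

lemma rho_right_diff_lebesgue:
  assumes "t \<in> {0..T}" "t' \<in> {0..T}"
  shows "integrable (lebesgue_on {0..T}) (\<lambda>s. \<bar>rho (s - t) - rho (s - t')\<bar>)"
    "(LINT s|lebesgue_on {0..T}. \<bar>rho (s - t) - rho (s - t')\<bar>) \<le> 2 * Rho \<bar>t - t'\<bar>"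
proof -
  have *: "integrable (lebesgue_on {0..T}) (\<lambda>s. \<bar>rho (s - t) - rho (s - t')\<bar>) \<and>
    (LINT s|lebesgue_on {0..T}. \<bar>rho (s - t) - rho (s - t')\<bar>) \<le> 2 * Rho \<bar>t - t'\<bar>"
    if "0 \<le> t'" "t' \<le> t" "t \<le> T" for t t'
  proof -
    have "((\<lambda>s. \<bar>rho (s - t) - rho (s - t')\<bar>) has_integral
        (Rho (T - t) - Rho (T - t') + 2 * Rho (t - t'))) {0..T}"
      using rho_left_diff_has_integral[of "-T" "-t" "-t'" 0] that
        has_integral_reflect_real[of "\<lambda>s. \<bar>rho (- t - s) - rho (- t' - s)\<bar>"
          "Rho (T - t) - Rho (T - t') + 2 * Rho (t - t')" 0 "-T"]
      by (simp add: algebra_simps)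
    from nonneg_has_integral_imp_lebesgue[OF this] show ?thesis
      using Rho_mono[of "T - t" "T - t'"] that by simp
  qed
  show "integrable (lebesgue_on {0..T}) (\<lambda>s. \<bar>rho (s - t) - rho (s - t')\<bar>)"
    "(LINT s|lebesgue_on {0..T}. \<bar>rho (s - t) - rho (s - t')\<bar>) \<le> 2 * Rho \<bar>t - t'\<bar>"
    using *[of t' t] *[of t t'] assms by (cases "t \<le> t'"; simp add: abs_minus_commute)+
qed

lemma rho_lipschitz:
  assumes "0 < \<eta>" "\<eta> \<le> u" "\<eta> \<le> v" shows "\<bar>rho u - rho v\<bar> \<le> rho \<eta> / \<eta> * \<bar>u - v\<bar>"
proof -
  have *: "\<bar>rho u - rho v\<bar> \<le> rho \<eta> / \<eta> * \<bar>u - v\<bar>" if "\<eta> \<le> u" "u \<le> v" for u v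
  proof -
    have u: "0 < u" "0 < v" using that assms by auto
    \<comment> \<open>since \<open>u / v \<le> 1\<close> and \<open>1 - \<alpha> \<le> 1\<close>\<close>
    have "u / v \<le> (u / v) powr (1 - \<alpha>)"
      using powr_mono'[of "1 - \<alpha>" 1 "u / v"] u that \<alpha>_pos by (simp add: powr_one_gt_zero_iff)
    moreover have "rho v = rho u * (u / v) powr (1 - \<alpha>)"
      using u by (simp add: rho_eq_inverse powr_divide)
    ultimately have "rho u * (u / v) \<le> rho v" by (metis mult_left_mono rho_nonneg)
    then have "rho u - rho v \<le> rho u * (1 - u / v)" by (simp add: right_diff_distrib)
    also have "\<dots> = rho u * ((v - u) / v)" using u by (simp add: field_simps)
    also have "\<dots> \<le> rho \<eta> * ((v - u) / \<eta>)"
      using rho_antimono[OF \<open>0 < \<eta>\<close> \<open>\<eta> \<le> u\<close>] that assms u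
      by (intro mult_mono divide_left_mono) auto
    finally show ?thesis using rho_antimono[OF u(1) that(2)] that by simp
  qed
  show ?thesis using *[of u v] *[of v u] assms by (cases "u \<le> v") (auto simp: abs_minus_commute)
qed

text \<open>The two singularities of \<open>rho (T - s) * rho (s - t)\<close> are at distance at least \<open>2 * \<eta>\<close>, so at each
  \<open>s\<close> one of the factors is at most \<open>rho \<eta>\<close>.\<close>
lemma rho_product_le:
  assumes "0 < \<eta>" "t \<le> T - 2 * \<eta>"
  shows "rho (T - s) * rho (s - t) \<le> rho \<eta> * (rho (T - s) + rho (s - t))"
proof (cases "t < s \<and> s < T")
  case True
  show ?thesis
  proof (cases "\<eta> \<le> T - s")
    case True
    have "rho (T - s) * rho (s - t) \<le> rho \<eta> * rho (s - t)"
      by (intro mult_right_mono rho_antimono assms True) simp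
    then show ?thesis by (simp add: distrib_left add_increasing)
  next
    case False
    have "rho (T - s) * rho (s - t) \<le> rho (T - s) * rho \<eta>"
      by (intro mult_left_mono rho_antimono assms) (use False assms in auto)
    then show ?thesis by (simp add: distrib_left add_increasing2 mult.commute)
  qed
qed auto

lemma rho_product_diff_le:
  assumes "0 < \<eta>" "t \<le> T - 2 * \<eta>" "t' \<le> T - 2 * \<eta>"
  shows "rho (T - s) * \<bar>rho (s - t) - rho (s - t')\<bar>
    \<le> rho \<eta> * \<bar>rho (s - t) - rho (s - t')\<bar> + rho (T - s) * (rho \<eta> / \<eta> * \<bar>t - t'\<bar>)"
proof (cases "\<eta> \<le> T - s")
  case True
  have "rho (T - s) * \<bar>rho (s - t) - rho (s - t')\<bar> \<le> rho \<eta> * \<bar>rho (s - t) - rho (s - t')\<bar>"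
    by (intro mult_right_mono rho_antimono assms True) simp
  moreover have "0 \<le> rho (T - s) * (rho \<eta> / \<eta> * \<bar>t - t'\<bar>)" using assms by simp
  ultimately show ?thesis by linarith
next
  case False
  have "rho (T - s) * \<bar>rho (s - t) - rho (s - t')\<bar> \<le> rho (T - s) * (rho \<eta> / \<eta> * \<bar>t - t'\<bar>)"
    using rho_lipschitz[OF assms(1), of "s - t" "s - t'"] False assms
    by (intro mult_left_mono) (auto simp: abs_minus_commute)
  moreover have "0 \<le> rho \<eta> * \<bar>rho (s - t) - rho (s - t')\<bar>" by simp
  ultimately show ?thesis by linarith
qed

text \<open>Lebesgue measure on the time interval \<open>[0,T]\<close>.\<close>
abbreviation "I0 \<equiv> lebesgue_on {0..T}"

lemma rho_comp_measurable [measurable]: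
  "(\<lambda>s. rho (s - t)) \<in> borel_measurable I0" "(\<lambda>s. rho (\<tau> - s)) \<in> borel_measurable I0"
  using rho_right_lebesgue(1)[of 0 T t] rho_left_lebesgue(1)[of 0 T \<tau>] T_pos by auto

lemma rho_product_integrable:
  assumes "0 < \<eta>" "t \<le> T - 2 * \<eta>"
  shows "integrable I0 (\<lambda>s. rho (T - s) * rho (s - t))"
  by (rule Bochner_Integration.integrable_bound[of _ "\<lambda>s. rho \<eta> * (rho (T - s) + rho (s - t))"])
     (use rho_product_le[OF assms] T_pos in \<open>auto intro!: rho_left_lebesgue rho_right_lebesgue\<close>)

lemma rho_product_integral_le:
  assumes "0 < \<eta>" "0 \<le> t" "t \<le> T - 2 * \<eta>"
  shows "(LINT s|I0. rho (T - s) * rho (s - t)) \<le> rho \<eta> * (2 * Rho T)"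
proof -
  have "(LINT s|I0. rho (T - s) * rho (s - t)) \<le> (LINT s|I0. rho \<eta> * (rho (T - s) + rho (s - t)))"
    by (rule integral_mono)
       (use rho_product_le rho_product_integrable assms T_pos in
        \<open>auto intro!: rho_left_lebesgue rho_right_lebesgue\<close>)
  also have "\<dots> = rho \<eta> * (Rho T + Rho (T - t))"
    using rho_left_lebesgue[of 0 T T] rho_right_lebesgue[of 0 T t] T_pos assms by simp
  also have "\<dots> \<le> rho \<eta> * (2 * Rho T)"
    using Rho_mono[of "T - t" T] assms by (intro mult_left_mono) auto
  finally show ?thesis .
qed

lemma rho_product_diff_integral_le:
  assumes "0 < \<eta>" "0 \<le> t" "t \<le> T - 2 * \<eta>" "0 \<le> t'" "t' \<le> T - 2 * \<eta>"
  shows "integrable I0 (\<lambda>s. rho (T - s) * \<bar>rho (s - t) - rho (s - t')\<bar>)"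
    "(LINT s|I0. rho (T - s) * \<bar>rho (s - t) - rho (s - t')\<bar>)
      \<le> rho \<eta> * (2 * Rho \<bar>t - t'\<bar>) + Rho T * (rho \<eta> / \<eta> * \<bar>t - t'\<bar>)"
proof -
  note i = rho_right_diff_lebesgue[of t t'] rho_left_lebesgue[of 0 T T]
  have tt: "t \<in> {0..T}" "t' \<in> {0..T}" "0 \<le> T" using assms by auto
  let ?g = "\<lambda>s. rho \<eta> * \<bar>rho (s - t) - rho (s - t')\<bar> + rho (T - s) * (rho \<eta> / \<eta> * \<bar>t - t'\<bar>)"
  have ig: "integrable I0 ?g" using i tt by (intro Bochner_Integration.integrable_add) auto
  show ii: "integrable I0 (\<lambda>s. rho (T - s) * \<bar>rho (s - t) - rho (s - t')\<bar>)"
    by (rule Bochner_Integration.integrable_bound[OF ig])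
       (use rho_product_diff_le[OF assms(1,3,5)] in \<open>auto intro!: AE_I2 order_trans[OF _ abs_ge_self]\<close>)
  have "(LINT s|I0. rho (T - s) * \<bar>rho (s - t) - rho (s - t')\<bar>) \<le> (LINT s|I0. ?g s)"
    by (rule integral_mono[OF ii ig]) (rule rho_product_diff_le[OF assms(1,3,5)])
  also have "\<dots> = rho \<eta> * (LINT s|I0. \<bar>rho (s - t) - rho (s - t')\<bar>) + Rho T * (rho \<eta> / \<eta> * \<bar>t - t'\<bar>)"
    using i tt by simp
  also have "\<dots> \<le> rho \<eta> * (2 * Rho \<bar>t - t'\<bar>) + Rho T * (rho \<eta> / \<eta> * \<bar>t - t'\<bar>)"
    using i tt by (intro add_right_mono mult_left_mono) auto
  finally show "(LINT s|I0. rho (T - s) * \<bar>rho (s - t) - rho (s - t')\<bar>)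
      \<le> rho \<eta> * (2 * Rho \<bar>t - t'\<bar>) + Rho T * (rho \<eta> / \<eta> * \<bar>t - t'\<bar>)" .
qed

text \<open>The nearest point of \<open>[0,T]\<close>.\<close>
definition clampT :: "real \<Rightarrow> real" where "clampT x = max 0 (min x T)"

text \<open>A continuous extension of \<open>Kst\<close> from the closed triangle to the plane.\<close>
definition Ke :: "real \<Rightarrow> real \<Rightarrow> real ^ 'n ^ 'n" where
  "Ke \<tau> \<xi> = Kst (max (clampT \<tau>) (clampT \<xi>)) (clampT \<xi>)"

lemma continuous_Ke: "continuous_on S (\<lambda>(\<tau>, \<xi>). Ke \<tau> \<xi>)"
proof -
  have "continuous_on S (\<lambda>p. (\<lambda>(\<tau>, \<xi>). Kst \<tau> \<xi>) (max (clampT (fst p)) (clampT (snd p)), clampT (snd p)))"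
    by (rule continuous_on_compose2[OF Kst_cont])
       (use T_pos in \<open>auto intro!: continuous_intros simp: clampT_def closed_triangle_def\<close>)
  then show ?thesis unfolding Ke_def case_prod_unfold by simp
qed

lemma Ke_measurable [measurable]: "(\<lambda>(\<tau>, \<xi>). Ke \<tau> \<xi>) \<in> borel_measurable borel"
  by (rule borel_measurable_continuous_onI[OF continuous_Ke])

lemma Ke_tendsto: "(f \<longlongrightarrow> a) F \<Longrightarrow> (g \<longlongrightarrow> b) F \<Longrightarrow> ((\<lambda>x. Ke (f x) (g x)) \<longlongrightarrow> Ke a b) F"
  using continuous_on_tendsto_compose[OF continuous_Ke[of UNIV], of "\<lambda>x. (f x, g x)" "(a, b)" F]
  by (simp add: tendsto_Pair)

lemma Ke_eq: "0 \<le> \<xi> \<Longrightarrow> \<xi> \<le> \<tau> \<Longrightarrow> \<tau> \<le> T \<Longrightarrow> Ke \<tau> \<xi> = Kst \<tau> \<xi>"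
  by (simp add: Ke_def clampT_def)

lemma Ke_bounded: "\<exists>C>0. \<forall>\<tau> \<xi> v. norm (Ke \<tau> \<xi> *v v) \<le> C * norm v \<and> norm (v v* Ke \<tau> \<xi>) \<le> C * norm v"
proof -
  have "closed_triangle T = (\<lambda>(a, b). (max a b, b)) ` ({0..T} \<times> {0..T})"
  proof (intro equalityI subsetI)
    fix p assume "p \<in> closed_triangle T"
    then show "p \<in> (\<lambda>(a, b). (max a b, b)) ` ({0..T} \<times> {0..T})"
      by (intro image_eqI[of _ _ p]) (auto simp: closed_triangle_def)
  qed (auto simp: closed_triangle_def)
  moreover have "compact ((\<lambda>(a::real, b::real). (max a b, b)) ` ({0..T} \<times> {0..T}))"
    by (intro compact_continuous_image compact_Times)
       (auto simp: case_prod_unfold intro!: continuous_intros)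
  ultimately have "compact ((\<lambda>(\<tau>, \<xi>). Kst \<tau> \<xi>) ` closed_triangle T)"
    using compact_continuous_image[OF Kst_cont] by simp
  then obtain B where B: "\<And>p. p \<in> closed_triangle T \<Longrightarrow> norm (Kst (fst p) (snd p)) \<le> B"
    using compact_imp_bounded[of "(\<lambda>(\<tau>, \<xi>). Kst \<tau> \<xi>) ` closed_triangle T"]
    unfolding bounded_iff by (auto simp: case_prod_unfold)
  have KeB: "norm (Ke \<tau> \<xi>) \<le> B" for \<tau> \<xi>
    unfolding Ke_def using T_pos
    by (intro B[of "(_, _)", simplified]) (auto simp: closed_triangle_def clampT_def)
  obtain C1 where C1: "C1 > 0" "\<And>A :: real^'n^'n. \<And>v. norm (A *v v) \<le> norm A * norm v * C1"
    using bounded_bilinear.pos_bounded[OF bounded_bilinear_matrix_vector_mult] by blast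
  obtain C2 where C2: "C2 > 0" "\<And>A :: real^'n^'n. \<And>v. norm (v v* A) \<le> norm v * norm A * C2"
    using bounded_bilinear.pos_bounded[OF bounded_bilinear_vector_matrix_mult] by blast
  have B0: "B \<ge> 0" using KeB norm_ge_zero order_trans by blast
  show ?thesis
  proof (intro exI[of _ "(B + 1) * (C1 + C2)"] conjI allI)
    fix \<tau> \<xi> and v :: "real^'n"
    have "norm (Ke \<tau> \<xi>) * norm v * C1 \<le> (B + 1) * norm v * (C1 + C2)"
      "norm v * norm (Ke \<tau> \<xi>) * C2 \<le> norm v * (B + 1) * (C1 + C2)"
      using KeB[of \<tau> \<xi>] C1(1) C2(1) B0 by (intro mult_mono; simp)+
    then show "norm (Ke \<tau> \<xi> *v v) \<le> (B + 1) * (C1 + C2) * norm v"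
      "norm (v v* Ke \<tau> \<xi>) \<le> (B + 1) * (C1 + C2) * norm v"
      using C1(2)[of "Ke \<tau> \<xi>" v] C2(2)[of v "Ke \<tau> \<xi>"] by (simp_all add: mult_ac)
  qed (use B0 C1 C2 in auto)
qed

text \<open>A common bound of the operator norms of the matrices \<open>Ke \<tau> \<xi>\<close> and of their transposes.\<close>
definition CK :: real where
  "CK = (SOME C. C > 0 \<and> (\<forall>\<tau> \<xi> v. norm (Ke \<tau> \<xi> *v v) \<le> C * norm v \<and> norm (v v* Ke \<tau> \<xi>) \<le> C * norm v))"

lemma CK_pos: "CK > 0"
  and Ke_mv_le: "norm (Ke \<tau> \<xi> *v v) \<le> CK * norm v"
  and Ke_vm_le: "norm (v v* Ke \<tau> \<xi>) \<le> CK * norm v"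
  using someI_ex[OF Ke_bounded] unfolding CK_def[symmetric] by auto

end

section \<open>The Volterra operator and positions\<close>

lemma matrix_vector_mult_measurable [measurable]:
  fixes f :: "'a \<Rightarrow> real^'n^'m"
  assumes "f \<in> borel_measurable M" "g \<in> borel_measurable M"
  shows "(\<lambda>x. f x *v g x) \<in> borel_measurable M"
  using assms
  by (rule borel_measurable_continuous_Pair)
     (intro bounded_bilinear.continuous_on[OF bounded_bilinear_matrix_vector_mult] continuous_intros)

lemma vector_matrix_mult_measurable [measurable]:
  fixes f :: "'a \<Rightarrow> real^'n^'m"
  assumes "g \<in> borel_measurable M" "f \<in> borel_measurable M"
  shows "(\<lambda>x. g x v* f x) \<in> borel_measurable M"
  using assms
  by (rule borel_measurable_continuous_Pair)
     (intro bounded_bilinear.continuous_on[OF bounded_bilinear_vector_matrix_mult] continuous_intros)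

lemma AE_lebesgue_on_neq: "S \<in> sets lebesgue \<Longrightarrow> AE x in lebesgue_on S. x \<noteq> (a::real)"
  using AE_completion[OF AE_lborel_singleton[of a]] by (auto simp: AE_restrict_space_iff elim!: eventually_mono)

lemma Linf_iff: "l \<in> Linf t \<longleftrightarrow> l \<in> borel_measurable (lebesgue_on {0..t}) \<and>
    (\<exists>M. AE \<xi> in lebesgue_on {0..t}. norm (l \<xi>) \<le> M)"
  by (simp add: Linf_def)

lemma Linf_measurable [measurable_dest]: "l \<in> Linf t \<Longrightarrow> l \<in> borel_measurable (lebesgue_on {0..t})"
  by (simp add: Linf_def)

lemma Linf_bound:
  assumes "l \<in> Linf t" obtains M where "M > 0" "AE \<xi> in lebesgue_on {0..t}. norm (l \<xi>) \<le> M"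
proof -
  obtain M where "AE \<xi> in lebesgue_on {0..t}. norm (l \<xi>) \<le> M" using assms by (auto simp: Linf_def)
  then have "AE \<xi> in lebesgue_on {0..t}. norm (l \<xi>) \<le> max M 1" by eventually_elim auto
  then show thesis using that[of "max M 1"] by simp
qed

lemma Linf_subinterval:
  assumes "l \<in> Linf t" "s \<le> t" shows "l \<in> Linf s"
proof -
  obtain M where "AE \<xi> in lebesgue_on {0..t}. norm (l \<xi>) \<le> M" using assms by (auto simp: Linf_def)
  then have "AE \<xi> in lebesgue_on {0..s}. norm (l \<xi>) \<le> M"
    using assms(2) by (auto simp: AE_restrict_space_iff elim!: eventually_mono)
  moreover have "l \<in> borel_measurable (lebesgue_on {0..s})"
    by (rule measurable_restrict_mono[OF Linf_measurable[OF assms(1)]]) (use assms(2) in auto)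
  ultimately show ?thesis by (auto simp: Linf_def)
qed

lemma Linf_const [simp]: "(\<lambda>_. c) \<in> Linf t"
  by (auto simp: Linf_def)

text \<open>Truncation of a function at time \<open>t\<close>: zero after \<open>t\<close>.\<close>
definition cut :: "real \<Rightarrow> (real \<Rightarrow> 'b) \<Rightarrow> real \<Rightarrow> 'b::zero" where
  "cut t l = (\<lambda>\<xi>. if \<xi> \<le> t then l \<xi> else 0)"

lemma cut_Linf:
  assumes "l \<in> Linf t" "t \<le> T" shows "cut t l \<in> Linf T"
proof -
  obtain M where M: "M > 0" "AE \<xi> in lebesgue_on {0..t}. norm (l \<xi>) \<le> M" using Linf_bound[OF assms(1)] .
  have "(\<lambda>x. if x \<in> {0..t} then l x else 0) \<in> borel_measurable lebesgue"
    using Linf_measurable[OF assms(1)] by (subst borel_measurable_if) auto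
  then have "(\<lambda>x. if x \<in> {0..t} then l x else 0) \<in> borel_measurable (lebesgue_on {0..T})"
    by (rule measurable_restrict_space1)
  moreover have "(\<lambda>x. if x \<in> {0..t} then l x else 0) \<in> borel_measurable (lebesgue_on {0..T})
      \<longleftrightarrow> cut t l \<in> borel_measurable (lebesgue_on {0..T})"
    by (rule measurable_cong) (auto simp: cut_def)
  moreover have "AE \<xi> in lebesgue_on {0..T}. norm (cut t l \<xi>) \<le> M"
    using M by (auto simp: AE_restrict_space_iff cut_def elim!: eventually_mono)
  ultimately show ?thesis by (auto simp: Linf_def)
qed

lemma cut_Linf': "l \<in> Linf T \<Longrightarrow> t \<le> T \<Longrightarrow> cut t l \<in> Linf T"
  by (rule cut_Linf[OF Linf_subinterval])

context weakly_singular_kernel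
begin

text \<open>The kernel on the whole plane, zero for \<open>\<xi> \<ge> \<tau>\<close>.\<close>
definition kern :: "real \<Rightarrow> real \<Rightarrow> real ^ 'n ^ 'n" where
  "kern \<tau> \<xi> = rho (\<tau> - \<xi>) *\<^sub>R Ke \<tau> \<xi>"

text \<open>The Volterra operator with integration over all of \<open>[0,T]\<close>; the kernel vanishes for \<open>\<xi> \<ge> \<tau>\<close>.\<close>
definition J :: "(real \<Rightarrow> real ^ 'n) \<Rightarrow> real \<Rightarrow> real ^ 'n" where
  "J l \<tau> = (LINT \<xi>|I0. kern \<tau> \<xi> *v l \<xi>)"

lemma ident_measurable_I0 [measurable]: "(\<lambda>x. x) \<in> borel_measurable I0"
  using id_borel_measurable_lebesgue_on[of "{0..T}"] by (simp add: id_def)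

lemma Ke_right_measurable [measurable]: "(\<lambda>\<xi>. Ke \<tau> \<xi>) \<in> borel_measurable I0"
proof -
  have "(\<lambda>\<xi>. (\<lambda>(\<tau>, \<xi>). Ke \<tau> \<xi>) (\<tau>, \<xi>)) \<in> borel_measurable I0"
    by (rule measurable_compose[OF _ Ke_measurable]) (simp add: borel_prod[symmetric])
  then show ?thesis by simp
qed

lemma Ke_left_measurable [measurable]: "(\<lambda>s. Ke s \<xi>) \<in> borel_measurable I0"
proof -
  have "(\<lambda>s. (\<lambda>(\<tau>, \<xi>). Ke \<tau> \<xi>) (s, \<xi>)) \<in> borel_measurable I0"
    by (rule measurable_compose[OF _ Ke_measurable]) (simp add: borel_prod[symmetric])
  then show ?thesis by simp
qed

lemma kern_measurable [measurable]: "(\<lambda>\<xi>. kern \<tau> \<xi>) \<in> borel_measurable I0"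
  unfolding kern_def by measurable

lemma kern_mv_eq: "kern \<tau> \<xi> *v v = rho (\<tau> - \<xi>) *\<^sub>R (Ke \<tau> \<xi> *v v)"
  by (simp add: kern_def scaleR_matrix_vector_assoc)

lemma kern_mv_le: "norm (kern \<tau> \<xi> *v v) \<le> CK * (rho (\<tau> - \<xi>) * norm v)"
  using mult_left_mono[OF Ke_mv_le[of \<tau> \<xi> v] rho_nonneg[of "\<tau> - \<xi>"]]
  by (simp add: kern_mv_eq mult_ac)

lemma rho_norm_integrable:
  assumes "l \<in> Linf T" shows "integrable I0 (\<lambda>\<xi>. rho (\<tau> - \<xi>) * norm (l \<xi>))"
proof -
  note [measurable] = Linf_measurable[OF assms]
  obtain M where M: "M > 0" "AE \<xi> in I0. norm (l \<xi>) \<le> M" using Linf_bound[OF assms] .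
  show ?thesis
  proof (rule Bochner_Integration.integrable_bound[of _ "\<lambda>\<xi>. rho (\<tau> - \<xi>) * M"])
    show "AE \<xi> in I0. norm (rho (\<tau> - \<xi>) * norm (l \<xi>)) \<le> norm (rho (\<tau> - \<xi>) * M)"
      using M(2) by eventually_elim (use M(1) in \<open>simp add: abs_mult mult_left_mono\<close>)
  qed (use rho_left_lebesgue[of 0 T \<tau>] T_pos in auto)
qed

lemma J_integrable:
  assumes "l \<in> Linf T" shows "integrable I0 (\<lambda>\<xi>. kern \<tau> \<xi> *v l \<xi>)"
proof -
  note [measurable] = Linf_measurable[OF assms]
  show ?thesis
    by (rule Bochner_Integration.integrable_bound[of _ "\<lambda>\<xi>. CK * (rho (\<tau> - \<xi>) * norm (l \<xi>))"])
       (use kern_mv_le CK_pos rho_norm_integrable[OF assms] in \<open>auto simp: abs_mult\<close>)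
qed

lemma J_norm_le:
  assumes "l \<in> Linf T" shows "norm (J l \<tau>) \<le> CK * (LINT \<xi>|I0. rho (\<tau> - \<xi>) * norm (l \<xi>))"
proof -
  have "norm (J l \<tau>) \<le> (LINT \<xi>|I0. norm (kern \<tau> \<xi> *v l \<xi>))"
    unfolding J_def by (rule integral_norm_bound)
  also have "\<dots> \<le> (LINT \<xi>|I0. CK * (rho (\<tau> - \<xi>) * norm (l \<xi>)))"
    by (rule integral_mono) (use J_integrable rho_norm_integrable assms kern_mv_le in auto)
  finally show ?thesis by simp
qed

lemma rho_norm_integral_le:
  assumes "l \<in> Linf T" "AE \<xi> in I0. norm (l \<xi>) \<le> M" and M: "0 \<le> M" and \<tau>: "\<tau> \<in> {0..T}"
  shows "(LINT \<xi>|I0. rho (\<tau> - \<xi>) * norm (l \<xi>)) \<le> Rho T * M"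
proof -
  have T: "0 \<le> T" using T_pos by simp
  have "(LINT \<xi>|I0. rho (\<tau> - \<xi>) * norm (l \<xi>)) \<le> (LINT \<xi>|I0. rho (\<tau> - \<xi>) * M)"
  proof (rule integral_mono_AE[OF rho_norm_integrable[OF assms(1)]])
    show "AE \<xi> in I0. rho (\<tau> - \<xi>) * norm (l \<xi>) \<le> rho (\<tau> - \<xi>) * M"
      using assms(2) by eventually_elim (simp add: mult_left_mono)
  qed (use rho_left_lebesgue[OF T] in auto)
  also have "\<dots> \<le> Rho T * M"
    using rho_left_lebesgue[OF T, of \<tau>] Rho_mono[of \<tau> T] \<tau> M by (auto intro!: mult_right_mono)
  finally show ?thesis .
qed

lemma J_bound:
  assumes "l \<in> Linf T" "AE \<xi> in I0. norm (l \<xi>) \<le> M" "0 \<le> M" "\<tau> \<in> {0..T}"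
  shows "norm (J l \<tau>) \<le> CK * (Rho T * M)"
  using J_norm_le[OF assms(1), of \<tau>] rho_norm_integral_le[OF assms] CK_pos
  by (meson mult_left_mono order_trans less_imp_le)

text \<open>The value at \<open>\<tau>\<close> depends only on the density before \<open>\<tau>\<close>.\<close>
lemma J_cong:
  assumes "l \<in> Linf T" "l' \<in> Linf T" "AE \<xi> in I0. \<xi> < \<tau> \<longrightarrow> l \<xi> = l' \<xi>"
  shows "J l \<tau> = J l' \<tau>"
  unfolding J_def
proof (rule integral_cong_AE)
  note [measurable] = Linf_measurable[OF assms(1)] Linf_measurable[OF assms(2)]
  show "(\<lambda>\<xi>. kern \<tau> \<xi> *v l \<xi>) \<in> borel_measurable I0" "(\<lambda>\<xi>. kern \<tau> \<xi> *v l' \<xi>) \<in> borel_measurable I0"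
    by measurable
  show "AE \<xi> in I0. kern \<tau> \<xi> *v l \<xi> = kern \<tau> \<xi> *v l' \<xi>"
    using assms(3) by eventually_elim (auto simp: kern_mv_eq not_less)
qed

lemma J_add: "l \<in> Linf T \<Longrightarrow> l' \<in> Linf T \<Longrightarrow> J (\<lambda>\<xi>. l \<xi> + l' \<xi>) \<tau> = J l \<tau> + J l' \<tau>"
  unfolding J_def matrix_vector_right_distrib by (intro Bochner_Integration.integral_add J_integrable)

lemma J_diff: "l \<in> Linf T \<Longrightarrow> l' \<in> Linf T \<Longrightarrow> J (\<lambda>\<xi>. l \<xi> - l' \<xi>) \<tau> = J l \<tau> - J l' \<tau>"
  unfolding J_def matrix_vector_mult_diff_distrib by (intro Bochner_Integration.integral_diff J_integrable)

lemma J_scaleR: "J (\<lambda>\<xi>. c *\<^sub>R l \<xi>) \<tau> = c *\<^sub>R J l \<tau>"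
  unfolding J_def matrix_vector_mult_scaleR by simp

lemma J_zero: "J (\<lambda>\<xi>. 0) \<tau> = 0" by (simp add: J_def)

lemma volterra_eq_J:
  assumes "l \<in> Linf t" "0 \<le> t" "t \<le> \<tau>" "\<tau> \<le> T"
  shows "volterra K l t \<tau> = J (cut t l) \<tau>"
proof -
  \<comment> \<open>The two integrands differ only at \<open>\<xi> = \<tau>\<close>, where \<open>K\<close> is unspecified;
    \<open>f\<close> is therefore measurable.\<close>
  define f where "f \<xi> = indicator {0..t} \<xi> *\<^sub>R (K \<tau> \<xi> *v l \<xi>)" for \<xi>
  define g where "g \<xi> = indicator {0..T} \<xi> *\<^sub>R (kern \<tau> \<xi> *v cut t l \<xi>)" for \<xi>
  have cL: "cut t l \<in> Linf T" using cut_Linf[of l t T] assms by simp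
  have fg: "f \<xi> = g \<xi>" if "\<xi> \<noteq> \<tau>" for \<xi>
  proof (cases "\<xi> \<in> {0..t}")
    case True
    then have x: "0 \<le> \<xi>" "\<xi> < \<tau>" "\<xi> \<le> T" using that assms by auto
    then have "K \<tau> \<xi> = kern \<tau> \<xi>"
      using K_eq[of \<tau> \<xi>] assms by (simp add: open_triangle_def kern_def Ke_eq rho_eq_inverse)
    then show ?thesis using True x by (simp add: f_def g_def cut_def)
  qed (auto simp: f_def g_def cut_def)
  have gm: "g \<in> borel_measurable lebesgue"
    using J_integrable[OF cL, of \<tau>] by (simp add: g_def[abs_def] integrable_restrict_space borel_measurable_integrable)
  have "(\<lambda>\<xi>. if \<xi> = \<tau> then f \<tau> else g \<xi>) \<in> borel_measurable lebesgue"
    by (rule measurable_If) (use gm in auto)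
  moreover have "(\<lambda>\<xi>. if \<xi> = \<tau> then f \<tau> else g \<xi>) = f" using fg by auto
  ultimately have fm: "f \<in> borel_measurable lebesgue" by simp
  have "AE \<xi> in lebesgue. \<xi> \<noteq> \<tau>" by (rule AE_completion[OF AE_lborel_singleton])
  then have "AE \<xi> in lebesgue. f \<xi> = g \<xi>" by eventually_elim (rule fg)
  then have "integral\<^sup>L lebesgue f = integral\<^sup>L lebesgue g"
    by (rule integral_cong_AE[OF fm gm])
  then show ?thesis
    by (simp add: volterra_def J_def integral_restrict_space f_def[abs_def] g_def[abs_def])
qed

end

text \<open>The kernel together with the inhomogeneity \<open>y\<close>, the growth constant and unique solvability.\<close>
locale volterra_problem = weakly_singular_kernel T \<alpha> K Kst
  for T \<alpha> :: real and K Kst :: "real \<Rightarrow> real \<Rightarrow> real ^ 'n ^ 'n" +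
  fixes c0 :: real and y :: "real \<Rightarrow> real ^ 'n"
  assumes c0_pos: "c0 > 0" and y_cont: "continuous_on {0..T} y"
    and volterra_unique: "\<And>t l. 0 < t \<Longrightarrow> t \<le> T \<Longrightarrow> l \<in> Linf t \<Longrightarrow>
           (\<forall>\<tau>\<in>{0..t}. volterra K l \<tau> \<tau> = 0) \<Longrightarrow> (AE \<xi> in lebesgue_on {0..t}. l \<xi> = 0)"
begin

text \<open>The positions whose density grows at most like \<open>k * c0\<close> times one plus the norm of the path.\<close>
abbreviation "\<G> \<equiv> Gk T y K c0"

text \<open>The path on \<open>[0,T]\<close> generated by the density \<open>l\<close>.\<close>
definition arc :: "(real \<Rightarrow> real ^ 'n) \<Rightarrow> real \<Rightarrow> real ^ 'n" where
  "arc l \<tau> = y \<tau> + J l \<tau>"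

text \<open>The density of a position, continued by zero; the generated path is the prolongation.\<close>
definition dn :: "'n position \<Rightarrow> real \<Rightarrow> real ^ 'n" where
  "dn q = cut (fst q) (dens y K (fst q) (snd q))"

lemma volterra_diag:
  assumes "l \<in> Linf t" "t \<le> T" "\<tau> \<in> {0..t}"
  shows "volterra K l \<tau> \<tau> = J (cut t l) \<tau>"
proof -
  have l: "l \<in> Linf \<tau>" using Linf_subinterval assms by auto
  have "volterra K l \<tau> \<tau> = J (cut \<tau> l) \<tau>" using volterra_eq_J[OF l] assms by auto
  also have "\<dots> = J (cut t l) \<tau>"
  proof (rule J_cong)
    show "cut \<tau> l \<in> Linf T" "cut t l \<in> Linf T" using cut_Linf[OF l] cut_Linf[OF assms(1)] assms by auto
  qed (use assms in \<open>auto simp: cut_def\<close>)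
  finally show ?thesis .
qed

lemma generates_iff:
  assumes "t \<le> T"
  shows "generates y K t l w \<longleftrightarrow> l \<in> Linf t \<and> (\<forall>\<tau>\<in>{0..t}. w \<tau> = arc (cut t l) \<tau>)"
  using volterra_diag assms by (auto simp: generates_def arc_def)

lemma density_unique:
  assumes "l \<in> Linf t" "l' \<in> Linf t" "0 \<le> t" "t \<le> T"
    and "\<And>\<tau>. \<tau> \<in> {0..t} \<Longrightarrow> arc (cut t l) \<tau> = arc (cut t l') \<tau>"
  shows "AE \<xi> in I0. cut t l \<xi> = cut t l' \<xi>"
proof -
  have "AE \<xi> in lebesgue_on {0..t}. l \<xi> - l' \<xi> = 0"
  proof (cases "t = 0")
    case True
    have "AE \<xi> in lebesgue_on {0..t}. \<xi> \<noteq> 0" by (rule AE_lebesgue_on_neq) simp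
    moreover have "AE \<xi> in lebesgue_on {0..t}. \<xi> \<in> {0..t}" by (rule AE_I2) simp
    ultimately show ?thesis by eventually_elim (use True in auto)
  next
    case False
    obtain M M' where M: "AE \<xi> in lebesgue_on {0..t}. norm (l \<xi>) \<le> M"
      "AE \<xi> in lebesgue_on {0..t}. norm (l' \<xi>) \<le> M'"
      using assms(1,2) by (auto simp: Linf_def)
    have L: "(\<lambda>\<xi>. l \<xi> - l' \<xi>) \<in> Linf t"
      unfolding Linf_iff
    proof (intro conjI exI[of _ "M + M'"])
      show "AE \<xi> in lebesgue_on {0..t}. norm (l \<xi> - l' \<xi>) \<le> M + M'"
        using M by eventually_elim (metis add_mono norm_triangle_ineq4 order_trans)
    qed (use assms in \<open>auto simp: Linf_def\<close>)
    have "volterra K (\<lambda>\<xi>. l \<xi> - l' \<xi>) \<tau> \<tau> = 0" if "\<tau> \<in> {0..t}" for \<tau>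
    proof -
      have "volterra K (\<lambda>\<xi>. l \<xi> - l' \<xi>) \<tau> \<tau> = J (cut t (\<lambda>\<xi>. l \<xi> - l' \<xi>)) \<tau>"
        by (rule volterra_diag[OF L assms(4) that])
      also have "cut t (\<lambda>\<xi>. l \<xi> - l' \<xi>) = (\<lambda>\<xi>. cut t l \<xi> - cut t l' \<xi>)" by (auto simp: cut_def)
      also have "J \<dots> \<tau> = J (cut t l) \<tau> - J (cut t l') \<tau>"
        by (rule J_diff) (use assms cut_Linf in auto)
      finally show ?thesis using assms(5)[OF that] by (simp add: arc_def)
    qed
    then show ?thesis using volterra_unique[OF _ assms(4) L] assms(3) False by auto
  qed
  then show ?thesis
    using assms(4) by (auto simp: AE_restrict_space_iff cut_def elim!: eventually_mono)
qed

lemma position_time: "q \<in> positions T y K \<Longrightarrow> fst q \<in> {0..T}"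
  by (auto simp: positions_def)

lemma position_dens:
  assumes "(t, w) \<in> positions T y K"
  shows "dens y K t w \<in> Linf t" "\<And>\<tau>. \<tau> \<in> {0..t} \<Longrightarrow> w \<tau> = arc (cut t (dens y K t w)) \<tau>"
proof -
  have t: "0 \<le> t" "t \<le> T" "w \<in> paths y K t" using assms by (auto simp: positions_def)
  have "dens y K t w \<in> Linf t \<and> (\<forall>\<tau>\<in>{0..t}. w \<tau> = arc (cut t (dens y K t w)) \<tau>)"
  proof (cases "t = 0")
    case True
    have "J (cut 0 (\<lambda>_. 0)) 0 = 0" using J_zero by (simp add: cut_def)
    then show ?thesis using True t by (auto simp: dens_def paths_def arc_def)
  next
    case False
    then have "\<exists>l. generates y K t l w" using t by (auto simp: paths_def)
    from someI_ex[OF this] have "generates y K t (dens y K t w) w" using False by (simp add: dens_def)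
    then show ?thesis using generates_iff[OF t(2)] by blast
  qed
  then show "dens y K t w \<in> Linf t" "\<And>\<tau>. \<tau> \<in> {0..t} \<Longrightarrow> w \<tau> = arc (cut t (dens y K t w)) \<tau>" by auto
qed

lemma position_dn:
  assumes "q \<in> positions T y K"
  shows "dn q \<in> Linf T" "\<And>\<tau>. \<tau> \<in> {0..fst q} \<Longrightarrow> snd q \<tau> = arc (dn q) \<tau>"
    "\<And>\<tau>. \<tau> \<in> {0..T} \<Longrightarrow> prolong y K q \<tau> = arc (dn q) \<tau>"
proof -
  obtain t w where q: "q = (t, w)" by (cases q)
  note d = position_dens[OF assms[unfolded q]]
  have t: "0 \<le> t" "t \<le> T" using assms by (auto simp: positions_def q)
  show "dn q \<in> Linf T" using cut_Linf[OF d(1) t(2)] by (simp add: dn_def q)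
  show *: "\<And>\<tau>. \<tau> \<in> {0..fst q} \<Longrightarrow> snd q \<tau> = arc (dn q) \<tau>" using d(2) by (simp add: dn_def q)
  show "prolong y K q \<tau> = arc (dn q) \<tau>" if "\<tau> \<in> {0..T}" for \<tau>
    using *[of \<tau>] volterra_eq_J[OF d(1), of \<tau>] that t by (auto simp: q prolong_def dn_def arc_def)
qed

text \<open>Every density and every time give a position, and the chosen density of that position agrees
  almost everywhere with the given one up to that time.\<close>
lemma arc_position:
  assumes "l \<in> Linf T" "t \<in> {0..T}"
  defines "q \<equiv> (t, restrict (arc l) {0..t})"
  shows "q \<in> positions T y K" "AE \<xi> in I0. dn q \<xi> = cut t l \<xi>"
    "\<And>\<tau>. \<tau> \<in> {0..T} \<Longrightarrow> arc (dn q) \<tau> = arc (cut t l) \<tau>"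
proof -
  have lt: "l \<in> Linf t" using Linf_subinterval assms by auto
  have eq: "arc (cut t l) \<tau> = arc l \<tau>" if "\<tau> \<in> {0..t}" for \<tau>
    unfolding arc_def using that assms cut_Linf[OF lt] by (simp, intro J_cong) (auto simp: cut_def)
  have "J l 0 = J (\<lambda>_. 0) 0" by (rule J_cong) (use assms(1) in \<open>auto simp: AE_restrict_space_iff\<close>)
  then have a0: "arc l 0 = y 0" by (simp add: arc_def J_zero)
  show q: "q \<in> positions T y K"
    unfolding positions_def q_def
  proof (intro SigmaI)
    show "restrict (arc l) {0..t} \<in> paths y K t"
    proof (cases "t = 0")
      case True then show ?thesis using a0 by (simp add: paths_def)
    next
      case False
      have "generates y K t l (restrict (arc l) {0..t})" using lt eq assms by (simp add: generates_iff)
      then show ?thesis using False by (auto simp: paths_def)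
    qed
  qed (use assms in auto)
  note d = position_dens[OF q[unfolded q_def]]
  show ae: "AE \<xi> in I0. dn q \<xi> = cut t l \<xi>"
    unfolding dn_def q_def fst_conv snd_conv
    by (rule density_unique[OF d(1) lt]) (use assms d(2) eq in auto)
  have "AE \<xi> in I0. \<xi> < \<tau> \<longrightarrow> dn q \<xi> = cut t l \<xi>" for \<tau>
    using ae by eventually_elim simp
  from J_cong[OF position_dn(1)[OF q] cut_Linf[OF lt] this] assms(2)
  show "arc (dn q) \<tau> = arc (cut t l) \<tau>" if "\<tau> \<in> {0..T}" for \<tau>
    by (simp add: arc_def)
qed

text \<open>A position is determined by its time and the values of its path, which is extensional.\<close>
lemma position_eqI:
  assumes "q \<in> positions T y K" "l \<in> Linf T" "\<And>\<tau>. \<tau> \<in> {0..fst q} \<Longrightarrow> snd q \<tau> = arc l \<tau>"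
  shows "q = (fst q, restrict (arc l) {0..fst q})"
proof -
  have "snd q \<in> extensional {0..fst q}"
    using assms(1) by (auto simp: positions_def paths_def split: if_splits)
  then have "snd q = restrict (arc l) {0..fst q}"
    using assms(3) by (auto simp: extensional_def restrict_def fun_eq_iff)
  then show ?thesis by (metis prod.collapse)
qed

text \<open>The growth condition on the whole of \<open>[0,T]\<close>: after the time of the position the density is zero.\<close>
lemma Gk_iff:
  "q \<in> \<G> k \<longleftrightarrow> q \<in> positions T y K \<and>
     (AE \<xi> in I0. norm (dn q \<xi>) \<le> real k * c0 * (1 + norm (arc (dn q) \<xi>)))"
proof -
  obtain t w where q: "q = (t, w)" by (cases q)
  have "(AE \<xi> in lebesgue_on {0..t}. norm (dens y K t w \<xi>) \<le> real k * c0 * (1 + norm (w \<xi>))) \<longleftrightarrow>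
     (AE \<xi> in I0. norm (dn q \<xi>) \<le> real k * c0 * (1 + norm (arc (dn q) \<xi>)))"
    if "q \<in> positions T y K"
  proof -
    have t: "0 \<le> t" "t \<le> T" using position_time[OF that] by (auto simp: q)
    have "\<xi> \<in> {0..t} \<longrightarrow> w \<xi> = arc (dn q) \<xi>" for \<xi>
      using position_dn(2)[OF that] by (simp add: q)
    then show ?thesis
      using t c0_pos by (auto simp: AE_restrict_space_iff dn_def q cut_def elim!: eventually_mono)
  qed
  then show ?thesis by (auto simp: Gk_def q)
qed

end

section \<open>Growth and equicontinuity of paths\<close>

context weakly_singular_kernel
begin

lemma Rho_small: assumes "e > 0" obtains d where "d > 0" "Rho d < e"
proof -
  have "(Rho \<longlongrightarrow> Rho 0) (at_right 0)" by (intro Rho_tendsto tendsto_ident_at)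
  then have "eventually (\<lambda>d. Rho d < e) (at_right 0)" using assms by (intro order_tendstoD) auto
  moreover have "eventually (\<lambda>d. d > (0::real)) (at_right 0)" by (simp add: eventually_at_right_less)
  ultimately have "eventually (\<lambda>d. d > 0 \<and> Rho d < e) (at_right 0)" by eventually_elim simp
  then have "\<exists>d. d > 0 \<and> Rho d < e" using eventually_happens' trivial_limit_at_right_real by blast
  then show thesis using that by blast
qed

lemma rho_tail_integral:
  assumes "0 \<le> d" "0 \<le> \<tau>" "\<tau> \<le> T"
  shows "integrable I0 (\<lambda>\<xi>. indicator {max 0 (\<tau> - d)..T} \<xi> * rho (\<tau> - \<xi>))"
    "(LINT \<xi>|I0. indicator {max 0 (\<tau> - d)..T} \<xi> * rho (\<tau> - \<xi>)) \<le> Rho d"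
proof -
  let ?c = "max 0 (\<tau> - d)"
  have c: "?c \<le> T" "0 \<le> T" using assms by auto
  show "integrable I0 (\<lambda>\<xi>. indicator {?c..T} \<xi> * rho (\<tau> - \<xi>))"
    by (rule Bochner_Integration.integrable_bound[OF rho_left_lebesgue(1)[OF c(2), of \<tau>]])
       (auto simp: indicator_def)
  have "(LINT \<xi>|I0. indicator {?c..T} \<xi> * rho (\<tau> - \<xi>)) = (LINT \<xi>|lebesgue_on {?c..T}. rho (\<tau> - \<xi>))"
    by (subst (1 2) integral_restrict_space) (auto intro!: Bochner_Integration.integral_cong simp: indicator_def)
  also have "\<dots> = Rho (\<tau> - ?c) - Rho (\<tau> - T)" by (rule rho_left_lebesgue(2)[OF c(1)])
  also have "\<dots> \<le> Rho d" using Rho_mono[of "\<tau> - ?c" d] assms by simp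
  finally show "(LINT \<xi>|I0. indicator {?c..T} \<xi> * rho (\<tau> - \<xi>)) \<le> Rho d" .
qed

lemma J_tendsto:
  assumes L: "\<And>i. f i \<in> Linf T" "l \<in> Linf T" and M: "M \<ge> 0" "\<And>i. AE \<xi> in I0. norm (f i \<xi>) \<le> M"
    and lim: "AE \<xi> in I0. (\<lambda>i. f i \<xi>) \<longlonglongrightarrow> l \<xi>"
  shows "(\<lambda>i. J (f i) \<tau>) \<longlonglongrightarrow> J l \<tau>"
  unfolding J_def
proof (rule integral_dominated_convergence[where w = "\<lambda>\<xi>. CK * (rho (\<tau> - \<xi>) * M)"])
  show "integrable I0 (\<lambda>\<xi>. CK * (rho (\<tau> - \<xi>) * M))"
    using rho_left_lebesgue(1)[of 0 T \<tau>] T_pos by simp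
  show "AE \<xi> in I0. (\<lambda>i. kern \<tau> \<xi> *v f i \<xi>) \<longlonglongrightarrow> kern \<tau> \<xi> *v l \<xi>"
    using lim by eventually_elim
      (intro bounded_bilinear.tendsto[OF bounded_bilinear_matrix_vector_mult] tendsto_const)
  show "AE \<xi> in I0. norm (kern \<tau> \<xi> *v f i \<xi>) \<le> CK * (rho (\<tau> - \<xi>) * M)" for i
    using M(2)[of i]
  proof eventually_elim
    case (elim \<xi>)
    have "CK * (rho (\<tau> - \<xi>) * norm (f i \<xi>)) \<le> CK * (rho (\<tau> - \<xi>) * M)"
      using elim CK_pos by (intro mult_left_mono) auto
    then show ?case using kern_mv_le[of \<tau> \<xi> "f i \<xi>"] by linarith
  qed
qed (use J_integrable[OF L(2)] J_integrable[OF L(1)] in auto)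

lemma J_equicontinuous:
  assumes "M \<ge> 0" "e > 0"
  obtains d where "d > 0" "\<And>l \<tau> \<tau>'. l \<in> Linf T \<Longrightarrow> AE \<xi> in I0. norm (l \<xi>) \<le> M \<Longrightarrow> \<tau> \<in> {0..T} \<Longrightarrow>
    \<tau>' \<in> {0..T} \<Longrightarrow> \<bar>\<tau> - \<tau>'\<bar> < d \<Longrightarrow> norm (J l \<tau> - J l \<tau>') < e"
proof -
  obtain C where C: "C > 0" "\<And>A :: real^'n^'n. \<And>v. norm (A *v v) \<le> norm A * norm v * C"
    using bounded_bilinear.pos_bounded[OF bounded_bilinear_matrix_vector_mult] by blast
  \<comment> \<open>\<open>e1\<close> bounds the oscillation of \<open>Ke\<close> in its first argument, \<open>d2\<close> below
    the mean difference of translates of \<open>rho\<close>; each contributes \<open>e / 2\<close>.\<close>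
  define e1 where "e1 = e / (2 * (M * C * Rho T + 1))"
  have pos: "M * C * Rho T \<ge> 0" using assms C(1) by simp
  have e1: "e1 > 0" "M * C * Rho T * e1 < e / 2"
    using assms pos by (auto simp: e1_def divide_simps add_nonneg_pos)
  have "uniformly_continuous_on ({0..T} \<times> {0..T}) (\<lambda>(\<tau>, \<xi>). Ke \<tau> \<xi>)"
    by (intro compact_uniformly_continuous continuous_Ke compact_Times) auto
  then obtain d1 where d1: "d1 > 0" "\<And>p p'. p \<in> {0..T} \<times> {0..T} \<Longrightarrow> p' \<in> {0..T} \<times> {0..T} \<Longrightarrow>
      dist p' p < d1 \<Longrightarrow> dist ((\<lambda>(\<tau>, \<xi>). Ke \<tau> \<xi>) p') ((\<lambda>(\<tau>, \<xi>). Ke \<tau> \<xi>) p) < e1"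
    using e1(1) unfolding uniformly_continuous_on_def by metis
  have CM: "CK * M \<ge> 0" using assms CK_pos by simp
  obtain d2 where d2: "d2 > 0" "Rho d2 < e / (4 * (CK * M + 1))"
    by (rule Rho_small[of "e / (4 * (CK * M + 1))"]) (use assms CM in auto)
  have d2': "CK * M * (2 * Rho d2) \<le> e / 2"
  proof -
    have "CK * M * (2 * Rho d2) \<le> (CK * M + 1) * (2 * (e / (4 * (CK * M + 1))))"
      using d2 CM by (intro mult_mono) auto
    also have "\<dots> = e / 2" using CM by (simp add: field_simps add_nonneg_eq_0_iff)
    finally show ?thesis .
  qed
  show thesis
  proof (rule that[of "min d1 d2"])
    fix l :: "real \<Rightarrow> real ^ 'n" and \<tau> \<tau>'
    assume l: "l \<in> Linf T" "AE \<xi> in I0. norm (l \<xi>) \<le> M"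
      and \<tau>: "\<tau> \<in> {0..T}" "\<tau>' \<in> {0..T}" "\<bar>\<tau> - \<tau>'\<bar> < min d1 d2"
    have T: "0 \<le> T" using T_pos by simp
    let ?b = "\<lambda>\<xi>. CK * M * \<bar>rho (\<tau> - \<xi>) - rho (\<tau>' - \<xi>)\<bar> + rho (\<tau>' - \<xi>) * (e1 * M * C)"
    have bnd: "norm (kern \<tau> \<xi> *v v - kern \<tau>' \<xi> *v v) \<le> ?b \<xi>" if "norm v \<le> M" "\<xi> \<in> {0..T}" for \<xi> v
    proof -
      have "dist (Ke \<tau> \<xi>) (Ke \<tau>' \<xi>) < e1"
        using d1(2)[of "(\<tau>', \<xi>)" "(\<tau>, \<xi>)"] \<tau> that by (auto simp: dist_Pair_Pair dist_real_def)
      then have k: "norm ((Ke \<tau> \<xi> - Ke \<tau>' \<xi>) *v v) \<le> e1 * M * C"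
      proof -
        have "norm (Ke \<tau> \<xi> - Ke \<tau>' \<xi>) * norm v * C \<le> e1 * M * C"
          using \<open>dist (Ke \<tau> \<xi>) (Ke \<tau>' \<xi>) < e1\<close> C(1) that(1) e1(1)
          by (intro mult_right_mono mult_mono) (auto simp: dist_norm)
        then show ?thesis using C(2)[of "Ke \<tau> \<xi> - Ke \<tau>' \<xi>" v] by linarith
      qed
      have eq: "kern \<tau> \<xi> *v v - kern \<tau>' \<xi> *v v =
          (rho (\<tau> - \<xi>) - rho (\<tau>' - \<xi>)) *\<^sub>R (Ke \<tau> \<xi> *v v) + rho (\<tau>' - \<xi>) *\<^sub>R ((Ke \<tau> \<xi> - Ke \<tau>' \<xi>) *v v)"
        by (simp add: kern_mv_eq algebra_simps matrix_vector_mult_diff_rdistrib)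
      have "norm (kern \<tau> \<xi> *v v - kern \<tau>' \<xi> *v v) \<le>
          \<bar>rho (\<tau> - \<xi>) - rho (\<tau>' - \<xi>)\<bar> * norm (Ke \<tau> \<xi> *v v) + rho (\<tau>' - \<xi>) * norm ((Ke \<tau> \<xi> - Ke \<tau>' \<xi>) *v v)"
        unfolding eq by (rule order_trans[OF norm_triangle_ineq]) simp
      also have "\<dots> \<le> \<bar>rho (\<tau> - \<xi>) - rho (\<tau>' - \<xi>)\<bar> * (CK * M) + rho (\<tau>' - \<xi>) * (e1 * M * C)"
        using Ke_mv_le[of \<tau> \<xi> v] k that(1) CK_pos
        by (intro add_mono mult_left_mono) (auto intro: order_trans mult_left_mono)
      finally show ?thesis by (simp add: mult_ac)
    qed
    have bi: "integrable I0 ?b"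
      using rho_left_diff_lebesgue(1)[OF \<tau>(1,2)] rho_left_lebesgue(1)[OF T, of \<tau>'] by simp
    have "norm (J l \<tau> - J l \<tau>') = norm (LINT \<xi>|I0. kern \<tau> \<xi> *v l \<xi> - kern \<tau>' \<xi> *v l \<xi>)"
      unfolding J_def using J_integrable[OF l(1)] by simp
    also have "\<dots> \<le> (LINT \<xi>|I0. ?b \<xi>)"
    proof (rule norm_integral_le_integral[OF _ bi])
      have "AE \<xi> in I0. \<xi> \<in> {0..T}" by (rule AE_I2) simp
      then show "AE \<xi> in I0. norm (kern \<tau> \<xi> *v l \<xi> - kern \<tau>' \<xi> *v l \<xi>) \<le> ?b \<xi>"
        using l(2) by eventually_elim (rule bnd)
    qed (use J_integrable[OF l(1)] in auto)
    also have "\<dots> = CK * M * (LINT \<xi>|I0. \<bar>rho (\<tau> - \<xi>) - rho (\<tau>' - \<xi>)\<bar>) + (LINT \<xi>|I0. rho (\<tau>' - \<xi>)) * (e1 * M * C)"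
      using rho_left_diff_lebesgue(1)[OF \<tau>(1,2)] rho_left_lebesgue(1)[OF T, of \<tau>'] by simp
    also have "\<dots> \<le> CK * M * (2 * Rho d2) + Rho T * (e1 * M * C)"
    proof (intro add_mono mult_left_mono mult_right_mono)
      show "(LINT \<xi>|I0. \<bar>rho (\<tau> - \<xi>) - rho (\<tau>' - \<xi>)\<bar>) \<le> 2 * Rho d2"
        using rho_left_diff_lebesgue(2)[OF \<tau>(1,2)] Rho_mono[of "\<bar>\<tau> - \<tau>'\<bar>" d2] \<tau>(3) by linarith
      show "(LINT \<xi>|I0. rho (\<tau>' - \<xi>)) \<le> Rho T"
        using rho_left_lebesgue(2)[OF T, of \<tau>'] Rho_mono[of \<tau>' T] \<tau>(2) by simp
    qed (use CM e1 assms C(1) in auto)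
    also have "\<dots> < e" using d2' e1(2) by (simp add: mult_ac)
    finally show "norm (J l \<tau> - J l \<tau>') < e" .
  qed (use d1 d2 in auto)
qed

end

context volterra_problem
begin

lemma y_bounded: obtains Y where "Y \<ge> 0" "\<And>\<tau>. \<tau> \<in> {0..T} \<Longrightarrow> norm (y \<tau>) \<le> Y"
proof -
  have "bounded (y ` {0..T})"
    by (intro compact_imp_bounded compact_continuous_image y_cont) auto
  then obtain Y where "\<And>\<tau>. \<tau> \<in> {0..T} \<Longrightarrow> norm (y \<tau>) \<le> Y" unfolding bounded_iff by blast
  then show thesis using that[of "max Y 0"] by fastforce
qed

lemma arc_bounded:
  assumes "l \<in> Linf T"
  obtains B where "B \<ge> 0" "\<And>\<tau>. \<tau> \<in> {0..T} \<Longrightarrow> norm (arc l \<tau>) \<le> B"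
proof -
  obtain M where M: "M > 0" "AE \<xi> in I0. norm (l \<xi>) \<le> M" using Linf_bound[OF assms] .
  obtain Y where Y: "Y \<ge> 0" "\<And>\<tau>. \<tau> \<in> {0..T} \<Longrightarrow> norm (y \<tau>) \<le> Y" using y_bounded by blast
  have "norm (arc l \<tau>) \<le> Y + CK * (Rho T * M)" if "\<tau> \<in> {0..T}" for \<tau>
    unfolding arc_def using Y(2)[OF that] J_bound[OF assms M(2) _ that] M(1)
    by (intro order_trans[OF norm_triangle_ineq] add_mono) auto
  moreover have "Y + CK * (Rho T * M) \<ge> 0" using Y(1) M(1) CK_pos by simp
  ultimately show thesis using that by blast
qed

lemma arc_equicontinuous:
  assumes "M \<ge> 0" "e > 0"
  obtains d where "d > 0" "\<And>l \<tau> \<tau>'. l \<in> Linf T \<Longrightarrow> AE \<xi> in I0. norm (l \<xi>) \<le> M \<Longrightarrow> \<tau> \<in> {0..T} \<Longrightarrow>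
    \<tau>' \<in> {0..T} \<Longrightarrow> \<bar>\<tau> - \<tau>'\<bar> < d \<Longrightarrow> norm (arc l \<tau> - arc l \<tau>') < e"
proof -
  have e: "e / 2 > 0" using assms by simp
  have "uniformly_continuous_on {0..T} y" by (intro compact_uniformly_continuous y_cont) simp
  then obtain d1 where d1: "d1 > 0" "\<And>\<tau> \<tau>'. \<tau> \<in> {0..T} \<Longrightarrow> \<tau>' \<in> {0..T} \<Longrightarrow> dist \<tau>' \<tau> < d1 \<Longrightarrow> dist (y \<tau>') (y \<tau>) < e / 2"
    using e unfolding uniformly_continuous_on_def by metis
  obtain d2 where d2: "d2 > 0" "\<And>l \<tau> \<tau>'. l \<in> Linf T \<Longrightarrow> AE \<xi> in I0. norm (l \<xi>) \<le> M \<Longrightarrow> \<tau> \<in> {0..T} \<Longrightarrow>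
    \<tau>' \<in> {0..T} \<Longrightarrow> \<bar>\<tau> - \<tau>'\<bar> < d2 \<Longrightarrow> norm (J l \<tau> - J l \<tau>') < e / 2"
    using J_equicontinuous[OF assms(1) e] by metis
  show thesis
  proof (rule that[of "min d1 d2"])
    fix l :: "real \<Rightarrow> real ^ 'n" and \<tau> \<tau>'
    assume l: "l \<in> Linf T" "AE \<xi> in I0. norm (l \<xi>) \<le> M"
      and \<tau>: "\<tau> \<in> {0..T}" "\<tau>' \<in> {0..T}" "\<bar>\<tau> - \<tau>'\<bar> < min d1 d2"
    have "norm (y \<tau> - y \<tau>') < e / 2" using d1(2)[OF \<tau>(2,1)] \<tau>(3) by (simp add: dist_norm)
    moreover have "norm (J l \<tau> - J l \<tau>') < e / 2" using d2(2)[OF l \<tau>(1,2)] \<tau>(3) by simp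
    moreover have "arc l \<tau> - arc l \<tau>' = (y \<tau> - y \<tau>') + (J l \<tau> - J l \<tau>')" by (simp add: arc_def)
    ultimately show "norm (arc l \<tau> - arc l \<tau>') < e"
      using norm_triangle_ineq[of "y \<tau> - y \<tau>'" "J l \<tau> - J l \<tau>'"] by simp
  qed (use d1 d2 in auto)
qed

lemma arc_continuous: assumes "l \<in> Linf T" shows "continuous_on {0..T} (arc l)"
  unfolding continuous_on_iff
proof (intro ballI allI impI)
  fix \<tau> e :: real assume \<tau>: "\<tau> \<in> {0..T}" and "0 < e"
  obtain M where M: "M > 0" "AE \<xi> in I0. norm (l \<xi>) \<le> M" using Linf_bound[OF assms] .
  obtain d where d: "d > 0" "\<And>l \<tau> \<tau>'. l \<in> Linf T \<Longrightarrow> AE \<xi> in I0. norm (l \<xi>) \<le> M \<Longrightarrow> \<tau> \<in> {0..T} \<Longrightarrow>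
    \<tau>' \<in> {0..T} \<Longrightarrow> \<bar>\<tau> - \<tau>'\<bar> < d \<Longrightarrow> norm (arc l \<tau> - arc l \<tau>') < e"
    using arc_equicontinuous[of M e] M(1) \<open>0 < e\<close> by (metis less_imp_le)
  then show "\<exists>d>0. \<forall>\<tau>'\<in>{0..T}. dist \<tau>' \<tau> < d \<longrightarrow> dist (arc l \<tau>') (arc l \<tau>) < e"
    using assms M(2) \<tau> by (auto simp: dist_norm)
qed

text \<open>A Gronwall estimate for the singular kernel. In the supremum weighted by \<open>exp (- \<gamma> * \<tau>)\<close> the
  integral term contributes at most one half of that supremum: the part of the kernel within \<open>d\<close>
  of the singularity is small by the choice of \<open>d\<close>, the rest by the choice of \<open>\<gamma>\<close>.\<close>
lemma arc_growth:
  assumes l: "l \<in> Linf T" and ae: "AE \<xi> in I0. norm (l \<xi>) \<le> \<kappa> * (1 + norm (arc l \<xi>))" and "\<kappa> \<ge> 0"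
    and d: "d > 0" "CK * \<kappa> * Rho d \<le> 1/4" and \<gamma>: "\<gamma> \<ge> 0" "CK * \<kappa> * Rho T * exp (- \<gamma> * d) \<le> 1/4"
    and Y: "\<And>\<tau>. \<tau> \<in> {0..T} \<Longrightarrow> norm (y \<tau>) \<le> Y" and \<tau>: "\<tau> \<in> {0..T}"
  shows "1 + norm (arc l \<tau>) \<le> 2 * (1 + Y) * exp (\<gamma> * T)"
proof -
  obtain B where B: "B \<ge> 0" "\<And>\<tau>. \<tau> \<in> {0..T} \<Longrightarrow> norm (arc l \<tau>) \<le> B" using arc_bounded[OF l] by blast
  define f where "f \<tau> = exp (- \<gamma> * \<tau>) * (1 + norm (arc l \<tau>))" for \<tau>
  define m where "m = (SUP \<tau>\<in>{0..T}. f \<tau>)"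
  have Y0: "Y \<ge> 0" using Y[OF \<tau>] norm_ge_zero order_trans by blast
  have "bdd_above (f ` {0..T})"
  proof (rule bdd_aboveI2)
    fix \<tau> assume t: "\<tau> \<in> {0..T}"
    have "exp (- \<gamma> * \<tau>) * (1 + norm (arc l \<tau>)) \<le> 1 * (1 + B)"
      using B(2)[OF t] \<gamma>(1) t by (intro mult_mono) auto
    then show "f \<tau> \<le> 1 + B" by (simp add: f_def)
  qed
  then have fm: "f \<tau> \<le> m" if "\<tau> \<in> {0..T}" for \<tau>
    unfolding m_def using that by (intro cSUP_upper)
  have m0: "m \<ge> 0" using fm[OF \<tau>] by (smt (verit) f_def exp_gt_zero mult_nonneg_nonneg norm_ge_zero)
  have am: "1 + norm (arc l \<xi>) \<le> m * exp (\<gamma> * \<xi>)" if "\<xi> \<in> {0..T}" for \<xi>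
    using fm[OF that] by (simp add: f_def exp_minus field_simps)
  have T: "0 \<le> T" using T_pos by simp
  have est: "1 + norm (arc l \<tau>) \<le> 1 + Y + m * exp (\<gamma> * \<tau>) / 2" if \<tau>: "\<tau> \<in> {0..T}" for \<tau>
  proof -
    let ?c = "max 0 (\<tau> - d)"
    let ?b = "\<lambda>\<xi>. \<kappa> * m * exp (\<gamma> * \<tau>) * (indicator {?c..T} \<xi> * rho (\<tau> - \<xi>) + exp (- \<gamma> * d) * rho (\<tau> - \<xi>))"
    note i1 = rho_tail_integral[of d \<tau>] and i2 = rho_left_lebesgue[OF T, of \<tau>]
    have \<tau>': "0 \<le> d" "0 \<le> \<tau>" "\<tau> \<le> T" using d \<tau> by auto
    have ex: "rho (\<tau> - \<xi>) * exp (\<gamma> * \<xi>) \<le>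
        exp (\<gamma> * \<tau>) * (indicator {?c..T} \<xi> * rho (\<tau> - \<xi>) + exp (- \<gamma> * d) * rho (\<tau> - \<xi>))"
      if \<xi>: "\<xi> \<in> {0..T}" for \<xi>
    proof (cases "\<xi> < \<tau>")
      case True
      show ?thesis
      proof (cases "\<tau> - d \<le> \<xi>")
        case True
        have "exp (\<gamma> * \<xi>) \<le> exp (\<gamma> * \<tau>)" using \<gamma>(1) \<open>\<xi> < \<tau>\<close> by (simp add: mult_left_mono)
        then have "rho (\<tau> - \<xi>) * exp (\<gamma> * \<xi>) \<le> exp (\<gamma> * \<tau>) * rho (\<tau> - \<xi>)"
          by (metis mult.commute mult_right_mono rho_nonneg)
        also have "\<dots> \<le> exp (\<gamma> * \<tau>) * (rho (\<tau> - \<xi>) + exp (- \<gamma> * d) * rho (\<tau> - \<xi>))"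
          by (intro mult_left_mono) auto
        finally show ?thesis using True \<xi> by simp
      next
        case False
        have "\<gamma> * \<xi> \<le> \<gamma> * \<tau> + - \<gamma> * d" using \<gamma>(1) False mult_left_mono[of "\<xi> + d" \<tau> \<gamma>]
          by (simp add: algebra_simps)
        then have "exp (\<gamma> * \<xi>) \<le> exp (\<gamma> * \<tau>) * exp (- \<gamma> * d)"
          by (metis exp_add exp_le_cancel_iff)
        then have "rho (\<tau> - \<xi>) * exp (\<gamma> * \<xi>) \<le> rho (\<tau> - \<xi>) * (exp (\<gamma> * \<tau>) * exp (- \<gamma> * d))"
          by (rule mult_left_mono) simp
        then show ?thesis using False by (simp add: mult_ac)
      qed
    qed simp
    have "norm (J l \<tau>) \<le> CK * (LINT \<xi>|I0. rho (\<tau> - \<xi>) * norm (l \<xi>))" by (rule J_norm_le[OF l])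
    also have "(LINT \<xi>|I0. rho (\<tau> - \<xi>) * norm (l \<xi>)) \<le> (LINT \<xi>|I0. ?b \<xi>)"
    proof (rule integral_mono_AE[OF rho_norm_integrable[OF l]])
      show "integrable I0 ?b" using i1(1) i2(1) \<tau>' by simp
      have "AE \<xi> in I0. \<xi> \<in> {0..T}" by (rule AE_I2) simp
      then show "AE \<xi> in I0. rho (\<tau> - \<xi>) * norm (l \<xi>) \<le> ?b \<xi>" using ae
      proof eventually_elim
        case (elim \<xi>)
        have "norm (l \<xi>) \<le> \<kappa> * (m * exp (\<gamma> * \<xi>))"
          using elim(2) mult_left_mono[OF am[OF elim(1)] \<open>\<kappa> \<ge> 0\<close>] by linarith
        then have "rho (\<tau> - \<xi>) * norm (l \<xi>) \<le> rho (\<tau> - \<xi>) * (\<kappa> * (m * exp (\<gamma> * \<xi>)))"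
          by (rule mult_left_mono) simp
        also have "\<dots> = \<kappa> * m * (rho (\<tau> - \<xi>) * exp (\<gamma> * \<xi>))" by (simp add: mult_ac)
        also have "\<dots> \<le> \<kappa> * m * (exp (\<gamma> * \<tau>) * (indicator {?c..T} \<xi> * rho (\<tau> - \<xi>) + exp (- \<gamma> * d) * rho (\<tau> - \<xi>)))"
          using \<open>\<kappa> \<ge> 0\<close> m0 by (intro mult_left_mono ex[OF elim(1)]) auto
        finally show ?case by (simp add: mult.assoc)
      qed
    qed
    also have "(LINT \<xi>|I0. ?b \<xi>) = \<kappa> * m * exp (\<gamma> * \<tau>) *
        ((LINT \<xi>|I0. indicator {?c..T} \<xi> * rho (\<tau> - \<xi>)) + exp (- \<gamma> * d) * (LINT \<xi>|I0. rho (\<tau> - \<xi>)))"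
      using i1(1) i2(1) \<tau>' by simp
    also have "\<dots> \<le> \<kappa> * m * exp (\<gamma> * \<tau>) * (Rho d + exp (- \<gamma> * d) * Rho T)"
      using i1(2)[OF \<tau>'] i2(2) Rho_mono[of \<tau> T] \<tau>' \<open>\<kappa> \<ge> 0\<close> m0
      by (intro mult_left_mono add_mono) auto
    also have "CK * (\<kappa> * m * exp (\<gamma> * \<tau>) * (Rho d + exp (- \<gamma> * d) * Rho T)) =
        m * exp (\<gamma> * \<tau>) * (CK * \<kappa> * Rho d + CK * \<kappa> * Rho T * exp (- \<gamma> * d))"
      by (simp add: algebra_simps)
    also have "\<dots> \<le> m * exp (\<gamma> * \<tau>) * (1/4 + 1/4)"
      using d(2) \<gamma>(2) m0 by (intro mult_left_mono add_mono) auto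
    finally have "norm (J l \<tau>) \<le> m * exp (\<gamma> * \<tau>) / 2" using CK_pos by simp
    then show ?thesis
      using Y[OF \<tau>] norm_triangle_ineq[of "y \<tau>" "J l \<tau>"] by (simp add: arc_def)
  qed
  have "m \<le> 1 + Y + m / 2"
    unfolding m_def
  proof (rule cSUP_least, fold m_def)
    fix \<tau> assume t: "\<tau> \<in> {0..T}"
    have "f \<tau> \<le> exp (- \<gamma> * \<tau>) * (1 + Y + m * exp (\<gamma> * \<tau>) / 2)"
      unfolding f_def by (rule mult_left_mono[OF est[OF t]]) simp
    also have "\<dots> = exp (- \<gamma> * \<tau>) * (1 + Y) + m / 2" by (simp add: exp_minus field_simps)
    also have "\<dots> \<le> 1 * (1 + Y) + m / 2"
      using \<gamma>(1) t Y0 by (intro add_right_mono mult_right_mono) auto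
    finally show "f \<tau> \<le> 1 + Y + m / 2" by simp
  qed (use T in auto)
  then have "m \<le> 2 * (1 + Y)" by simp
  then have "m * exp (\<gamma> * \<tau>) \<le> 2 * (1 + Y) * exp (\<gamma> * T)"
    using \<gamma>(1) \<tau> Y0 by (intro mult_mono) (auto intro: mult_left_mono)
  then show ?thesis using am[OF \<tau>] by linarith
qed

lemma Gk_bounded:
  obtains M where "M > 0" "\<And>q. q \<in> \<G> k \<Longrightarrow> AE \<xi> in I0. norm (dn q \<xi>) \<le> M"
    "\<And>q \<tau>. q \<in> \<G> k \<Longrightarrow> \<tau> \<in> {0..T} \<Longrightarrow> norm (arc (dn q) \<tau>) \<le> M"
proof -
  obtain Y where Y: "Y \<ge> 0" "\<And>\<tau>. \<tau> \<in> {0..T} \<Longrightarrow> norm (y \<tau>) \<le> Y" using y_bounded by blast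
  define \<kappa> where "\<kappa> = real k * c0"
  have \<kappa>: "\<kappa> \<ge> 0" using c0_pos by (simp add: \<kappa>_def)
  have c: "CK * \<kappa> \<ge> 0" using \<kappa> CK_pos by simp
  obtain d where d: "d > 0" "Rho d < 1 / (4 * (CK * \<kappa> + 1))"
    by (rule Rho_small[of "1 / (4 * (CK * \<kappa> + 1))"]) (use c in auto)
  have d': "CK * \<kappa> * Rho d \<le> 1 / 4"
  proof -
    have "CK * \<kappa> * Rho d \<le> (CK * \<kappa> + 1) * (1 / (4 * (CK * \<kappa> + 1)))"
      using d c by (intro mult_mono) auto
    also have "\<dots> = 1 / 4" using c by (simp add: field_simps add_nonneg_eq_0_iff)
    finally show ?thesis .
  qed
  \<comment> \<open>With \<open>\<gamma> = A / d\<close> the second smallness condition is \<open>A * exp (- A) \<le> 1\<close>.\<close>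
  define A where "A = 4 * (CK * \<kappa> * Rho T)"
  have A: "A \<ge> 0" using c by (simp add: A_def)
  have "A \<le> exp A" using exp_ge_add_one_self[of A] by linarith
  then have "A / exp A \<le> 1" by simp
  then have \<gamma>: "CK * \<kappa> * Rho T * exp (- (A / d) * d) \<le> 1 / 4"
    using d(1) by (simp add: A_def exp_minus field_simps)
  define R where "R = 2 * (1 + Y) * exp (A / d * T)"
  have R: "1 + norm (arc (dn q) \<tau>) \<le> R" if "q \<in> \<G> k" "\<tau> \<in> {0..T}" for q \<tau>
    unfolding R_def
    by (rule arc_growth[OF _ _ \<kappa> d(1) d' _ \<gamma> Y(2) that(2)])
       (use that position_dn(1) A d(1) in \<open>auto simp: Gk_iff \<kappa>_def\<close>)
  have R0: "R \<ge> 0" using Y(1) by (simp add: R_def)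
  show thesis
  proof (rule that[of "\<kappa> * R + R + 1"])
    show "0 < \<kappa> * R + R + 1" using \<kappa> R0 by (simp add: add_nonneg_pos)
    fix q assume q: "q \<in> \<G> k"
    have "AE \<xi> in I0. norm (dn q \<xi>) \<le> \<kappa> * (1 + norm (arc (dn q) \<xi>))" using q by (simp add: Gk_iff \<kappa>_def)
    moreover have "AE \<xi> in I0. \<xi> \<in> {0..T}" by (rule AE_I2) simp
    ultimately show "AE \<xi> in I0. norm (dn q \<xi>) \<le> \<kappa> * R + R + 1"
    proof eventually_elim
      case (elim \<xi>)
      then show ?case using mult_left_mono[OF R[OF q elim(2)] \<kappa>] R0 by linarith
    qed
    show "norm (arc (dn q) \<tau>) \<le> \<kappa> * R + R + 1" if "\<tau> \<in> {0..T}" for \<tau>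
      using R[OF q that] mult_nonneg_nonneg[OF \<kappa> R0] by linarith
  qed
qed

section \<open>Compactness of the sets of positions with bounded growth\<close>

text \<open>Convergence of positions: the times converge and the prolongations converge uniformly.\<close>
definition pconv :: "(nat \<Rightarrow> 'n position) \<Rightarrow> 'n position \<Rightarrow> bool" where
  "pconv s q \<longleftrightarrow> (\<lambda>n. fst (s n)) \<longlonglongrightarrow> fst q \<and>
     (\<forall>e>0. \<exists>N. \<forall>n\<ge>N. \<forall>\<tau>\<in>{0..T}. norm (arc (dn (s n)) \<tau> - arc (dn q) \<tau>) < e)"

lemma pconv_time: "pconv s q \<Longrightarrow> (\<lambda>n. fst (s n)) \<longlonglongrightarrow> fst q"
  by (simp add: pconv_def)

lemma pconv_point:
  assumes "pconv s q" "\<tau> \<in> {0..T}" shows "(\<lambda>n. arc (dn (s n)) \<tau>) \<longlonglongrightarrow> arc (dn q) \<tau>"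
  unfolding LIMSEQ_iff using assms unfolding pconv_def by meson

lemma pconv_subseq:
  assumes "pconv s q" "strict_mono r" shows "pconv (\<lambda>n. s (r n)) q"
  unfolding pconv_def
proof (intro conjI allI impI)
  show "(\<lambda>n. fst (s (r n))) \<longlonglongrightarrow> fst q"
    using LIMSEQ_subseq_LIMSEQ[OF pconv_time[OF assms(1)] assms(2)] by (simp add: comp_def)
  fix e :: real assume "e > 0"
  then obtain N where "\<forall>n\<ge>N. \<forall>\<tau>\<in>{0..T}. norm (arc (dn (s n)) \<tau> - arc (dn q) \<tau>) < e"
    using assms(1) unfolding pconv_def by blast
  then show "\<exists>N. \<forall>n\<ge>N. \<forall>\<tau>\<in>{0..T}. norm (arc (dn (s (r n))) \<tau> - arc (dn q) \<tau>) < e"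
    using seq_suble[OF assms(2)] order_trans by blast
qed

text \<open>The values at the running times converge, too.\<close>
lemma pconv_diag:
  assumes "pconv s q" "q \<in> positions T y K" "\<And>n. u n \<in> {0..T}" "u \<longlonglongrightarrow> v"
  shows "(\<lambda>n. arc (dn (s n)) (u n)) \<longlonglongrightarrow> arc (dn q) v"
proof -
  have v: "v \<in> {0..T}" using closed_sequentially[OF closed_real_atLeastAtMost _ assms(4)] assms(3) by blast
  have 1: "(\<lambda>n. arc (dn q) (u n)) \<longlonglongrightarrow> arc (dn q) v"
    by (rule continuous_on_tendsto_compose[OF arc_continuous[OF position_dn(1)[OF assms(2)]] assms(4) v])
       (use assms(3) in auto)
  have 2: "(\<lambda>n. arc (dn (s n)) (u n) - arc (dn q) (u n)) \<longlonglongrightarrow> 0"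
    unfolding LIMSEQ_iff
  proof (intro allI impI)
    fix e :: real assume "e > 0"
    then obtain N where "\<forall>n\<ge>N. \<forall>\<tau>\<in>{0..T}. norm (arc (dn (s n)) \<tau> - arc (dn q) \<tau>) < e"
      using assms(1) unfolding pconv_def by blast
    then show "\<exists>N. \<forall>n\<ge>N. norm (arc (dn (s n)) (u n) - arc (dn q) (u n) - 0) < e"
      using assms(3) by (intro exI[of _ N]) auto
  qed
  from tendsto_add[OF 1 2] show ?thesis by simp
qed

text \<open>Arzela--Ascoli gives a limit path. Densities whose paths stay close to it form midpoint convex
  sets, so some sequence of such densities converges almost everywhere, and its limit generates the
  limit path.\<close>
theorem Gk_compact:
  fixes s :: "nat \<Rightarrow> 'n position"
  assumes s: "\<And>n. s n \<in> \<G> k"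
  shows "\<exists>r q. strict_mono r \<and> q \<in> \<G> k \<and> pconv (\<lambda>n. s (r n)) q"
proof -
  obtain M where M: "M > 0" "\<And>q. q \<in> \<G> k \<Longrightarrow> AE \<xi> in I0. norm (dn q \<xi>) \<le> M"
    "\<And>q \<tau>. q \<in> \<G> k \<Longrightarrow> \<tau> \<in> {0..T} \<Longrightarrow> norm (arc (dn q) \<tau>) \<le> M"
    using Gk_bounded by blast
  have pos: "s n \<in> positions T y K" for n using s[of n] by (simp add: Gk_iff)
  define \<kappa> where "\<kappa> = real k * c0"
  have \<kappa>: "\<kappa> \<ge> 0" using c0_pos by (simp add: \<kappa>_def)
  have growth: "AE \<xi> in I0. norm (dn (s n) \<xi>) \<le> \<kappa> * (1 + norm (arc (dn (s n)) \<xi>))" for n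
    using s[of n] by (simp add: Gk_iff \<kappa>_def)
  have "seq_compact {0..T}" by (simp add: compact_imp_seq_compact)
  from this[unfolded seq_compact_def, rule_format, of "\<lambda>n. fst (s n)"] position_time[OF pos]
  obtain t r1 where "t \<in> {0..T}" "strict_mono r1" "((\<lambda>n. fst (s n)) \<circ> r1) \<longlonglongrightarrow> t"
    by auto
  then have t: "t \<in> {0..T}" "strict_mono r1" "(\<lambda>n. fst (s (r1 n))) \<longlonglongrightarrow> t"
    by (auto simp: comp_def)
  obtain a and r2 :: "nat \<Rightarrow> nat" where a: "continuous_on {0..T} a" "strict_mono r2"
    "\<And>e. 0 < e \<Longrightarrow> \<exists>N. \<forall>n \<tau>. n \<ge> N \<and> \<tau> \<in> {0..T} \<longrightarrow> norm (arc (dn (s (r1 (r2 n)))) \<tau> - a \<tau>) < e"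
  proof (rule Arzela_Ascoli[of "{0..T}" "\<lambda>n. arc (dn (s (r1 n)))" M])
    fix x e :: real assume x: "x \<in> {0..T}" and e: "0 < e"
    obtain d where d: "d > 0" "\<And>l \<tau> \<tau>'. l \<in> Linf T \<Longrightarrow> AE \<xi> in I0. norm (l \<xi>) \<le> M \<Longrightarrow> \<tau> \<in> {0..T} \<Longrightarrow>
      \<tau>' \<in> {0..T} \<Longrightarrow> \<bar>\<tau> - \<tau>'\<bar> < d \<Longrightarrow> norm (arc l \<tau> - arc l \<tau>') < e"
      using arc_equicontinuous[of M e] M(1) e by (metis less_imp_le)
    then show "\<exists>d>0. \<forall>n y. y \<in> {0..T} \<and> norm (x - y) < d \<longrightarrow>
        norm (arc (dn (s (r1 n))) x - arc (dn (s (r1 n))) y) < e"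
      using x position_dn(1)[OF pos] M(2)[OF s] by (intro exI[of _ d]) auto
  next
    show "norm (arc (dn (s (r1 n))) \<tau>) \<le> M" if "\<tau> \<in> {0..T}" for n \<tau> by (rule M(3)[OF s that])
  qed (simp, rule that)
  define r where "r = r1 \<circ> r2"
  have r: "strict_mono r" using t(2) a(2) by (simp add: r_def strict_mono_o)
  have tr: "(\<lambda>n. fst (s (r n))) \<longlonglongrightarrow> t"
    using LIMSEQ_subseq_LIMSEQ[OF t(3) a(2)] by (simp add: r_def comp_def)
  have ar: "\<exists>N. \<forall>n \<tau>. n \<ge> N \<and> \<tau> \<in> {0..T} \<longrightarrow> norm (arc (dn (s (r n))) \<tau> - a \<tau>) < e" if "e > 0" for e
    using a(3)[OF that] by (simp add: r_def)
  \<comment> \<open>Densities generating paths \<open>\<epsilon> m\<close>-close to \<open>a\<close>, with the bounds that hold in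
    the limit relaxed by \<open>\<epsilon> m\<close>.\<close>
  define \<epsilon> where "\<epsilon> m = 1 / (real m + 1)" for m
  have \<epsilon>: "\<epsilon> m > 0" "m \<le> n \<Longrightarrow> \<epsilon> n \<le> \<epsilon> m" for m n by (auto simp: \<epsilon>_def frac_le)
  have \<epsilon>0: "\<epsilon> \<longlonglongrightarrow> 0"
    using LIMSEQ_inverse_real_of_nat by (simp add: \<epsilon>_def[abs_def] inverse_eq_divide add.commute)
  define A where "A m = {l. l \<in> borel_measurable I0 \<and> (AE \<xi> in I0. norm (l \<xi>) \<le> M) \<and>
      (\<forall>\<tau>\<in>{0..T}. norm (arc l \<tau> - a \<tau>) \<le> \<epsilon> m) \<and>
      (AE \<xi> in I0. norm (l \<xi>) \<le> \<kappa> * (1 + norm (a \<xi>) + \<epsilon> m)) \<and>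
      (AE \<xi> in I0. t + \<epsilon> m < \<xi> \<longrightarrow> l \<xi> = 0)}" for m
  have AL: "l \<in> Linf T" if "l \<in> A m" for l m using that by (auto simp: A_def Linf_def)
  have inI: "AE \<xi> in I0. \<xi> \<in> {0..T}" by (rule AE_I2) simp
  obtain g \<rho> l where g: "\<And>m. g m \<in> A m" and \<rho>: "strict_mono (\<rho> :: nat \<Rightarrow> nat)"
    and lm: "l \<in> borel_measurable I0" and lim: "AE \<xi> in I0. (\<lambda>i. g (\<rho> i) \<xi>) \<longlonglongrightarrow> l \<xi>"
  proof (rule midpoint_convex_AE_limit[of I0 A M])
    show "finite_measure I0" by (rule finite_measure_lebesgue_on) simp
    show "A m \<noteq> {}" for m
    proof -
      obtain N1 where N1: "\<And>n. n \<ge> N1 \<Longrightarrow> \<bar>fst (s (r n)) - t\<bar> < \<epsilon> m"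
        using tr \<epsilon>(1)[of m] unfolding LIMSEQ_iff by (metis real_norm_def)
      obtain N2 where N2: "\<And>n \<tau>. n \<ge> N2 \<Longrightarrow> \<tau> \<in> {0..T} \<Longrightarrow> norm (arc (dn (s (r n))) \<tau> - a \<tau>) < \<epsilon> m"
        using ar[OF \<epsilon>(1)[of m]] by blast
      define n where "n = max N1 N2"
      have "dn (s (r n)) \<in> A m"
        unfolding A_def
      proof (intro CollectI conjI ballI)
        show "dn (s (r n)) \<in> borel_measurable I0" using position_dn(1)[OF pos] by (simp add: Linf_def)
        show "AE \<xi> in I0. norm (dn (s (r n)) \<xi>) \<le> M" by (rule M(2)[OF s])
        show "norm (arc (dn (s (r n))) \<tau> - a \<tau>) \<le> \<epsilon> m" if "\<tau> \<in> {0..T}" for \<tau>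
          using N2[of n \<tau>] that by (simp add: n_def)
        show "AE \<xi> in I0. norm (dn (s (r n)) \<xi>) \<le> \<kappa> * (1 + norm (a \<xi>) + \<epsilon> m)"
          using growth[of "r n"] inI
        proof eventually_elim
          case (elim \<xi>)
          have "norm (arc (dn (s (r n))) \<xi>) \<le> norm (a \<xi>) + \<epsilon> m"
            using N2[of n \<xi>] elim(2) norm_triangle_ineq2[of "arc (dn (s (r n))) \<xi>" "a \<xi>"] by (simp add: n_def)
          then show ?case using elim(1) mult_left_mono[OF _ \<kappa>, of "1 + norm (arc (dn (s (r n))) \<xi>)" "1 + norm (a \<xi>) + \<epsilon> m"]
            by linarith
        qed
        show "AE \<xi> in I0. t + \<epsilon> m < \<xi> \<longrightarrow> dn (s (r n)) \<xi> = 0"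
          using N1[of n] by (intro AE_I2) (auto simp: dn_def cut_def n_def)
      qed
      then show ?thesis by auto
    qed
    show "A n \<subseteq> A m" if "m \<le> n" for m n
    proof
      fix l assume l: "l \<in> A n"
      note e = \<epsilon>(2)[OF that]
      have "AE \<xi> in I0. norm (l \<xi>) \<le> \<kappa> * (1 + norm (a \<xi>) + \<epsilon> n)" using l by (simp add: A_def)
      then have "AE \<xi> in I0. norm (l \<xi>) \<le> \<kappa> * (1 + norm (a \<xi>) + \<epsilon> m)"
        by eventually_elim (rule order_trans, assumption, intro mult_left_mono, use \<kappa> e in auto)
      moreover have "AE \<xi> in I0. t + \<epsilon> n < \<xi> \<longrightarrow> l \<xi> = 0" using l by (simp add: A_def)
      then have "AE \<xi> in I0. t + \<epsilon> m < \<xi> \<longrightarrow> l \<xi> = 0" by eventually_elim (use e in auto)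
      moreover have "\<forall>\<tau>\<in>{0..T}. norm (arc l \<tau> - a \<tau>) \<le> \<epsilon> m" using l e by (force simp: A_def)
      ultimately show "l \<in> A m" using l by (simp add: A_def)
    qed
    show "l \<in> borel_measurable I0" if "l \<in> A m" for l m using that by (simp add: A_def)
    show "AE \<xi> in I0. norm (l \<xi>) \<le> M" if "l \<in> A m" for l m using that by (simp add: A_def)
    show "(\<lambda>\<xi>. (1 / 2) *\<^sub>R (l \<xi> + l' \<xi>)) \<in> A m" if l: "l \<in> A m" "l' \<in> A m" for l l' m
    proof -
      have half: "norm ((1 / 2) *\<^sub>R (u + v)) \<le> c" if "norm u \<le> c" "norm v \<le> c" for u v :: "real^'n" and c
        using norm_triangle_ineq[of u v] that by simp
      have al: "arc (\<lambda>\<xi>. (1 / 2) *\<^sub>R (l \<xi> + l' \<xi>)) \<tau> - a \<tau> = (1/2) *\<^sub>R ((arc l \<tau> - a \<tau>) + (arc l' \<tau> - a \<tau>))" for \<tau>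
      proof -
        have "J (\<lambda>\<xi>. (1 / 2) *\<^sub>R (l \<xi> + l' \<xi>)) \<tau> = (1/2) *\<^sub>R (J l \<tau> + J l' \<tau>)"
          using J_add[OF AL[OF l(1)] AL[OF l(2)]] by (simp only: J_scaleR)
        moreover have "u + (1/2) *\<^sub>R (j + j') - z = (1/2) *\<^sub>R ((u + j - z) + (u + j' - z))" for u j j' z :: "real^'n"
          by (simp add: vec_eq_iff algebra_simps)
        ultimately show ?thesis by (simp add: arc_def)
      qed
      have b: "AE \<xi> in I0. norm (l \<xi>) \<le> M" "AE \<xi> in I0. norm (l' \<xi>) \<le> M"
        "AE \<xi> in I0. norm (l \<xi>) \<le> \<kappa> * (1 + norm (a \<xi>) + \<epsilon> m)" "AE \<xi> in I0. norm (l' \<xi>) \<le> \<kappa> * (1 + norm (a \<xi>) + \<epsilon> m)"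
        "AE \<xi> in I0. t + \<epsilon> m < \<xi> \<longrightarrow> l \<xi> = 0" "AE \<xi> in I0. t + \<epsilon> m < \<xi> \<longrightarrow> l' \<xi> = 0"
        and m: "l \<in> borel_measurable I0" "l' \<in> borel_measurable I0"
        using l by (simp_all add: A_def)
      show ?thesis
        unfolding A_def
      proof (intro CollectI conjI ballI)
        show "AE \<xi> in I0. norm ((1 / 2) *\<^sub>R (l \<xi> + l' \<xi>)) \<le> M"
          using b(1,2) by eventually_elim (rule half)
        show "AE \<xi> in I0. norm ((1 / 2) *\<^sub>R (l \<xi> + l' \<xi>)) \<le> \<kappa> * (1 + norm (a \<xi>) + \<epsilon> m)"
          using b(3,4) by eventually_elim (rule half)
        show "AE \<xi> in I0. t + \<epsilon> m < \<xi> \<longrightarrow> (1 / 2) *\<^sub>R (l \<xi> + l' \<xi>) = 0"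
          using b(5,6) by eventually_elim simp
        show "norm (arc (\<lambda>\<xi>. (1 / 2) *\<^sub>R (l \<xi> + l' \<xi>)) \<tau> - a \<tau>) \<le> \<epsilon> m" if "\<tau> \<in> {0..T}" for \<tau>
          unfolding al by (rule half) (use l that in \<open>auto simp: A_def\<close>)
        show "(\<lambda>\<xi>. (1 / 2) *\<^sub>R (l \<xi> + l' \<xi>)) \<in> borel_measurable I0" using m by measurable
      qed
    qed
  qed blast
  have g\<rho>: "g (\<rho> i) \<in> A (\<rho> i)" for i by (rule g)
  have \<epsilon>\<rho>: "(\<lambda>i. \<epsilon> (\<rho> i)) \<longlonglongrightarrow> 0"
    using LIMSEQ_subseq_LIMSEQ[OF \<epsilon>0 \<rho>] by (simp add: comp_def)
  have "AE \<xi> in I0. norm (g (\<rho> i) \<xi>) \<le> M" for i using g\<rho>[of i] by (simp add: A_def)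
  then have gM: "AE \<xi> in I0. \<forall>i. norm (g (\<rho> i) \<xi>) \<le> M" by (simp add: AE_all_countable)
  \<comment> \<open>All constraints are closed under convergence almost everywhere, and the relaxation disappears.\<close>
  have lM: "AE \<xi> in I0. norm (l \<xi>) \<le> M"
    using gM lim by eventually_elim (rule LIMSEQ_le_const2[OF tendsto_norm], auto)
  have lL: "l \<in> Linf T" using lm lM by (auto simp: Linf_def)
  have "AE \<xi> in I0. norm (g (\<rho> i) \<xi>) \<le> \<kappa> * (1 + norm (a \<xi>) + \<epsilon> (\<rho> i))" for i
    using g\<rho>[of i] by (simp add: A_def)
  then have "AE \<xi> in I0. \<forall>i. norm (g (\<rho> i) \<xi>) \<le> \<kappa> * (1 + norm (a \<xi>) + \<epsilon> (\<rho> i))" by (simp add: AE_all_countable)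
  then have l\<kappa>: "AE \<xi> in I0. norm (l \<xi>) \<le> \<kappa> * (1 + norm (a \<xi>))"
    using lim
  proof eventually_elim
    case (elim \<xi>)
    have "(\<lambda>i. \<kappa> * (1 + norm (a \<xi>) + \<epsilon> (\<rho> i))) \<longlonglongrightarrow> \<kappa> * (1 + norm (a \<xi>) + 0)"
      by (intro tendsto_intros \<epsilon>\<rho>)
    from LIMSEQ_le[OF tendsto_norm[OF elim(2)] this] elim(1) show ?case by auto
  qed
  have "AE \<xi> in I0. t + \<epsilon> (\<rho> i) < \<xi> \<longrightarrow> g (\<rho> i) \<xi> = 0" for i
    using g\<rho>[of i] by (simp add: A_def)
  then have "AE \<xi> in I0. \<forall>i. t + \<epsilon> (\<rho> i) < \<xi> \<longrightarrow> g (\<rho> i) \<xi> = 0" by (simp add: AE_all_countable)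
  then have l0: "AE \<xi> in I0. l \<xi> = cut t l \<xi>"
    using lim
  proof eventually_elim
    case (elim \<xi>)
    show ?case
    proof (cases "\<xi> \<le> t")
      case False
      then have "eventually (\<lambda>i. \<epsilon> (\<rho> i) < \<xi> - t) sequentially" using order_tendstoD(2)[OF \<epsilon>\<rho>, of "\<xi> - t"] by simp
      then have "eventually (\<lambda>i. g (\<rho> i) \<xi> = 0) sequentially"
        by eventually_elim (use elim(1) in \<open>auto simp: algebra_simps\<close>)
      then have "(\<lambda>i. g (\<rho> i) \<xi>) \<longlonglongrightarrow> 0" by (simp add: tendsto_eventually)
      then have "l \<xi> = 0" using elim(2) LIMSEQ_unique by blast
      then show ?thesis using False by (simp add: cut_def)
    qed (simp add: cut_def)
  qed
  have arcl: "arc l \<tau> = a \<tau>" if \<tau>: "\<tau> \<in> {0..T}" for \<tau>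
  proof -
    have "(\<lambda>i. J (g (\<rho> i)) \<tau>) \<longlonglongrightarrow> J l \<tau>"
      by (rule J_tendsto[OF AL[OF g\<rho>] lL less_imp_le[OF M(1)] _ lim])
         (use g\<rho> in \<open>auto simp: A_def\<close>)
    then have "(\<lambda>i. norm (arc (g (\<rho> i)) \<tau> - a \<tau>)) \<longlonglongrightarrow> norm (arc l \<tau> - a \<tau>)"
      unfolding arc_def by (intro tendsto_intros)
    from LIMSEQ_le[OF this \<epsilon>\<rho>] have "norm (arc l \<tau> - a \<tau>) \<le> 0"
      using g\<rho> \<tau> by (auto simp: A_def)
    then show ?thesis by simp
  qed
  define q where "q = (t, restrict (arc l) {0..t})"
  note q = arc_position[OF lL t(1), folded q_def]
  have arcq: "arc (dn q) \<tau> = a \<tau>" if "\<tau> \<in> {0..T}" for \<tau>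
  proof -
    have "J (cut t l) \<tau> = J l \<tau>"
      by (rule J_cong[OF cut_Linf' lL]) (use lL t(1) l0 in \<open>auto elim!: eventually_mono\<close>)
    then show ?thesis using q(3)[OF that] arcl[OF that] by (simp add: arc_def)
  qed
  have "AE \<xi> in I0. norm (dn q \<xi>) \<le> \<kappa> * (1 + norm (arc (dn q) \<xi>))"
    using q(2) l0 l\<kappa> inI by eventually_elim (simp add: arcq)
  then have "q \<in> \<G> k" using q(1) by (simp add: Gk_iff \<kappa>_def)
  moreover have "pconv (\<lambda>n. s (r n)) q"
    unfolding pconv_def
  proof (intro conjI allI impI)
    show "(\<lambda>n. fst (s (r n))) \<longlonglongrightarrow> fst q" using tr by (simp add: q_def)
    show "\<exists>N. \<forall>n\<ge>N. \<forall>\<tau>\<in>{0..T}. norm (arc (dn (s (r n))) \<tau> - arc (dn q) \<tau>) < e" if "e > 0" for e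
      using ar[OF that] arcq by metis
  qed
  ultimately show ?thesis using r by blast
qed

lemma pos_dist_eq:
  assumes "q \<in> positions T y K" "p \<in> positions T y K"
  shows "pos_dist T q p = \<bar>fst q - fst p\<bar> +
    (SUP \<tau>\<in>{0..T}. norm (arc (dn q) (min \<tau> (fst q)) - arc (dn p) (min \<tau> (fst p))))"
proof -
  have "(SUP \<tau>\<in>{0..T}. norm (snd q (min \<tau> (fst q)) - snd p (min \<tau> (fst p)))) =
    (SUP \<tau>\<in>{0..T}. norm (arc (dn q) (min \<tau> (fst q)) - arc (dn p) (min \<tau> (fst p))))"
    using position_time[OF assms(1)] position_time[OF assms(2)]
    by (intro SUP_cong refl) (auto simp: position_dn(2)[OF assms(1)] position_dn(2)[OF assms(2)])
  then show ?thesis by (simp add: pos_dist_def case_prod_unfold)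
qed

lemma pos_dist_upper:
  assumes q: "q \<in> positions T y K" and p: "p \<in> positions T y K" and \<tau>: "\<tau> \<in> {0..T}"
  shows "\<bar>fst q - fst p\<bar> \<le> pos_dist T q p"
    "norm (arc (dn q) (min \<tau> (fst q)) - arc (dn p) (min \<tau> (fst p))) \<le> pos_dist T q p"
proof -
  let ?f = "\<lambda>\<tau>. norm (arc (dn q) (min \<tau> (fst q)) - arc (dn p) (min \<tau> (fst p)))"
  obtain B where B: "B \<ge> 0" "\<And>\<tau>. \<tau> \<in> {0..T} \<Longrightarrow> norm (arc (dn q) \<tau>) \<le> B"
    using arc_bounded[OF position_dn(1)[OF q]] by blast
  obtain B' where B': "B' \<ge> 0" "\<And>\<tau>. \<tau> \<in> {0..T} \<Longrightarrow> norm (arc (dn p) \<tau>) \<le> B'"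
    using arc_bounded[OF position_dn(1)[OF p]] by blast
  have "bdd_above (?f ` {0..T})"
  proof (rule bdd_aboveI2)
    fix \<tau> assume "\<tau> \<in> {0..T}"
    then have "min \<tau> (fst q) \<in> {0..T}" "min \<tau> (fst p) \<in> {0..T}"
      using position_time[OF q] position_time[OF p] by auto
    then show "?f \<tau> \<le> B + B'" using B(2) B'(2) by (meson add_mono norm_triangle_ineq4 order_trans)
  qed
  then have "?f \<tau> \<le> (SUP \<tau>\<in>{0..T}. ?f \<tau>)" using \<tau> by (intro cSUP_upper)
  moreover have "0 \<le> ?f \<tau>" by simp
  ultimately show "\<bar>fst q - fst p\<bar> \<le> pos_dist T q p" "?f \<tau> \<le> pos_dist T q p"
    unfolding pos_dist_eq[OF q p] by linarith+
qed

lemma pconv_imp_pos_dist: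
  assumes s: "\<And>n. s n \<in> positions T y K" and q: "q \<in> positions T y K" and c: "pconv s q" and e: "e > 0"
  shows "\<exists>N. \<forall>n\<ge>N. pos_dist T q (s n) < e"
proof -
  have e4: "e / 4 > 0" using e by simp
  have "uniformly_continuous_on {0..T} (arc (dn q))"
    by (intro compact_uniformly_continuous arc_continuous position_dn q) simp
  then obtain d where d: "d > 0" "\<And>\<tau> \<tau>'. \<tau> \<in> {0..T} \<Longrightarrow> \<tau>' \<in> {0..T} \<Longrightarrow> dist \<tau>' \<tau> < d \<Longrightarrow>
      dist (arc (dn q) \<tau>') (arc (dn q) \<tau>) < e / 4"
    using e4 unfolding uniformly_continuous_on_def by metis
  obtain N1 where N1: "\<And>n. n \<ge> N1 \<Longrightarrow> \<bar>fst (s n) - fst q\<bar> < min d (e / 4)"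
    using pconv_time[OF c] d(1) e4 unfolding LIMSEQ_iff by (metis min_less_iff_conj real_norm_def)
  obtain N2 where N2: "\<And>n \<tau>. n \<ge> N2 \<Longrightarrow> \<tau> \<in> {0..T} \<Longrightarrow> norm (arc (dn (s n)) \<tau> - arc (dn q) \<tau>) < e / 4"
    using c e4 unfolding pconv_def by meson
  have "pos_dist T q (s n) < e" if n: "n \<ge> max N1 N2" for n
  proof -
    have "(SUP \<tau>\<in>{0..T}. norm (arc (dn q) (min \<tau> (fst q)) - arc (dn (s n)) (min \<tau> (fst (s n))))) \<le> e / 4 + e / 4"
    proof (rule cSUP_least)
      fix \<tau> assume \<tau>: "\<tau> \<in> {0..T}"
      let ?u = "min \<tau> (fst q)" and ?v = "min \<tau> (fst (s n))"
      have uv: "?u \<in> {0..T}" "?v \<in> {0..T}" using \<tau> position_time[OF q] position_time[OF s[of n]] by auto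
      have "\<bar>fst (s n) - fst q\<bar> < d" using N1[of n] n by simp
      moreover have "\<bar>?v - ?u\<bar> \<le> \<bar>fst (s n) - fst q\<bar>" by (auto simp: min_def)
      ultimately have "dist ?v ?u < d" by (simp add: dist_real_def)
      then have 1: "norm (arc (dn q) ?v - arc (dn q) ?u) < e / 4" using d(2)[OF uv] by (simp add: dist_norm)
      have 2: "norm (arc (dn (s n)) ?v - arc (dn q) ?v) < e / 4" using N2[of n ?v] n uv by simp
      show "norm (arc (dn q) ?u - arc (dn (s n)) ?v) \<le> e / 4 + e / 4"
        using dist_triangle3[of "arc (dn q) ?u" "arc (dn (s n)) ?v" "arc (dn q) ?v"] 1 2
        unfolding dist_norm by (simp add: norm_minus_commute)
    qed (use T_pos in auto)
    moreover have "\<bar>fst q - fst (s n)\<bar> < e / 4" using N1[of n] n by (simp add: abs_minus_commute)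
    ultimately show ?thesis unfolding pos_dist_eq[OF q s] using e by linarith
  qed
  then show ?thesis by blast
qed

text \<open>The metric only sees the paths up to the times of the positions. By compactness and unique
  solvability it nevertheless controls the prolongations on the sets \<open>\<G> k\<close>.\<close>
lemma pos_dist_imp_pconv:
  assumes s: "\<And>n. s n \<in> \<G> k" and q: "q \<in> positions T y K"
    and lim: "(\<lambda>n. pos_dist T q (s n)) \<longlonglongrightarrow> 0"
  shows "pconv s q"
proof -
  have pos: "s n \<in> positions T y K" for n using s[of n] by (simp add: Gk_iff)
  have T: "0 \<in> {0..T}" using T_pos by simp
  have time: "(\<lambda>n. fst (s n)) \<longlonglongrightarrow> fst q"
  proof (rule LIM_zero_cancel, rule Lim_null_comparison[OF _ lim])
    show "eventually (\<lambda>n. norm (fst (s n) - fst q) \<le> pos_dist T q (s n)) sequentially"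
      using pos_dist_upper(1)[OF q pos T] by (simp add: abs_minus_commute)
  qed
  show ?thesis
    unfolding pconv_def
  proof (intro conjI time allI impI, rule ccontr)
    fix e :: real assume e: "e > 0"
      and neg: "\<nexists>N. \<forall>n\<ge>N. \<forall>\<tau>\<in>{0..T}. norm (arc (dn (s n)) \<tau> - arc (dn q) \<tau>) < e"
    then have "\<exists>n\<ge>N. \<exists>\<tau>\<in>{0..T}. \<not> norm (arc (dn (s n)) \<tau> - arc (dn q) \<tau>) < e" for N by blast
    then have "infinite {n. \<exists>\<tau>\<in>{0..T}. \<not> norm (arc (dn (s n)) \<tau> - arc (dn q) \<tau>) < e}"
      unfolding infinite_nat_iff_unbounded_le by auto
    from infinite_enumerate[OF this] obtain r1 :: "nat \<Rightarrow> nat" where r1: "strict_mono r1"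
      "\<And>n. \<exists>\<tau>\<in>{0..T}. \<not> norm (arc (dn (s (r1 n))) \<tau> - arc (dn q) \<tau>) < e" by auto
    obtain r2 p where p: "strict_mono r2" "p \<in> \<G> k" "pconv (\<lambda>n. s (r1 (r2 n))) p"
      using Gk_compact[of "\<lambda>n. s (r1 n)" k] s by blast
    have pp: "p \<in> positions T y K" using p(2) by (simp add: Gk_iff)
    have r: "strict_mono (\<lambda>n. r1 (r2 n))" using r1(1) p(1) by (simp add: strict_mono_def)
    have "(\<lambda>n. fst (s (r1 (r2 n)))) \<longlonglongrightarrow> fst q"
      using LIMSEQ_subseq_LIMSEQ[OF time r] by (simp add: comp_def)
    then have tp: "fst p = fst q" using pconv_time[OF p(3)] LIMSEQ_unique by blast
    have ld: "(\<lambda>n. pos_dist T q (s (r1 (r2 n)))) \<longlonglongrightarrow> 0"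
      using LIMSEQ_subseq_LIMSEQ[OF lim r] by (simp add: comp_def)
    have "snd q \<tau> = arc (dn p) \<tau>" if \<tau>: "\<tau> \<in> {0..fst q}" for \<tau>
    proof -
      let ?v = "\<lambda>n. min \<tau> (fst (s (r1 (r2 n))))"
      have \<tau>T: "\<tau> \<in> {0..T}" using \<tau> position_time[OF q] by auto
      have "?v \<longlonglongrightarrow> min \<tau> (fst p)" by (intro tendsto_min tendsto_const pconv_time[OF p(3)])
      moreover have "?v n \<in> {0..T}" for n using \<tau>T position_time[OF pos] by (auto simp: min_le_iff_disj)
      ultimately have 1: "(\<lambda>n. arc (dn (s (r1 (r2 n)))) (?v n)) \<longlonglongrightarrow> arc (dn p) (min \<tau> (fst p))"
        by (intro pconv_diag[OF p(3) pp])
      have "(\<lambda>n. arc (dn q) (min \<tau> (fst q)) - arc (dn (s (r1 (r2 n)))) (?v n)) \<longlonglongrightarrow> 0"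
        by (rule Lim_null_comparison[OF _ ld]) (use pos_dist_upper(2)[OF q pos \<tau>T] in simp)
      from tendsto_diff[OF tendsto_const[of "arc (dn q) (min \<tau> (fst q))"] this]
      have "(\<lambda>n. arc (dn (s (r1 (r2 n)))) (?v n)) \<longlonglongrightarrow> arc (dn q) (min \<tau> (fst q))" by simp
      then have "arc (dn p) (min \<tau> (fst p)) = arc (dn q) (min \<tau> (fst q))" using 1 LIMSEQ_unique by blast
      then show ?thesis using \<tau> tp position_dn(2)[OF q \<tau>] by (simp add: min_def)
    qed
    then have qe: "q = (fst q, restrict (arc (dn p)) {0..fst q})"
      by (rule position_eqI[OF q position_dn(1)[OF pp]])
    have "p = (fst p, restrict (arc (dn p)) {0..fst p})"
      by (rule position_eqI[OF pp position_dn(1)[OF pp]]) (rule position_dn(2)[OF pp])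
    then have "p = q" using qe tp by simp
    then obtain N where "\<forall>n\<ge>N. \<forall>\<tau>\<in>{0..T}. norm (arc (dn (s (r1 (r2 n)))) \<tau> - arc (dn q) \<tau>) < e"
      using p(3) e unfolding pconv_def by blast
    then show False using r1(2)[of "r2 N"] by blast
  qed
qed

lemma pos_continuous_onD:
  assumes "pos_continuous_on T S f" "S \<subseteq> positions T y K" "\<And>n. s n \<in> S" "q \<in> S" "pconv s q"
  shows "(\<lambda>n. f (s n)) \<longlonglongrightarrow> f q"
  unfolding lim_sequentially
proof (intro allI impI)
  fix e :: real assume "e > 0"
  then obtain d where d: "d > 0" "\<And>p. p \<in> S \<Longrightarrow> pos_dist T q p < d \<Longrightarrow> dist (f q) (f p) < e"
    using assms(1,4) unfolding pos_continuous_on_def by blast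
  obtain N where "\<forall>n\<ge>N. pos_dist T q (s n) < d"
    using pconv_imp_pos_dist[OF _ _ assms(5) d(1)] assms(2,3,4) by blast
  then show "\<exists>N. \<forall>n\<ge>N. dist (f (s n)) (f q) < e"
    using d(2)[OF assms(3)] by (metis dist_commute)
qed

lemma pos_continuous_onI:
  assumes S: "S \<subseteq> \<G> k"
    and f: "\<And>s q. (\<And>n. s n \<in> S) \<Longrightarrow> q \<in> S \<Longrightarrow> pconv s q \<Longrightarrow> (\<lambda>n. f (s n)) \<longlonglongrightarrow> f q"
  shows "pos_continuous_on T S f"
  unfolding pos_continuous_on_def
proof (intro ballI allI impI, rule ccontr)
  fix q and e :: real
  assume q: "q \<in> S" and e: "e > 0" and neg: "\<not> (\<exists>d>0. \<forall>p\<in>S. pos_dist T q p < d \<longrightarrow> dist (f q) (f p) < e)"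
  have "\<exists>p\<in>S. pos_dist T q p < 1 / (real n + 1) \<and> \<not> dist (f q) (f p) < e" for n :: nat
    using neg by (metis add_nonneg_pos divide_pos_pos of_nat_0_le_iff zero_less_one)
  then obtain s where s: "\<And>n. s n \<in> S" "\<And>n. pos_dist T q (s n) < 1 / (real n + 1)" "\<And>n. \<not> dist (f q) (f (s n)) < e"
    by metis
  have sG: "\<And>n. s n \<in> \<G> k" using s(1) S by blast
  have qp: "q \<in> positions T y K" using q S by (auto simp: Gk_iff)
  have "(\<lambda>n. pos_dist T q (s n)) \<longlonglongrightarrow> 0"
  proof (rule Lim_null_comparison)
    show "(\<lambda>n. 1 / (real n + 1)) \<longlonglongrightarrow> 0"
      using LIMSEQ_inverse_real_of_nat by (simp add: inverse_eq_divide add.commute)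
    have "0 \<le> pos_dist T q (s n)" for n
      using pos_dist_upper(1)[OF qp, of "s n" 0] sG[of n] T_pos
      by (intro order_trans[OF abs_ge_zero]) (auto simp: Gk_iff)
    then show "\<forall>\<^sub>F n in sequentially. norm (pos_dist T q (s n)) \<le> 1 / (real n + 1)"
      using s(2) by (simp add: less_imp_le)
  qed
  from f[OF s(1) q pos_dist_imp_pconv[OF sG qp this]]
  obtain n where "dist (f (s n)) (f q) < e" using e unfolding lim_sequentially by blast
  then show False using s(3)[of n] by (simp add: dist_commute)
qed

end

section \<open>Smooth test functionals\<close>

text \<open>The norm, smoothed at the origin at scale \<open>e\<close>.\<close>
definition smooth_norm :: "real \<Rightarrow> 'a::real_inner \<Rightarrow> real" where
  "smooth_norm e v = sqrt (e\<^sup>2 + (norm v)\<^sup>2)"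

text \<open>The inner product of this vector with \<open>u - v\<close> is the increment of the smoothed norm from \<open>v\<close> to \<open>u\<close>;
  on the diagonal it is the gradient.\<close>
definition norm_slope :: "real \<Rightarrow> 'a::real_inner \<Rightarrow> 'a \<Rightarrow> 'a" where
  "norm_slope e u v = (1 / (smooth_norm e u + smooth_norm e v)) *\<^sub>R (u + v)"

lemma smooth_norm_ge: "norm v \<le> smooth_norm e v"
  unfolding smooth_norm_def by (rule real_le_rsqrt) simp

lemma smooth_norm_le: "e \<ge> 0 \<Longrightarrow> smooth_norm e v \<le> norm v + e"
  unfolding smooth_norm_def by (rule real_le_lsqrt) (auto simp: power2_sum)

lemma smooth_norm_pos: "e > 0 \<Longrightarrow> smooth_norm e v > 0"
  unfolding smooth_norm_def by (simp add: add_pos_nonneg)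

lemma smooth_norm_minus: "smooth_norm e (- v) = smooth_norm e v"
  by (simp add: smooth_norm_def)

lemma smooth_norm_diff:
  assumes "e > 0" shows "smooth_norm e u - smooth_norm e v = inner (norm_slope e u v) (u - v)"
proof -
  have p: "smooth_norm e u + smooth_norm e v > 0" by (intro add_pos_pos smooth_norm_pos assms)
  have "(smooth_norm e u - smooth_norm e v) * (smooth_norm e u + smooth_norm e v) = (smooth_norm e u)\<^sup>2 - (smooth_norm e v)\<^sup>2"
    by (simp add: power2_eq_square algebra_simps)
  also have "\<dots> = (norm u)\<^sup>2 - (norm v)\<^sup>2" by (simp add: smooth_norm_def)
  also have "\<dots> = inner (u + v) (u - v)"
    by (simp add: power2_norm_eq_inner inner_simps inner_commute)
  finally have "smooth_norm e u - smooth_norm e v = inner (u + v) (u - v) / (smooth_norm e u + smooth_norm e v)"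
    using p by (simp add: eq_divide_eq)
  then show ?thesis by (simp only: norm_slope_def inner_scaleR_left) simp
qed

lemma norm_slope_le: assumes "e > 0" shows "norm (norm_slope e u v) \<le> 1"
proof -
  have p: "smooth_norm e u + smooth_norm e v > 0" by (intro add_pos_pos smooth_norm_pos assms)
  have "norm (u + v) \<le> smooth_norm e u + smooth_norm e v"
    using norm_triangle_ineq[of u v] smooth_norm_ge[of u e] smooth_norm_ge[of v e] by linarith
  then show ?thesis using p by (simp add: norm_slope_def)
qed

lemma norm_slope_minus: "norm_slope e (- u) (- v) = - norm_slope e u v"
proof -
  have "- u + - v = - (u + v)" by simp
  then show ?thesis unfolding norm_slope_def smooth_norm_minus by (simp only: scaleR_minus_right)
qed

lemma tendsto_smooth_norm: "(f \<longlongrightarrow> l) F \<Longrightarrow> ((\<lambda>x. smooth_norm e (f x)) \<longlongrightarrow> smooth_norm e l) F"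
  unfolding smooth_norm_def by (intro tendsto_intros)

lemma tendsto_norm_slope:
  assumes "e > 0" "(f \<longlongrightarrow> a) F" "(g \<longlongrightarrow> b) F"
  shows "((\<lambda>x. norm_slope e (f x) (g x)) \<longlongrightarrow> norm_slope e a b) F"
proof -
  have "smooth_norm e a + smooth_norm e b > 0" by (intro add_pos_pos smooth_norm_pos assms)
  then show ?thesis unfolding norm_slope_def by (intro tendsto_intros tendsto_smooth_norm assms) auto
qed

lemma smooth_norm_measurable [measurable]:
  fixes h :: "'a \<Rightarrow> 'b::euclidean_space"
  assumes [measurable]: "h \<in> borel_measurable M"
  shows "(\<lambda>s. smooth_norm e (h s)) \<in> borel_measurable M"
  unfolding smooth_norm_def by measurable

lemma norm_slope_measurable [measurable]:
  fixes h h' :: "'a \<Rightarrow> 'b::euclidean_space"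
  assumes [measurable]: "h \<in> borel_measurable M" "h' \<in> borel_measurable M"
  shows "(\<lambda>s. norm_slope e (h s) (h' s)) \<in> borel_measurable M"
  unfolding norm_slope_def by measurable

context weakly_singular_kernel
begin

text \<open>The gradient of the test functional below: \<open>G\<close> is the derivative of the smoothed norm along the
  prolonged path, and \<open>rho (s - t) *\<^sub>R Ke s t\<close> is the response of the prolongation at \<open>s\<close> to the
  density at \<open>t\<close>.\<close>
definition P :: "(real \<Rightarrow> real ^ 'n) \<Rightarrow> real \<Rightarrow> real ^ 'n" where
  "P G t = rho (T - t) *\<^sub>R (G T v* Ke T t) + (LINT s|I0. (rho (T - s) * rho (s - t)) *\<^sub>R (G s v* Ke s t))"

lemma Ke_vm_le_of_unit: "norm v \<le> 1 \<Longrightarrow> norm (v v* Ke \<tau> \<xi>) \<le> CK"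
  using Ke_vm_le[of v \<tau> \<xi>] mult_left_le[of "norm v" CK] CK_pos by linarith

lemma P_integrable:
  assumes G: "G \<in> borel_measurable I0" "\<And>s. norm (G s) \<le> 1" and t: "0 < \<eta>" "t \<le> T - 2 * \<eta>"
  shows "integrable I0 (\<lambda>s. (rho (T - s) * rho (s - t)) *\<^sub>R (G s v* Ke s t))"
proof (rule Bochner_Integration.integrable_bound[of _ "\<lambda>s. CK * (rho (T - s) * rho (s - t))"])
  note [measurable] = G(1)
  show "(\<lambda>s. (rho (T - s) * rho (s - t)) *\<^sub>R (G s v* Ke s t)) \<in> borel_measurable I0" by measurable
  have "norm (G s v* Ke s t) \<le> CK" for s
    by (rule Ke_vm_le_of_unit) (rule G(2))
  then show "AE s in I0. norm ((rho (T - s) * rho (s - t)) *\<^sub>R (G s v* Ke s t)) \<le> norm (CK * (rho (T - s) * rho (s - t)))"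
    using CK_pos by (intro AE_I2) (simp add: abs_mult mult.commute mult_right_mono)
qed (use rho_product_integrable[OF t] in simp)

lemma P_norm_le:
  assumes G: "G \<in> borel_measurable I0" "\<And>s. norm (G s) \<le> 1" and t: "0 < \<eta>" "0 \<le> t" "t \<le> T - 2 * \<eta>"
  shows "norm (P G t) \<le> CK * (rho \<eta> * (1 + 2 * Rho T))"
proof -
  have b: "norm (G s v* Ke s t) \<le> CK" for s
    by (rule Ke_vm_le_of_unit) (rule G(2))
  have "norm (rho (T - t) *\<^sub>R (G T v* Ke T t)) \<le> rho \<eta> * CK"
    using rho_antimono[of \<eta> "T - t"] b[of T] t by (auto intro!: mult_mono)
  moreover have "norm (LINT s|I0. (rho (T - s) * rho (s - t)) *\<^sub>R (G s v* Ke s t)) \<le>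
      (LINT s|I0. CK * (rho (T - s) * rho (s - t)))"
    by (rule norm_integral_le_integral[OF P_integrable[OF G t(1,3)]])
       (use b rho_product_integrable[OF t(1,3)] in \<open>auto simp: abs_mult mult.commute[of CK] intro!: AE_I2 mult_left_mono\<close>)
  moreover have "\<dots> \<le> CK * (rho \<eta> * (2 * Rho T))"
    using rho_product_integral_le[OF t] CK_pos by (simp add: mult_left_mono)
  ultimately show ?thesis
    unfolding P_def by (intro order_trans[OF norm_triangle_ineq]) (simp add: algebra_simps)
qed

text \<open>Pointwise convergence of the bounded factors suffices: the moving singularity is handled by
  continuity of translation in the mean, the rest by dominated convergence.\<close>
lemma P_tendsto:
  assumes G: "\<And>n. G n \<in> borel_measurable I0" "\<And>n s. norm (G n s) \<le> 1"
    and G': "G' \<in> borel_measurable I0" "\<And>s. s \<in> {0..T} \<Longrightarrow> (\<lambda>n. G n s) \<longlonglongrightarrow> G' s"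
    and t: "\<And>n. 0 \<le> t n" "t \<longlonglongrightarrow> t'" "0 \<le> t'" "t' < T"
  shows "(\<lambda>n. P (G n) (t n)) \<longlonglongrightarrow> P G' t'"
proof -
  note [measurable] = G(1) G'(1)
  \<comment> \<open>keeps \<open>t n\<close> below \<open>T - 2 * \<eta>\<close> from some index on\<close>
  define \<eta> where "\<eta> = (T - t') / 4"
  have "\<eta> > 0" using t(4) by (simp add: \<eta>_def)
  have lt: "t' < T - 2 * \<eta>" using t(4) unfolding \<eta>_def by argo
  note \<eta> = \<open>\<eta> > 0\<close> less_imp_le[OF lt]
  from lt have ev: "eventually (\<lambda>n. t n \<le> T - 2 * \<eta>) sequentially"
    using order_tendstoD(2)[OF t(2), of "T - 2 * \<eta>"] by (auto elim: eventually_mono)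
  have Tin: "T \<in> {0..T}" using T_pos by simp
  have b: "norm (G n s v* Ke s u) \<le> CK" for n s u
    by (rule Ke_vm_le_of_unit) (rule G(2))
  note vm = bounded_bilinear.tendsto[OF bounded_bilinear_vector_matrix_mult]
  have rho_t: "(\<lambda>n. rho (T - t n)) \<longlonglongrightarrow> rho (T - t')"
  proof (rule LIM_zero_cancel, rule Lim_null_comparison)
    show "eventually (\<lambda>n. norm (rho (T - t n) - rho (T - t')) \<le> rho \<eta> / \<eta> * \<bar>t n - t'\<bar>) sequentially"
      using ev
    proof eventually_elim
      case (elim n)
      then show ?case
        using rho_lipschitz[OF \<eta>(1), of "T - t n" "T - t'"] \<eta> by (simp add: abs_minus_commute)
    qed
    have "(\<lambda>n. rho \<eta> / \<eta> * \<bar>t n - t'\<bar>) \<longlonglongrightarrow> rho \<eta> / \<eta> * \<bar>t' - t'\<bar>" by (intro tendsto_intros t)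
    then show "(\<lambda>n. rho \<eta> / \<eta> * \<bar>t n - t'\<bar>) \<longlonglongrightarrow> 0" by simp
  qed
  have 1: "(\<lambda>n. rho (T - t n) *\<^sub>R (G n T v* Ke T (t n))) \<longlonglongrightarrow> rho (T - t') *\<^sub>R (G' T v* Ke T t')"
    by (intro tendsto_scaleR rho_t vm G'(2) Tin Ke_tendsto tendsto_const t)
  have 2: "(\<lambda>n. LINT s|I0. (rho (T - s) * rho (s - t')) *\<^sub>R (G n s v* Ke s (t n))) \<longlonglongrightarrow>
      (LINT s|I0. (rho (T - s) * rho (s - t')) *\<^sub>R (G' s v* Ke s t'))"
  proof (rule integral_dominated_convergence[where w = "\<lambda>s. CK * (rho (T - s) * rho (s - t'))"])
    show "integrable I0 (\<lambda>s. CK * (rho (T - s) * rho (s - t')))"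
      using rho_product_integrable[OF \<eta>] by simp
    show "AE s in I0. norm ((rho (T - s) * rho (s - t')) *\<^sub>R (G n s v* Ke s (t n))) \<le> CK * (rho (T - s) * rho (s - t'))" for n
      using b by (intro AE_I2) (auto simp: abs_mult mult.commute[of CK] intro!: mult_left_mono)
    show "AE s in I0. (\<lambda>n. (rho (T - s) * rho (s - t')) *\<^sub>R (G n s v* Ke s (t n))) \<longlonglongrightarrow>
        (rho (T - s) * rho (s - t')) *\<^sub>R (G' s v* Ke s t')"
      by (intro AE_I2 tendsto_scaleR tendsto_const vm G'(2) Ke_tendsto t) auto
  qed measurable
  have 3: "(\<lambda>n. (LINT s|I0. (rho (T - s) * rho (s - t n)) *\<^sub>R (G n s v* Ke s (t n)))
      - (LINT s|I0. (rho (T - s) * rho (s - t')) *\<^sub>R (G n s v* Ke s (t n)))) \<longlonglongrightarrow> 0"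
  proof (rule Lim_null_comparison)
    let ?q = "\<lambda>n. CK * (rho \<eta> * (2 * Rho \<bar>t n - t'\<bar>) + Rho T * (rho \<eta> / \<eta> * \<bar>t n - t'\<bar>))"
    have "?q \<longlonglongrightarrow> CK * (rho \<eta> * (2 * Rho \<bar>t' - t'\<bar>) + Rho T * (rho \<eta> / \<eta> * \<bar>t' - t'\<bar>))"
      by (intro tendsto_intros Rho_tendsto t)
    then show "?q \<longlonglongrightarrow> 0" by simp
    show "eventually (\<lambda>n. norm ((LINT s|I0. (rho (T - s) * rho (s - t n)) *\<^sub>R (G n s v* Ke s (t n)))
      - (LINT s|I0. (rho (T - s) * rho (s - t')) *\<^sub>R (G n s v* Ke s (t n)))) \<le> ?q n) sequentially"
      using ev
    proof eventually_elim
      case (elim n)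
      let ?f = "\<lambda>s. G n s v* Ke s (t n)"
      note d = rho_product_diff_integral_le[OF \<eta>(1) t(1) elim t(3) \<eta>(2)]
      have i1: "integrable I0 (\<lambda>s. (rho (T - s) * rho (s - t n)) *\<^sub>R ?f s)"
        by (rule P_integrable[OF G(1) G(2) \<eta>(1) elim])
      have i2: "integrable I0 (\<lambda>s. (rho (T - s) * rho (s - t')) *\<^sub>R ?f s)"
        by (rule Bochner_Integration.integrable_bound[of _ "\<lambda>s. CK * (rho (T - s) * rho (s - t'))"])
           (use rho_product_integrable[OF \<eta>] b CK_pos in \<open>auto simp: abs_mult mult.commute[of CK] intro!: mult_left_mono\<close>)
      have eq: "(LINT s|I0. (rho (T - s) * rho (s - t n)) *\<^sub>R ?f s) - (LINT s|I0. (rho (T - s) * rho (s - t')) *\<^sub>R ?f s)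
        = (LINT s|I0. (rho (T - s) * rho (s - t n)) *\<^sub>R ?f s - (rho (T - s) * rho (s - t')) *\<^sub>R ?f s)"
        using i1 i2 by simp
      have "norm (LINT s|I0. (rho (T - s) * rho (s - t n)) *\<^sub>R ?f s - (rho (T - s) * rho (s - t')) *\<^sub>R ?f s)
        \<le> (LINT s|I0. CK * (rho (T - s) * \<bar>rho (s - t n) - rho (s - t')\<bar>))"
      proof (rule norm_integral_le_integral)
        show "AE s in I0. norm ((rho (T - s) * rho (s - t n)) *\<^sub>R ?f s - (rho (T - s) * rho (s - t')) *\<^sub>R ?f s)
            \<le> CK * (rho (T - s) * \<bar>rho (s - t n) - rho (s - t')\<bar>)"
        proof (rule AE_I2)
          fix s
          have "(rho (T - s) * rho (s - t n)) *\<^sub>R ?f s - (rho (T - s) * rho (s - t')) *\<^sub>R ?f s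
            = (rho (T - s) * (rho (s - t n) - rho (s - t'))) *\<^sub>R ?f s"
            by (simp add: algebra_simps)
          then show "norm ((rho (T - s) * rho (s - t n)) *\<^sub>R ?f s - (rho (T - s) * rho (s - t')) *\<^sub>R ?f s)
            \<le> CK * (rho (T - s) * \<bar>rho (s - t n) - rho (s - t')\<bar>)"
            using mult_left_mono[OF b[of n s "t n"], of "rho (T - s) * \<bar>rho (s - t n) - rho (s - t')\<bar>"]
            by (simp add: abs_mult mult.commute[of CK])
        qed
      qed (use i1 i2 d(1) in auto)
      also have "\<dots> \<le> ?q n" using d(2) CK_pos by (simp add: mult_left_mono)
      finally show ?case unfolding eq .
    qed
  qed
  from tendsto_add[OF 1 tendsto_add[OF 3 2]] show ?thesis by (simp add: P_def)
qed

text \<open>Fubini: pairing the response of the path with \<open>G\<close>, at \<open>T\<close> and in the weighted mean, is pairing the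
  density with \<open>P G\<close>. The density must vanish near \<open>T\<close>, where \<open>P G\<close> is unbounded.\<close>
lemma J_pairing:
  assumes G: "G \<in> borel_measurable I0" "\<And>s. norm (G s) \<le> 1"
    and l: "l \<in> Linf T" "\<And>\<xi>. T - 2 * \<eta> < \<xi> \<Longrightarrow> l \<xi> = 0" and \<eta>: "\<eta> > 0"
  shows "integrable I0 (\<lambda>\<xi>. inner (P G \<xi>) (l \<xi>))"
    "inner (G T) (J l T) + (LINT s|I0. rho (T - s) * inner (G s) (J l s)) = (LINT \<xi>|I0. inner (P G \<xi>) (l \<xi>))"
proof -
  note [measurable] = G(1) Linf_measurable[OF l(1)]
  interpret I: finite_measure I0 by (rule finite_measure_lebesgue_on) simp
  interpret II: pair_sigma_finite I0 I0 ..
  obtain M where M: "M > 0" "AE \<xi> in I0. norm (l \<xi>) \<le> M" using Linf_bound[OF l(1)] .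
  define F where "F = (\<lambda>(s, \<xi>). rho (T - s) * inner (G s) (kern s \<xi> *v l \<xi>))"
  have fst_m[measurable]: "fst \<in> borel_measurable (I0 \<Otimes>\<^sub>M I0)"
    using measurable_compose[OF measurable_fst ident_measurable_I0] by simp
  have snd_m[measurable]: "snd \<in> borel_measurable (I0 \<Otimes>\<^sub>M I0)"
    using measurable_compose[OF measurable_snd ident_measurable_I0] by simp
  have Ke2[measurable]: "(\<lambda>p. Ke (fst p) (snd p)) \<in> borel_measurable (I0 \<Otimes>\<^sub>M I0)"
  proof -
    have "(\<lambda>p. (fst p, snd p)) \<in> (I0 \<Otimes>\<^sub>M I0) \<rightarrow>\<^sub>M borel \<Otimes>\<^sub>M borel"
      by (rule measurable_Pair[OF fst_m snd_m])
    then have "(\<lambda>p. (fst p, snd p)) \<in> borel_measurable (I0 \<Otimes>\<^sub>M I0)" by (simp only: borel_prod)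
    from measurable_compose[OF this Ke_measurable] show ?thesis by simp
  qed
  have Fm[measurable]: "F \<in> borel_measurable (I0 \<Otimes>\<^sub>M I0)"
    unfolding F_def case_prod_unfold kern_def by measurable
  have Fle: "norm (F (s, \<xi>)) \<le> rho (T - s) * (CK * (rho (s - \<xi>) * norm (l \<xi>)))" for s \<xi>
  proof -
    have "\<bar>inner (G s) (kern s \<xi> *v l \<xi>)\<bar> \<le> norm (G s) * norm (kern s \<xi> *v l \<xi>)" by (rule Cauchy_Schwarz_ineq2)
    also have "\<dots> \<le> 1 * (CK * (rho (s - \<xi>) * norm (l \<xi>)))"
      by (intro mult_mono G kern_mv_le) auto
    finally show ?thesis by (simp add: F_def abs_mult mult_left_mono)
  qed
  have Fi: "integrable I0 (\<lambda>\<xi>. F (s, \<xi>))" for s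
    unfolding F_def using J_integrable[OF l(1), of s] by simp
  have FF: "integrable (I0 \<Otimes>\<^sub>M I0) F"
  proof (rule II.Fubini_integrable[OF Fm])
    show "AE s in I0. integrable I0 (\<lambda>\<xi>. F (s, \<xi>))" using Fi by simp
    show "integrable I0 (\<lambda>s. LINT \<xi>|I0. norm (F (s, \<xi>)))"
    proof (rule Bochner_Integration.integrable_bound[of _ "\<lambda>s. rho (T - s) * (CK * (Rho T * M))"])
      show "integrable I0 (\<lambda>s. rho (T - s) * (CK * (Rho T * M)))"
        using rho_left_lebesgue(1)[of 0 T T] T_pos by simp
      show "AE s in I0. norm (LINT \<xi>|I0. norm (F (s, \<xi>))) \<le> norm (rho (T - s) * (CK * (Rho T * M)))"
      proof (rule AE_I2)
        fix s assume "s \<in> space I0"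
        then have s: "s \<in> {0..T}" by simp
        have "norm (LINT \<xi>|I0. norm (F (s, \<xi>))) \<le> (LINT \<xi>|I0. rho (T - s) * (CK * (rho (s - \<xi>) * norm (l \<xi>))))"
          by (rule norm_integral_le_integral)
             (use Fi Fle rho_norm_integrable[OF l(1)] in auto)
        also have "\<dots> \<le> rho (T - s) * (CK * (Rho T * M))"
          using rho_norm_integral_le[OF l(1) M(2) _ s] M(1) CK_pos by (simp add: mult_left_mono)
        finally show "norm (LINT \<xi>|I0. norm (F (s, \<xi>))) \<le> norm (rho (T - s) * (CK * (Rho T * M)))"
          using M(1) CK_pos by simp
      qed
    qed measurable
  qed
  have inner1: "(LINT \<xi>|I0. F (s, \<xi>)) = rho (T - s) * inner (G s) (J l s)" for s
    unfolding F_def J_def using J_integrable[OF l(1), of s] by simp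
  define Q where "Q \<xi> = (LINT s|I0. (rho (T - s) * rho (s - \<xi>)) *\<^sub>R (G s v* Ke s \<xi>))" for \<xi>
  have Fsw: "F (s, \<xi>) = inner ((rho (T - s) * rho (s - \<xi>)) *\<^sub>R (G s v* Ke s \<xi>)) (l \<xi>)" for s \<xi>
    by (simp add: F_def kern_mv_eq dot_lmul_matrix)
  have inner2: "(LINT s|I0. F (s, \<xi>)) = inner (Q \<xi>) (l \<xi>)" for \<xi>
  proof (cases "T - 2 * \<eta> < \<xi>")
    case True then show ?thesis by (simp add: Fsw l(2))
  next
    case False
    then have "integrable I0 (\<lambda>s. (rho (T - s) * rho (s - \<xi>)) *\<^sub>R (G s v* Ke s \<xi>))"
      by (intro P_integrable[OF G \<eta>]) simp
    then show ?thesis unfolding Fsw Q_def by (intro integral_inner_left)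
  qed
  have i2: "integrable I0 (\<lambda>\<xi>. inner (Q \<xi>) (l \<xi>))"
    using II.integrable_snd[of "\<lambda>s \<xi>. F (s, \<xi>)"] FF by (simp add: inner2)
  have fub: "(LINT s|I0. rho (T - s) * inner (G s) (J l s)) = (LINT \<xi>|I0. inner (Q \<xi>) (l \<xi>))"
    using II.Fubini_integral[of "\<lambda>s \<xi>. F (s, \<xi>)"] FF by (simp add: inner1 inner2)
  have i1: "integrable I0 (\<lambda>\<xi>. inner (G T) (kern T \<xi> *v l \<xi>))" using J_integrable[OF l(1), of T] by simp
  have pt: "inner (G T) (J l T) = (LINT \<xi>|I0. inner (G T) (kern T \<xi> *v l \<xi>))"
    unfolding J_def using J_integrable[OF l(1), of T] by simp
  have Peq: "inner (P G \<xi>) (l \<xi>) = inner (G T) (kern T \<xi> *v l \<xi>) + inner (Q \<xi>) (l \<xi>)" for \<xi>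
    by (simp add: P_def Q_def kern_mv_eq inner_add_left dot_lmul_matrix)
  show "integrable I0 (\<lambda>\<xi>. inner (P G \<xi>) (l \<xi>))" unfolding Peq using i1 i2 by simp
  show "inner (G T) (J l T) + (LINT s|I0. rho (T - s) * inner (G s) (J l s)) = (LINT \<xi>|I0. inner (P G \<xi>) (l \<xi>))"
    unfolding Peq pt fub using i1 i2 by simp
qed

lemma P_cong: "(\<And>s. s \<in> {0..T} \<Longrightarrow> G s = G' s) \<Longrightarrow> P G t = P G' t"
  using T_pos unfolding P_def
  by (intro arg_cong2[where f = "(+)"] Bochner_Integration.integral_cong) auto

lemma P_minus: "P (\<lambda>s. - G s) t = - P G t"
proof -
  have m: "(- v) v* A = - (v v* A)" for v :: "real^'n" and A :: "real^'n^'n"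
    by (rule bounded_bilinear.minus_left[OF bounded_bilinear_vector_matrix_mult])
  show ?thesis unfolding P_def m by simp
qed

text \<open>A smooth approximation of the weighted norm in the Lipschitz condition, which is \<open>penalty 0\<close>.\<close>
definition penalty :: "real \<Rightarrow> (real \<Rightarrow> real ^ 'n) \<Rightarrow> real" where
  "penalty e h = smooth_norm e (h T) + (LINT s|I0. rho (T - s) * smooth_norm e (h s))"

lemma penalty_integrable:
  assumes "continuous_on {0..T} h" "e \<ge> 0"
  shows "integrable I0 (\<lambda>s. rho (T - s) * smooth_norm e (h s :: real^'n))"
proof -
  have "bounded (h ` {0..T})" by (intro compact_imp_bounded compact_continuous_image assms) simp
  then obtain B where B: "\<And>s. s \<in> {0..T} \<Longrightarrow> norm (h s) \<le> B" unfolding bounded_iff by blast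
  have [measurable]: "h \<in> borel_measurable I0"
    by (rule continuous_imp_measurable_on_sets_lebesgue[OF assms(1)]) simp
  show ?thesis
  proof (rule Bochner_Integration.integrable_bound[of _ "\<lambda>s. rho (T - s) * (B + e)"])
    show "AE s in I0. norm (rho (T - s) * smooth_norm e (h s)) \<le> norm (rho (T - s) * (B + e))"
    proof (rule AE_I2)
      fix s assume "s \<in> space I0"
      then have "smooth_norm e (h s) \<le> B + e" using smooth_norm_le[OF assms(2), of "h s"] B[of s] by simp
      moreover have "0 \<le> smooth_norm e (h s)" using smooth_norm_ge[of "h s" e] norm_ge_zero order_trans by blast
      ultimately show "norm (rho (T - s) * smooth_norm e (h s)) \<le> norm (rho (T - s) * (B + e))"
        by (simp add: abs_mult mult_left_mono)
    qed
  qed (use rho_left_lebesgue(1)[of 0 T T] T_pos in auto)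
qed

lemma penalty_tendsto:
  assumes h: "\<And>n. continuous_on {0..T} (h n)" "continuous_on {0..T} h'"
    and B: "\<And>n s. s \<in> {0..T} \<Longrightarrow> norm (h n s) \<le> B" and e: "e \<ge> 0"
    and lim: "\<And>s. s \<in> {0..T} \<Longrightarrow> (\<lambda>n. h n s) \<longlonglongrightarrow> h' s"
  shows "(\<lambda>n. penalty e (h n)) \<longlonglongrightarrow> penalty e h'"
  unfolding penalty_def
proof (intro tendsto_add tendsto_smooth_norm lim integral_dominated_convergence[where w = "\<lambda>s. rho (T - s) * (B + e)"])
  show "integrable I0 (\<lambda>s. rho (T - s) * (B + e))"
    using rho_left_lebesgue(1)[of 0 T T] T_pos by simp
  show "AE s in I0. (\<lambda>n. rho (T - s) * smooth_norm e (h n s)) \<longlonglongrightarrow> rho (T - s) * smooth_norm e (h' s)"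
    by (intro AE_I2 tendsto_mult tendsto_const tendsto_smooth_norm lim) simp
  show "AE s in I0. norm (rho (T - s) * smooth_norm e (h n s)) \<le> rho (T - s) * (B + e)" for n
  proof (rule AE_I2)
    fix s assume "s \<in> space I0"
    then have "smooth_norm e (h n s) \<le> B + e" using smooth_norm_le[OF e, of "h n s"] B[of s n] by simp
    moreover have "0 \<le> smooth_norm e (h n s)" using smooth_norm_ge[of "h n s" e] norm_ge_zero order_trans by blast
    ultimately show "norm (rho (T - s) * smooth_norm e (h n s)) \<le> rho (T - s) * (B + e)"
      by (simp add: abs_mult mult_left_mono)
  qed
qed (use penalty_integrable[OF h(1) e] penalty_integrable[OF h(2) e] T_pos in auto)

lemma penalty_bounds:
  assumes h: "continuous_on {0..T} h" and e: "e \<ge> 0"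
  shows "penalty 0 h \<le> penalty e h" "penalty e h \<le> penalty 0 h + e * (1 + Rho T)" "0 \<le> penalty 0 h"
proof -
  have s0: "smooth_norm 0 v = norm v" for v :: "real^'n" by (simp add: smooth_norm_def)
  note i = penalty_integrable[OF h]
  have i0: "integrable I0 (\<lambda>s. rho (T - s) * norm (h s))" using i[of 0] by (simp add: s0)
  have "(LINT s|I0. rho (T - s) * smooth_norm 0 (h s)) \<le> (LINT s|I0. rho (T - s) * smooth_norm e (h s))"
    by (rule integral_mono) (use i0 i e in \<open>auto simp: s0 smooth_norm_ge intro!: mult_left_mono\<close>)
  then show "penalty 0 h \<le> penalty e h"
    using smooth_norm_ge[of "h T" e] by (simp add: penalty_def s0)
  have "(LINT s|I0. rho (T - s) * smooth_norm e (h s)) \<le> (LINT s|I0. rho (T - s) * smooth_norm 0 (h s) + rho (T - s) * e)"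
  proof (rule integral_mono)
    show "integrable I0 (\<lambda>s. rho (T - s) * smooth_norm 0 (h s) + rho (T - s) * e)"
      using i[of 0] rho_left_lebesgue(1)[of 0 T T] T_pos by simp
    fix s
    show "rho (T - s) * smooth_norm e (h s) \<le> rho (T - s) * smooth_norm 0 (h s) + rho (T - s) * e"
      using mult_left_mono[OF smooth_norm_le[OF e, of "h s"], of "rho (T - s)"] by (simp add: s0 distrib_left)
  qed (use i e in auto)
  also have "\<dots> = (LINT s|I0. rho (T - s) * smooth_norm 0 (h s)) + Rho T * e"
    using i[of 0] rho_left_lebesgue[of 0 T T] T_pos by simp
  finally show "penalty e h \<le> penalty 0 h + e * (1 + Rho T)"
    using smooth_norm_le[OF e, of "h T"] by (simp add: penalty_def s0 algebra_simps)
  show "0 \<le> penalty 0 h"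
    unfolding penalty_def s0 by (intro add_nonneg_nonneg Bochner_Integration.integral_nonneg) auto
qed

text \<open>At \<open>s = T\<close> both weights are zero by convention.\<close>
lemma penalty_0_eq:
  "penalty 0 h = norm (h T) + (LINT s|I0. norm (h s) / (T - s) powr (1 - \<alpha>))"
proof -
  have "rho (T - s) * smooth_norm 0 (h s) = norm (h s) / (T - s) powr (1 - \<alpha>)" if "s \<le> T" for s
    using that by (cases "s = T") (auto simp: smooth_norm_def rho_eq_inverse)
  then have "(LINT s|I0. rho (T - s) * smooth_norm 0 (h s)) = (LINT s|I0. norm (h s) / (T - s) powr (1 - \<alpha>))"
    by (intro Bochner_Integration.integral_cong) auto
  then show ?thesis by (simp add: penalty_def smooth_norm_def)
qed

lemma penalty_zero: "penalty 0 (\<lambda>_. 0) = 0"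
  by (simp add: penalty_def smooth_norm_def)

lemma integral_I0_subinterval:
  fixes f :: "real \<Rightarrow> 'b::euclidean_space"
  assumes "0 \<le> a" "b \<le> T"
  shows "(LINT \<xi>|I0. indicator {a..b} \<xi> *\<^sub>R f \<xi>) = (LINT \<xi>|lebesgue_on {a..b}. f \<xi>)"
  by (subst (1 2) integral_restrict_space)
     (use assms in \<open>auto intro!: Bochner_Integration.integral_cong simp: indicator_def\<close>)

lemma integral_const_lebesgue_interval: "a \<le> b \<Longrightarrow> (LINT \<xi>|lebesgue_on {a..b}. c) = (b - a) *\<^sub>R (c :: 'b::euclidean_space)"
  by (simp add: lebesgue_integral_const measure_restrict_space)

end

context volterra_problem
begin

text \<open>The penalty as a functional of the position, for a fixed comparison path \<open>b\<close>.\<close>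
definition test :: "real \<Rightarrow> (real \<Rightarrow> real ^ 'n) \<Rightarrow> 'n position \<Rightarrow> real" where
  "test e b q = penalty e (\<lambda>s. arc (dn q) s - b s)"

text \<open>Its \<open>ci\<close>-gradient.\<close>
definition test_grad :: "real \<Rightarrow> (real \<Rightarrow> real ^ 'n) \<Rightarrow> 'n position \<Rightarrow> real ^ 'n" where
  "test_grad e b q = P (\<lambda>s. norm_slope e (arc (dn q) s - b s) (arc (dn q) s - b s)) (fst q)"

lemma arc_measurable: "l \<in> Linf T \<Longrightarrow> arc l \<in> borel_measurable I0"
  by (rule continuous_imp_measurable_on_sets_lebesgue[OF arc_continuous]) auto

lemma penalty_cong: "(\<And>s. s \<in> {0..T} \<Longrightarrow> h s = h' s) \<Longrightarrow> penalty e h = penalty e h'"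
  using T_pos unfolding penalty_def
  by (intro arg_cong2[where f = "(+)"] Bochner_Integration.integral_cong) auto

text \<open>The increment of the test functional along a path, by the exact difference quotient and Fubini.\<close>
lemma test_increment:
  assumes l: "l \<in> Linf T" and t: "0 \<le> t" "t \<le> t'" "t' \<le> T - 2 * \<eta>" "\<eta> > 0"
    and b: "continuous_on {0..T} b" and e: "e > 0"
  defines "G \<equiv> \<lambda>s. norm_slope e (arc (cut t' l) s - b s) (arc (cut t l) s - b s)"
    and "d \<equiv> \<lambda>\<xi>. cut t' l \<xi> - cut t l \<xi>"
  shows "integrable I0 (\<lambda>\<xi>. inner (P G \<xi>) (d \<xi>))"
    "test e b (t', restrict (arc l) {0..t'}) - test e b (t, restrict (arc l) {0..t}) = (LINT \<xi>|I0. inner (P G \<xi>) (d \<xi>))"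
proof -
  have T: "t \<in> {0..T}" "t' \<in> {0..T}" using t by auto
  have L: "cut t l \<in> Linf T" "cut t' l \<in> Linf T" using cut_Linf'[OF l] T by auto
  note [measurable] = arc_measurable[OF L(1)] arc_measurable[OF L(2)]
  have bm[measurable]: "b \<in> borel_measurable I0" by (rule continuous_imp_measurable_on_sets_lebesgue[OF b]) simp
  have Gm: "G \<in> borel_measurable I0" unfolding G_def by measurable
  have G1: "norm (G s) \<le> 1" for s unfolding G_def by (rule norm_slope_le[OF e])
  have dL: "d \<in> Linf T"
  proof -
    obtain M where M: "M > 0" "AE \<xi> in I0. norm (l \<xi>) \<le> M" using Linf_bound[OF l] .
    have "AE \<xi> in I0. norm (d \<xi>) \<le> M"
      using M(2) by eventually_elim (use M(1) t in \<open>auto simp: d_def cut_def\<close>)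
    then show ?thesis using L unfolding Linf_iff d_def by auto
  qed
  have d0: "d \<xi> = 0" if "T - 2 * \<eta> < \<xi>" for \<xi> using that t by (simp add: d_def cut_def)
  note jp = J_pairing[OF Gm G1 dL d0 t(4)]
  show "integrable I0 (\<lambda>\<xi>. inner (P G \<xi>) (d \<xi>))" by (rule jp(1))
  have Jd: "J d s = (arc (cut t' l) s - b s) - (arc (cut t l) s - b s)" for s
    unfolding d_def J_diff[OF L(2,1)] by (simp add: arc_def)
  have sl: "inner (G s) (J d s) = smooth_norm e (arc (cut t' l) s - b s) - smooth_norm e (arc (cut t l) s - b s)" for s
    unfolding Jd G_def by (rule smooth_norm_diff[OF e, symmetric])
  have c: "continuous_on {0..T} (\<lambda>s. arc (cut t l) s - b s)" "continuous_on {0..T} (\<lambda>s. arc (cut t' l) s - b s)"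
    by (intro continuous_intros arc_continuous L b)+
  have tq: "test e b (u, restrict (arc l) {0..u}) = penalty e (\<lambda>s. arc (cut u l) s - b s)" if "u \<in> {0..T}" for u
    unfolding test_def by (rule penalty_cong) (simp add: arc_position(3)[OF l that])
  have "test e b (t', restrict (arc l) {0..t'}) - test e b (t, restrict (arc l) {0..t})
    = inner (G T) (J d T) + (LINT s|I0. rho (T - s) * inner (G s) (J d s))"
    unfolding tq[OF T(1)] tq[OF T(2)] penalty_def sl
    using penalty_integrable[OF c(1) less_imp_le[OF e]] penalty_integrable[OF c(2) less_imp_le[OF e]]
    by (simp add: right_diff_distrib)
  then show "test e b (t', restrict (arc l) {0..t'}) - test e b (t, restrict (arc l) {0..t}) = (LINT \<xi>|I0. inner (P G \<xi>) (d \<xi>))"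
    using jp(2) by simp
qed

lemma extension_density:
  assumes "(t, w) \<in> positions T y K" "x \<in> extensions T y K (t, w)"
  defines "l \<equiv> dens y K T x"
  shows "l \<in> Linf T" "\<And>\<tau>. \<tau> \<in> {0..T} \<Longrightarrow> restrict x {0..\<tau>} = restrict (arc l) {0..\<tau>}"
    "w = restrict (arc l) {0..t}"
proof -
  have x: "(T, x) \<in> positions T y K" "restrict x {0..t} = w"
    using assms T_pos by (auto simp: extensions_def positions_def)
  note d = position_dens[OF x(1), folded l_def]
  show l: "l \<in> Linf T" by (rule d(1))
  have "J (cut T l) \<tau> = J l \<tau>" for \<tau>
    by (rule J_cong[OF cut_Linf'[OF l] l]) (auto intro!: AE_I2 simp: cut_def)
  then have xl: "x \<tau> = arc l \<tau>" if "\<tau> \<in> {0..T}" for \<tau> using d(2)[OF that] by (simp add: arc_def)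
  show *: "restrict x {0..\<tau>} = restrict (arc l) {0..\<tau>}" if "\<tau> \<in> {0..T}" for \<tau>
    using xl that by (auto simp: restrict_def)
  show "w = restrict (arc l) {0..t}"
    using *[of t] x(2) position_time[OF assms(1)] by (metis fst_conv)
qed

text \<open>Such extensions realize every average density \<open>v\<close>, whence the uniqueness of \<open>ci\<close>-derivatives.\<close>
lemma extension_with_constant_density:
  assumes p: "(t, w) \<in> positions T y K" and "t < T"
  obtains x where "x \<in> extensions T y K (t, w)"
    "\<And>\<tau>. t < \<tau> \<Longrightarrow> \<tau> \<le> T \<Longrightarrow> (1 / (\<tau> - t)) *\<^sub>R (LINT \<xi>|lebesgue_on {t..\<tau>}. dens y K T x \<xi>) = v"
proof -
  note dp = position_dn[OF p]
  have t: "0 \<le> t" "t \<le> T" using position_time[OF p] by auto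
  define l where "l \<xi> = (if \<xi> \<le> t then dn (t, w) \<xi> else v)" for \<xi>
  have lL: "l \<in> Linf T"
  proof -
    obtain M where M: "M > 0" "AE \<xi> in I0. norm (dn (t, w) \<xi>) \<le> M" using Linf_bound[OF dp(1)] .
    note [measurable] = Linf_measurable[OF dp(1)]
    have "l \<in> borel_measurable I0" unfolding l_def by measurable
    moreover have "AE \<xi> in I0. norm (l \<xi>) \<le> max M (norm v)"
      using M(2) by eventually_elim (auto simp: l_def)
    ultimately show ?thesis by (auto simp: Linf_def)
  qed
  have Tin: "T \<in> {0..T}" using T_pos by simp
  note ap = arc_position[OF lL Tin]
  define x where "x = restrict (arc l) {0..T}"
  have al: "arc l \<tau> = arc (dn (t, w)) \<tau>" if "\<tau> \<in> {0..t}" for \<tau>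
  proof -
    have "J l \<tau> = J (dn (t, w)) \<tau>"
      by (rule J_cong[OF lL dp(1)]) (use that in \<open>auto simp: l_def\<close>)
    then show ?thesis by (simp add: arc_def)
  qed
  have wr: "w = restrict (arc l) {0..t}"
    using position_eqI[OF p lL] dp(2) al by simp
  have xe: "x \<in> extensions T y K (t, w)"
  proof -
    have int: "{0..T} \<inter> {0..t} = {0..t}" using t by auto
    have "restrict x {0..t} = w" unfolding x_def restrict_restrict int by (rule wr[symmetric])
    moreover have "x \<in> paths y K T" using ap(1) by (simp add: positions_def x_def)
    ultimately show ?thesis by (simp add: extensions_def)
  qed
  have dn_x: "dn (T, x) = cut T (dens y K T x)" by (simp add: dn_def)
  have ae: "AE \<xi> in I0. dens y K T x \<xi> = l \<xi>"
  proof -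
    have "AE \<xi> in I0. \<xi> \<in> {0..T}" by (rule AE_I2) simp
    then show ?thesis using ap(2)[folded x_def] by eventually_elim (simp add: dn_def cut_def)
  qed
  have dm: "dens y K T x \<in> Linf T" using position_dens(1) ap(1)[folded x_def] by blast
  show thesis
  proof (rule that[OF xe])
    fix \<tau> assume \<tau>: "t < \<tau>" "\<tau> \<le> T"
    have "(LINT \<xi>|lebesgue_on {t..\<tau>}. dens y K T x \<xi>) = (LINT \<xi>|lebesgue_on {t..\<tau>}. v)"
    proof (rule integral_cong_AE)
      show "dens y K T x \<in> borel_measurable (lebesgue_on {t..\<tau>})"
        by (rule measurable_restrict_mono[OF Linf_measurable[OF dm]]) (use t \<tau> in auto)
      have "AE \<xi> in lebesgue_on {t..\<tau>}. dens y K T x \<xi> = l \<xi>"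
        using ae t \<tau> by (auto simp: AE_restrict_space_iff elim!: eventually_mono)
      moreover have "AE \<xi> in lebesgue_on {t..\<tau>}. \<xi> \<noteq> t" by (rule AE_lebesgue_on_neq) simp
      moreover have "AE \<xi> in lebesgue_on {t..\<tau>}. \<xi> \<in> {t..\<tau>}" by (rule AE_I2) simp
      ultimately show "AE \<xi> in lebesgue_on {t..\<tau>}. dens y K T x \<xi> = v"
        by eventually_elim (auto simp: l_def)
    qed simp
    then have "(LINT \<xi>|lebesgue_on {t..\<tau>}. dens y K T x \<xi>) = (\<tau> - t) *\<^sub>R v"
      by (simp only: integral_const_lebesgue_interval[OF less_imp_le[OF \<tau>(1)]])
    then show "(1 / (\<tau> - t)) *\<^sub>R (LINT \<xi>|lebesgue_on {t..\<tau>}. dens y K T x \<xi>) = v"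
      using \<tau> by simp
  qed
qed

lemma ci_derivatives_unique:
  assumes q: "q \<in> open_positions T y K"
    and D: "has_ci_derivatives T y K \<psi> q d g" "has_ci_derivatives T y K \<psi> q d' g'"
  shows "d = d'" "g = g'"
proof -
  obtain t w where tw: "q = (t, w)" by (cases q)
  have p: "(t, w) \<in> positions T y K" "t < T" using q by (auto simp: open_positions_def tw)
  have key: "d + inner g v = d' + inner g' v" for v
  proof -
    obtain x where x: "x \<in> extensions T y K (t, w)"
      "\<And>\<tau>. t < \<tau> \<Longrightarrow> \<tau> \<le> T \<Longrightarrow> (1 / (\<tau> - t)) *\<^sub>R (LINT \<xi>|lebesgue_on {t..\<tau>}. dens y K T x \<xi>) = v"
      using extension_with_constant_density[OF p] by metis
    define X where "X \<tau> = (\<psi> (\<tau>, restrict x {0..\<tau>}) - \<psi> (t, w)) / (\<tau> - t)" for \<tau>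
    have ev: "eventually (\<lambda>\<tau>. t < \<tau> \<and> \<tau> \<le> T) (at_right t)"
      using eventually_at_right_less[of t] eventually_at_right_real[OF p(2)]
      by eventually_elim auto
    have lim: "(X \<longlongrightarrow> a + inner h v) (at_right t)" if "has_ci_derivatives T y K \<psi> q a h" for a h
    proof -
      let ?E = "\<lambda>\<tau>. X \<tau> - a - inner h ((1 / (\<tau> - t)) *\<^sub>R (LINT \<xi>|lebesgue_on {t..\<tau>}. dens y K T x \<xi>))"
      have "((\<lambda>\<tau>. \<bar>?E \<tau>\<bar>) \<longlongrightarrow> 0) (at_right t)"
        using that x(1) by (simp add: has_ci_derivatives_def tw X_def)
      then have "(?E \<longlongrightarrow> 0) (at_right t)" by (rule tendsto_rabs_zero_cancel)
      moreover have "eventually (\<lambda>\<tau>. ?E \<tau> = X \<tau> - (a + inner h v)) (at_right t)"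
        using ev by eventually_elim (simp add: x(2) algebra_simps del: scaleR_scaleR)
      ultimately have "((\<lambda>\<tau>. X \<tau> - (a + inner h v)) \<longlongrightarrow> 0) (at_right t)"
        by (rule Lim_transform_eventually)
      then show ?thesis by (rule LIM_zero_cancel)
    qed
    show ?thesis by (rule tendsto_unique[OF _ lim[OF D(1)] lim[OF D(2)]]) simp
  qed
  show dd: "d = d'" using key[of 0] by simp
  have "inner (g - g') (g - g') = 0" using key[of "g - g'"] dd by (simp add: inner_diff_left)
  then show "g = g'" by simp
qed

lemma ci_dt_grad_eq:
  assumes "q \<in> open_positions T y K" "has_ci_derivatives T y K \<psi> q d g"
  shows "ci_dt T y K \<psi> q = d" "ci_grad T y K \<psi> q = g"
  unfolding ci_dt_def ci_grad_def
  using assms ci_derivatives_unique[OF assms(1)] by (auto intro!: the_equality)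

text \<open>Uniform version of \<open>P_tendsto\<close> near \<open>t\<close>, for the difference quotients along one path.\<close>
lemma P_near:
  assumes l: "l \<in> Linf T" and t: "0 \<le> t" "t < T" and b: "continuous_on {0..T} b" and e: "e > 0" and \<epsilon>: "\<epsilon> > 0"
  defines "G \<equiv> \<lambda>\<tau> s. norm_slope e (arc (cut \<tau> l) s - b s) (arc (cut t l) s - b s)"
  shows "\<exists>d>0. t + d < T \<and> (\<forall>\<tau> \<xi>. t \<le> \<xi> \<longrightarrow> \<xi> \<le> \<tau> \<longrightarrow> \<tau> < t + d \<longrightarrow> norm (P (G \<tau>) \<xi> - P (G t) t) < \<epsilon>)"
proof (rule ccontr)
  assume neg: "\<not> ?thesis"
  define \<delta> where "\<delta> n = min ((T - t) / 2) (1 / (real n + 1))" for n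
  have \<delta>: "\<delta> n > 0" "t + \<delta> n < T" "\<delta> n \<le> 1 / (real n + 1)" for n
    using t by (auto simp: \<delta>_def min_def field_simps)
  have "\<exists>\<tau> \<xi>. t \<le> \<xi> \<and> \<xi> \<le> \<tau> \<and> \<tau> < t + \<delta> n \<and> \<not> norm (P (G \<tau>) \<xi> - P (G t) t) < \<epsilon>" for n
    using neg \<delta>(1,2)[of n] by blast
  then obtain \<tau> \<xi> where s: "\<And>n. t \<le> \<xi> n" "\<And>n. \<xi> n \<le> \<tau> n" "\<And>n. \<tau> n < t + \<delta> n"
    "\<And>n. \<not> norm (P (G (\<tau> n)) (\<xi> n) - P (G t) t) < \<epsilon>" by metis
  have lim1: "(\<lambda>n. t + 1 / (real n + 1)) \<longlonglongrightarrow> t"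
    using tendsto_add[OF tendsto_const[of t] LIMSEQ_inverse_real_of_nat] by (simp add: inverse_eq_divide add.commute)
  have \<tau>1: "\<tau> n \<le> t + 1 / (real n + 1)" for n using s(3)[of n] \<delta>(3)[of n] by linarith
  have lim\<tau>: "\<tau> \<longlonglongrightarrow> t"
    by (rule tendsto_sandwich[OF _ _ tendsto_const lim1]) (use \<tau>1 s(1,2) in \<open>auto intro!: always_eventually intro: order_trans\<close>)
  have lim\<xi>: "\<xi> \<longlonglongrightarrow> t"
    by (rule tendsto_sandwich[OF _ _ tendsto_const lim\<tau>]) (use s(1,2) in auto)
  have \<tau>T: "\<tau> n \<le> T" "t \<le> \<tau> n" for n using s(1,2,3)[of n] \<delta>(2)[of n] by linarith+
  have L: "cut (\<tau> n) l \<in> Linf T" "cut t l \<in> Linf T" for n using cut_Linf'[OF l] \<tau>T t by auto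
  note [measurable] = arc_measurable[OF L(1)] arc_measurable[OF L(2)]
  have bm[measurable]: "b \<in> borel_measurable I0" by (rule continuous_imp_measurable_on_sets_lebesgue[OF b]) simp
  obtain M where M: "M > 0" "AE \<xi> in I0. norm (l \<xi>) \<le> M" using Linf_bound[OF l] .
  have Jl: "(\<lambda>n. J (cut (\<tau> n) l) u) \<longlonglongrightarrow> J (cut t l) u" for u
  proof (rule J_tendsto[OF L less_imp_le[OF M(1)]])
    show "AE \<xi> in I0. norm (cut (\<tau> n) l \<xi>) \<le> M" for n
      using M(2) by eventually_elim (use M(1) in \<open>auto simp: cut_def\<close>)
    show "AE \<xi> in I0. (\<lambda>n. cut (\<tau> n) l \<xi>) \<longlonglongrightarrow> cut t l \<xi>"
    proof (rule AE_I2)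
      fix \<xi>
      have "eventually (\<lambda>n. cut (\<tau> n) l \<xi> = cut t l \<xi>) sequentially"
      proof (cases "\<xi> \<le> t")
        case True
        then have "cut (\<tau> n) l \<xi> = cut t l \<xi>" for n using \<tau>T(2)[of n] by (simp add: cut_def)
        then show ?thesis by simp
      next
        case False
        then have "eventually (\<lambda>n. \<tau> n < \<xi>) sequentially" using order_tendstoD(2)[OF lim\<tau>] by simp
        then show ?thesis by eventually_elim (use False in \<open>auto simp: cut_def\<close>)
      qed
      then show "(\<lambda>n. cut (\<tau> n) l \<xi>) \<longlonglongrightarrow> cut t l \<xi>" by (rule tendsto_eventually)
    qed
  qed
  have "(\<lambda>n. P (G (\<tau> n)) (\<xi> n)) \<longlonglongrightarrow> P (G t) t"
  proof (rule P_tendsto)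
    show "G (\<tau> n) \<in> borel_measurable I0" for n unfolding G_def by measurable
    show "G t \<in> borel_measurable I0" unfolding G_def by measurable
    show "norm (G (\<tau> n) s) \<le> 1" for n s unfolding G_def by (rule norm_slope_le[OF e])
    show "(\<lambda>n. G (\<tau> n) s) \<longlonglongrightarrow> G t s" for s
      unfolding G_def arc_def by (intro tendsto_norm_slope[OF e] tendsto_intros Jl)
  qed (use t s(1) lim\<xi> in \<open>auto intro: order_trans\<close>)
  then have "eventually (\<lambda>n. dist (P (G (\<tau> n)) (\<xi> n)) (P (G t) t) < \<epsilon>) sequentially" using \<epsilon> by (rule tendstoD)
  then obtain n where "dist (P (G (\<tau> n)) (\<xi> n)) (P (G t) t) < \<epsilon>" by (auto simp: eventually_sequentially)
  then show False using s(4)[of n] by (simp add: dist_norm)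
qed

lemma test_ci_derivative:
  assumes q: "(t, w) \<in> open_positions T y K" and x: "x \<in> extensions T y K (t, w)"
    and b: "continuous_on {0..T} b" and e: "e > 0"
  shows "((\<lambda>\<tau>. (test e b (\<tau>, restrict x {0..\<tau>}) - test e b (t, w)) / (\<tau> - t)
      - inner (test_grad e b (t, w)) ((1 / (\<tau> - t)) *\<^sub>R (LINT \<xi>|lebesgue_on {t..\<tau>}. dens y K T x \<xi>))) \<longlongrightarrow> 0) (at_right t)"
proof -
  have p: "(t, w) \<in> positions T y K" and tT: "t < T" using q by (auto simp: open_positions_def)
  have t0: "0 \<le> t" using position_time[OF p] by simp
  define l where "l = dens y K T x"
  note ex = extension_density[OF p x, folded l_def]
  obtain M where M: "M > 0" "AE \<xi> in I0. norm (l \<xi>) \<le> M" using Linf_bound[OF ex(1)] .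
  define G where "G \<tau> s = norm_slope e (arc (cut \<tau> l) s - b s) (arc (cut t l) s - b s)" for \<tau> s
  define g0 where "g0 = P (G t) t"
  have tin: "t \<in> {0..T}" using t0 tT by simp
  have tg: "test_grad e b (t, w) = g0"
    unfolding test_grad_def g0_def G_def fst_conv
    by (rule P_cong) (simp add: ex(3) arc_position(3)[OF ex(1) tin])
  let ?E = "\<lambda>\<tau>. (test e b (\<tau>, restrict x {0..\<tau>}) - test e b (t, w)) / (\<tau> - t)
      - inner g0 ((1 / (\<tau> - t)) *\<^sub>R (LINT \<xi>|lebesgue_on {t..\<tau>}. l \<xi>))"
  have main: "\<exists>d>0. \<forall>\<tau>. t < \<tau> \<longrightarrow> \<tau> < t + d \<longrightarrow> \<bar>?E \<tau>\<bar> \<le> \<epsilon> * M" if \<epsilon>: "\<epsilon> > 0" for \<epsilon>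
  proof -
    obtain d where d: "d > 0" "t + d < T"
      "\<And>\<tau> \<xi>. t \<le> \<xi> \<Longrightarrow> \<xi> \<le> \<tau> \<Longrightarrow> \<tau> < t + d \<Longrightarrow> norm (P (G \<tau>) \<xi> - g0) < \<epsilon>"
      using P_near[OF ex(1) t0 tT b e \<epsilon>] unfolding g0_def G_def by blast
    have "\<bar>?E \<tau>\<bar> \<le> \<epsilon> * M" if \<tau>: "t < \<tau>" "\<tau> < t + d" for \<tau>
    proof -
      define dl where "dl \<xi> = cut \<tau> l \<xi> - cut t l \<xi>" for \<xi>
      define \<eta> where "\<eta> = (T - \<tau>) / 2"
      have \<eta>: "\<eta> > 0" "\<tau> \<le> T - 2 * \<eta>" using \<tau> d(2) unfolding \<eta>_def by argo+
      have \<tau>in: "\<tau> \<in> {0..T}" using \<tau> d(2) t0 by auto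
      note inc = test_increment[OF ex(1) t0 less_imp_le[OF \<tau>(1)] \<eta>(2,1) b e, folded G_def dl_def]
      have dlm: "dl \<in> borel_measurable I0"
        unfolding dl_def using \<tau>in tin
        by (intro borel_measurable_diff Linf_measurable cut_Linf'[OF ex(1)]) auto
      have lm[measurable]: "l \<in> borel_measurable I0" by (rule Linf_measurable[OF ex(1)])
      have avg: "(LINT \<xi>|lebesgue_on {t..\<tau>}. l \<xi>) = (LINT \<xi>|I0. dl \<xi>)"
      proof -
        have "(LINT \<xi>|lebesgue_on {t..\<tau>}. l \<xi>) = (LINT \<xi>|I0. indicator {t..\<tau>} \<xi> *\<^sub>R l \<xi>)"
          using integral_I0_subinterval[of t \<tau> l] t0 \<tau>in by simp
        also have "\<dots> = (LINT \<xi>|I0. dl \<xi>)"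
        proof (rule integral_cong_AE)
          show "(\<lambda>\<xi>. indicator {t..\<tau>} \<xi> *\<^sub>R l \<xi>) \<in> borel_measurable I0" by measurable
          have "AE \<xi> in I0. \<xi> \<noteq> t" by (rule AE_lebesgue_on_neq) simp
          then show "AE \<xi> in I0. indicator {t..\<tau>} \<xi> *\<^sub>R l \<xi> = dl \<xi>"
            by eventually_elim (use \<tau> in \<open>auto simp: dl_def cut_def indicator_def\<close>)
        qed (rule dlm)
        finally show ?thesis .
      qed
      have dli: "integrable I0 dl"
      proof -
        interpret I: finite_measure I0 by (rule finite_measure_lebesgue_on) simp
        have "AE \<xi> in I0. norm (dl \<xi>) \<le> M"
          using M(2) by eventually_elim (use M(1) \<tau> in \<open>auto simp: dl_def cut_def\<close>)
        then show ?thesis by (rule I.integrable_const_bound) (rule dlm)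
      qed
      have num: "(test e b (\<tau>, restrict x {0..\<tau>}) - test e b (t, w)) - inner g0 (LINT \<xi>|lebesgue_on {t..\<tau>}. l \<xi>)
          = (LINT \<xi>|I0. inner (P (G \<tau>) \<xi> - g0) (dl \<xi>))"
        using inc dli ex(2)[OF \<tau>in] ex(3) unfolding avg by (simp add: inner_diff_left)
      have "norm (LINT \<xi>|I0. inner (P (G \<tau>) \<xi> - g0) (dl \<xi>)) \<le> (LINT \<xi>|I0. indicator {t..\<tau>} \<xi> *\<^sub>R (\<epsilon> * M))"
      proof (rule norm_integral_le_integral)
        show "integrable I0 (\<lambda>\<xi>. inner (P (G \<tau>) \<xi> - g0) (dl \<xi>))"
          using inc(1) dli by (simp add: inner_diff_left)
        show "integrable I0 (\<lambda>\<xi>. indicator {t..\<tau>} \<xi> *\<^sub>R (\<epsilon> * M))"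
        proof -
          interpret I: finite_measure I0 by (rule finite_measure_lebesgue_on) simp
          show ?thesis by (rule I.integrable_const_bound[of _ "\<bar>\<epsilon> * M\<bar>"]) (auto simp: indicator_def)
        qed
        show "AE \<xi> in I0. norm (inner (P (G \<tau>) \<xi> - g0) (dl \<xi>)) \<le> indicator {t..\<tau>} \<xi> *\<^sub>R (\<epsilon> * M)"
          using M(2)
        proof eventually_elim
          case (elim \<xi>)
          show ?case
          proof (cases "t < \<xi> \<and> \<xi> \<le> \<tau>")
            case True
            have "norm (inner (P (G \<tau>) \<xi> - g0) (l \<xi>)) \<le> norm (P (G \<tau>) \<xi> - g0) * norm (l \<xi>)"
              by (rule Cauchy_Schwarz_ineq2[unfolded real_norm_def[symmetric]])
            also have "\<dots> \<le> \<epsilon> * M"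
              using d(3)[of \<xi> \<tau>] True \<tau> elim \<epsilon> by (intro mult_mono) auto
            finally show ?thesis using True by (simp add: dl_def cut_def)
          next
            case False
            then have "dl \<xi> = 0" using \<tau> by (auto simp: dl_def cut_def)
            then show ?thesis using \<epsilon> M(1) by (simp add: indicator_def)
          qed
        qed
      qed
      also have "\<dots> = (LINT \<xi>|lebesgue_on {t..\<tau>}. \<epsilon> * M)"
        by (rule integral_I0_subinterval) (use t0 \<tau>in in auto)
      also have "\<dots> = (\<tau> - t) * (\<epsilon> * M)"
        using integral_const_lebesgue_interval[OF less_imp_le[OF \<tau>(1)], of "\<epsilon> * M"] by (simp only: real_scaleR_def)
      finally have "\<bar>(test e b (\<tau>, restrict x {0..\<tau>}) - test e b (t, w)) - inner g0 (LINT \<xi>|lebesgue_on {t..\<tau>}. l \<xi>)\<bar> \<le> (\<tau> - t) * (\<epsilon> * M)"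
        unfolding num by simp
      moreover have "?E \<tau> = ((test e b (\<tau>, restrict x {0..\<tau>}) - test e b (t, w)) - inner g0 (LINT \<xi>|lebesgue_on {t..\<tau>}. l \<xi>)) / (\<tau> - t)"
        by (simp add: diff_divide_distrib)
      ultimately show ?thesis using \<tau>(1) by (simp add: abs_divide pos_divide_le_eq mult.commute)
    qed
    then show ?thesis using d(1) by blast
  qed
  have "(?E \<longlongrightarrow> 0) (at_right t)"
  proof (rule tendstoI)
    fix r :: real assume r: "r > 0"
    have "r / (2 * M) > 0" using r M(1) by simp
    from main[OF this] obtain d where d: "d > 0" "\<And>\<tau>. t < \<tau> \<Longrightarrow> \<tau> < t + d \<Longrightarrow> \<bar>?E \<tau>\<bar> \<le> r / (2 * M) * M" by blast
    have "eventually (\<lambda>\<tau>. \<tau> \<in> {t<..<t + d}) (at_right t)" using eventually_at_right_real[of t "t + d"] d(1) by simp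
    then show "eventually (\<lambda>\<tau>. dist (?E \<tau>) 0 < r) (at_right t)"
    proof eventually_elim
      case (elim \<tau>)
      have "\<bar>?E \<tau>\<bar> \<le> r / (2 * M) * M" using d(2)[of \<tau>] elim by simp
      then show ?case using M(1) r by (simp add: dist_real_def)
    qed
  qed
  then show ?thesis unfolding tg l_def .
qed

text \<open>The time derivative comes from \<open>\<theta>\<close> alone.\<close>
lemma test_functional_derivatives:
  assumes q: "q \<in> open_positions T y K" and b: "continuous_on {0..T} b" and e: "e > 0"
    and \<theta>: "(\<theta> has_real_derivative d) (at (fst q))"
  shows "has_ci_derivatives T y K (\<lambda>q. c * test e b q + \<theta> (fst q)) q d (c *\<^sub>R test_grad e b q)"
proof -
  obtain t w where tw: "q = (t, w)" by (cases q)
  show ?thesis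
    unfolding has_ci_derivatives_def tw prod.case
  proof
    fix x assume x: "x \<in> extensions T y K (t, w)"
    let ?v = "\<lambda>\<tau>. (1 / (\<tau> - t)) *\<^sub>R (LINT \<xi>|lebesgue_on {t..\<tau>}. dens y K T x \<xi>)"
    let ?A = "\<lambda>\<tau>. (test e b (\<tau>, restrict x {0..\<tau>}) - test e b (t, w)) / (\<tau> - t) - inner (test_grad e b (t, w)) (?v \<tau>)"
    let ?B = "\<lambda>\<tau>. (\<theta> \<tau> - \<theta> t) / (\<tau> - t) - d"
    have A: "(?A \<longlongrightarrow> 0) (at_right t)" by (rule test_ci_derivative[OF q[unfolded tw] x b e])
    have "(\<theta> has_real_derivative d) (at t within {t<..})" using \<theta> by (simp add: tw has_field_derivative_at_within)
    then have B: "(?B \<longlongrightarrow> 0) (at_right t)" unfolding has_field_derivative_iff by (rule LIM_zero)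
    have lim: "((\<lambda>\<tau>. \<bar>c * ?A \<tau> + ?B \<tau>\<bar>) \<longlongrightarrow> \<bar>c * 0 + 0\<bar>) (at_right t)" by (intro tendsto_intros A B)
    have eq: "c * ?A \<tau> + ?B \<tau> = (c * test e b (\<tau>, restrict x {0..\<tau>}) + \<theta> \<tau> - (c * test e b (t, w) + \<theta> t)) / (\<tau> - t) - d
        - inner (c *\<^sub>R test_grad e b (t, w)) (?v \<tau>)" for \<tau>
      by (simp add: diff_divide_distrib add_divide_distrib algebra_simps)
    from lim[unfolded eq] show "((\<lambda>\<tau>. \<bar>(c * test e b (\<tau>, restrict x {0..\<tau>}) + \<theta> (fst (\<tau>, restrict x {0..\<tau>})) - (c * test e b (t, w) + \<theta> (fst (t, w)))) / (\<tau> - t) - d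
        - inner (c *\<^sub>R test_grad e b (t, w)) (?v \<tau>)\<bar>) \<longlongrightarrow> 0) (at_right t)"
      by simp
  qed
qed

lemma Gk_position: "q \<in> \<G> k \<Longrightarrow> q \<in> positions T y K" by (simp add: Gk_iff)

lemma Gk_dn: "q \<in> \<G> k \<Longrightarrow> dn q \<in> Linf T" by (rule position_dn(1)[OF Gk_position])

lemma test_grad_tendsto:
  assumes s: "\<And>n. s n \<in> \<G> k" "q \<in> \<G> k" "pconv s q" "fst q < T" and e: "e > 0"
    and b: "\<And>n. continuous_on {0..T} (b n)" "continuous_on {0..T} b'" "\<And>u. u \<in> {0..T} \<Longrightarrow> (\<lambda>n. b n u) \<longlonglongrightarrow> b' u"
  shows "(\<lambda>n. test_grad e (b n) (s n)) \<longlonglongrightarrow> test_grad e b' q"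
proof -
  note [measurable] = arc_measurable[OF Gk_dn[OF s(1)]] arc_measurable[OF Gk_dn[OF s(2)]]
  have bm[measurable]: "b n \<in> borel_measurable I0" "b' \<in> borel_measurable I0" for n
    by (rule continuous_imp_measurable_on_sets_lebesgue, rule b, simp)+
  show ?thesis
    unfolding test_grad_def
  proof (rule P_tendsto)
    show "(\<lambda>u. norm_slope e (arc (dn (s n)) u - b n u) (arc (dn (s n)) u - b n u)) \<in> borel_measurable I0" for n by measurable
    show "(\<lambda>u. norm_slope e (arc (dn q) u - b' u) (arc (dn q) u - b' u)) \<in> borel_measurable I0" by measurable
    show "norm (norm_slope e (arc (dn (s n)) u - b n u) (arc (dn (s n)) u - b n u)) \<le> 1" for n u
      by (rule norm_slope_le[OF e])
    show "(\<lambda>n. norm_slope e (arc (dn (s n)) u - b n u) (arc (dn (s n)) u - b n u)) \<longlonglongrightarrow>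
        norm_slope e (arc (dn q) u - b' u) (arc (dn q) u - b' u)" if "u \<in> {0..T}" for u
      by (intro tendsto_norm_slope[OF e] tendsto_diff pconv_point[OF s(3)] b(3) that)
    show "0 \<le> fst (s n)" "0 \<le> fst q" for n
      using position_time[OF Gk_position[OF s(1)]] position_time[OF Gk_position[OF s(2)]] by auto
  qed (use s pconv_time in auto)
qed

lemma penalty_arc_tendsto:
  assumes s: "\<And>n. s n \<in> \<G> k" "q \<in> \<G> k" "pconv s q" and e: "e \<ge> 0"
    and b: "\<And>n. continuous_on {0..T} (b n)" "continuous_on {0..T} b'" "\<And>u. u \<in> {0..T} \<Longrightarrow> (\<lambda>n. b n u) \<longlonglongrightarrow> b' u"
    and B: "\<And>n u. u \<in> {0..T} \<Longrightarrow> norm (b n u) \<le> B"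
  shows "(\<lambda>n. penalty e (\<lambda>u. arc (dn (s n)) u - b n u)) \<longlonglongrightarrow> penalty e (\<lambda>u. arc (dn q) u - b' u)"
proof -
  obtain M where M: "\<And>q \<tau>. q \<in> \<G> k \<Longrightarrow> \<tau> \<in> {0..T} \<Longrightarrow> norm (arc (dn q) \<tau>) \<le> M"
    by (rule Gk_bounded) (rule that)
  show ?thesis
  proof (rule penalty_tendsto[where B = "M + B"])
    show "continuous_on {0..T} (\<lambda>u. arc (dn (s n)) u - b n u)" for n
      by (intro continuous_on_diff arc_continuous Gk_dn[OF s(1)] b)
    show "continuous_on {0..T} (\<lambda>u. arc (dn q) u - b' u)"
      by (intro continuous_on_diff arc_continuous Gk_dn[OF s(2)] b)
    show "norm (arc (dn (s n)) u - b n u) \<le> M + B" if "u \<in> {0..T}" for n u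
      using M[OF s(1) that] B[OF that] by (meson add_mono norm_triangle_ineq4 order_trans)
    show "(\<lambda>n. arc (dn (s n)) u - b n u) \<longlonglongrightarrow> arc (dn q) u - b' u" if "u \<in> {0..T}" for u
      by (intro tendsto_diff pconv_point[OF s(3)] b(3) that)
  qed (rule e)
qed

lemma penalty_pair_tendsto:
  assumes "\<And>n. s n \<in> \<G> k" "q \<in> \<G> k" "pconv s q"
    and "\<And>n. r n \<in> \<G> k" "p \<in> \<G> k" "pconv r p" and "e \<ge> 0"
  shows "(\<lambda>n. penalty e (\<lambda>u. arc (dn (s n)) u - arc (dn (r n)) u)) \<longlonglongrightarrow> penalty e (\<lambda>u. arc (dn q) u - arc (dn p) u)"
proof -
  obtain M where M: "\<And>q \<tau>. q \<in> \<G> k \<Longrightarrow> \<tau> \<in> {0..T} \<Longrightarrow> norm (arc (dn q) \<tau>) \<le> M"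
    by (rule Gk_bounded) (rule that)
  show ?thesis
    by (rule penalty_arc_tendsto[where k = k and B = M])
       (use assms M in \<open>auto intro: arc_continuous Gk_dn pconv_point\<close>)
qed

lemma test_functional_smooth:
  fixes c e :: real and b :: "real \<Rightarrow> real ^ 'n" and \<theta> \<theta>' :: "real \<Rightarrow> real"
  assumes b: "continuous_on {0..T} b" and e: "e > 0"
    and \<theta>: "\<And>t. (\<theta> has_real_derivative \<theta>' t) (at t)" and \<theta>': "continuous_on UNIV \<theta>'"
  defines "\<psi> \<equiv> \<lambda>q. c * test e b q + \<theta> (fst q)"
  shows "ci_smooth T y K c0 \<psi>"
    "\<And>q. q \<in> open_positions T y K \<Longrightarrow> ci_dt T y K \<psi> q = \<theta>' (fst q)"
    "\<And>q. q \<in> open_positions T y K \<Longrightarrow> ci_grad T y K \<psi> q = c *\<^sub>R test_grad e b q"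
proof -
  have der: "has_ci_derivatives T y K \<psi> q (\<theta>' (fst q)) (c *\<^sub>R test_grad e b q)" if "q \<in> open_positions T y K" for q
    unfolding \<psi>_def by (rule test_functional_derivatives[OF that b e \<theta>])
  show dt: "\<And>q. q \<in> open_positions T y K \<Longrightarrow> ci_dt T y K \<psi> q = \<theta>' (fst q)"
    and gr: "\<And>q. q \<in> open_positions T y K \<Longrightarrow> ci_grad T y K \<psi> q = c *\<^sub>R test_grad e b q"
    using ci_dt_grad_eq[OF _ der] by blast+
  have "bounded (b ` {0..T})" by (intro compact_imp_bounded compact_continuous_image b) simp
  then obtain B where B: "\<And>u. u \<in> {0..T} \<Longrightarrow> norm (b u) \<le> B" unfolding bounded_iff by blast
  have \<theta>c: "continuous_on UNIV \<theta>" by (intro DERIV_continuous_on) (use \<theta> in auto)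
  have lim: "(\<lambda>n. f (fst (s n))) \<longlonglongrightarrow> f (fst q)" if "continuous_on UNIV f" "pconv s q" for f :: "real \<Rightarrow> real" and s q
    by (rule continuous_on_tendsto_compose[OF that(1) pconv_time[OF that(2)]]) auto
  show "ci_smooth T y K c0 \<psi>"
    unfolding ci_smooth_def
  proof (intro conjI ballI allI impI)
    show "ci_differentiable T y K \<psi> q" if "q \<in> open_positions T y K" for q
      unfolding ci_differentiable_def using der[OF that] by blast
    fix k
    show "pos_continuous_on T (\<G> k) \<psi>"
    proof (rule pos_continuous_onI[OF subset_refl])
      fix s q assume s: "\<And>n. s n \<in> \<G> k" "q \<in> \<G> k" "pconv s q"
      show "(\<lambda>n. \<psi> (s n)) \<longlonglongrightarrow> \<psi> q"
        unfolding \<psi>_def test_def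
        by (intro tendsto_add tendsto_mult tendsto_const lim[OF \<theta>c s(3)] penalty_arc_tendsto[OF s])
           (use b B e in auto)
    qed
    show "pos_continuous_on T (\<G> k \<inter> open_positions T y K) (ci_dt T y K \<psi>)"
    proof (rule pos_continuous_onI[of _ k])
      fix s q assume s: "\<And>n. s n \<in> \<G> k \<inter> open_positions T y K" "q \<in> \<G> k \<inter> open_positions T y K" "pconv s q"
      have "(\<lambda>n. \<theta>' (fst (s n))) \<longlonglongrightarrow> \<theta>' (fst q)" by (rule lim[OF \<theta>' s(3)])
      then show "(\<lambda>n. ci_dt T y K \<psi> (s n)) \<longlonglongrightarrow> ci_dt T y K \<psi> q" using dt s by simp
    qed auto
    show "pos_continuous_on T (\<G> k \<inter> open_positions T y K) (ci_grad T y K \<psi>)"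
    proof (rule pos_continuous_onI[of _ k])
      fix s q assume s: "\<And>n. s n \<in> \<G> k \<inter> open_positions T y K" "q \<in> \<G> k \<inter> open_positions T y K" "pconv s q"
      have sG: "s n \<in> \<G> k" "q \<in> \<G> k" for n using s(1)[of n] s(2) by auto
      have qT: "fst q < T" using s(2) by (auto simp: open_positions_def)
      have "(\<lambda>n. c *\<^sub>R test_grad e b (s n)) \<longlonglongrightarrow> c *\<^sub>R test_grad e b q"
        by (intro tendsto_scaleR tendsto_const test_grad_tendsto[OF sG(1) sG(2) s(3) qT e]) (use b in auto)
      then show "(\<lambda>n. ci_grad T y K \<psi> (s n)) \<longlonglongrightarrow> ci_grad T y K \<psi> q" using gr s by simp
    qed auto
  qed
qed

lemma penalty_minus_commute: "penalty e (\<lambda>u. f u - g u) = penalty e (\<lambda>u. g u - f u)"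
proof -
  have "smooth_norm e (f u - g u) = smooth_norm e (g u - f u)" for u
    using smooth_norm_minus[of e "g u - f u"] by simp
  then show ?thesis by (simp add: penalty_def)
qed

text \<open>At equal times the gradients with respect to the two arguments of the penalty are opposite.\<close>
lemma test_grad_swap:
  assumes "fst q = fst p"
  shows "test_grad e (arc (dn p)) q = - test_grad e (arc (dn q)) p"
proof -
  have "norm_slope e (arc (dn q) u - arc (dn p) u) (arc (dn q) u - arc (dn p) u)
    = - norm_slope e (arc (dn p) u - arc (dn q) u) (arc (dn p) u - arc (dn q) u)" for u
    using norm_slope_minus[of e "arc (dn p) u - arc (dn q) u" "arc (dn p) u - arc (dn q) u"] by simp
  then show ?thesis unfolding test_grad_def assms by (simp add: P_minus)
qed

section \<open>The comparison argument\<close>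

lemma Phi_lipschitz:
  assumes "\<phi> \<in> Phi T y K c0 \<alpha>" "k \<ge> 1"
  obtains L where "L > 0" "\<And>q p. q \<in> \<G> k \<Longrightarrow> p \<in> \<G> k \<Longrightarrow> fst q = fst p \<Longrightarrow>
    \<bar>\<phi> q - \<phi> p\<bar> \<le> L * penalty 0 (\<lambda>u. arc (dn q) u - arc (dn p) u)"
proof -
  obtain L where L: "L > 0" "\<And>t w w'. (t, w) \<in> \<G> k \<Longrightarrow> (t, w') \<in> \<G> k \<Longrightarrow>
        \<bar>\<phi> (t, w) - \<phi> (t, w')\<bar> \<le>
          L * (norm (prolong y K (t, w) T - prolong y K (t, w') T) +
               (LINT \<tau>|lebesgue_on {0..T}.
                  norm (prolong y K (t, w) \<tau> - prolong y K (t, w') \<tau>) / (T - \<tau>) powr (1 - \<alpha>)))"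
    using assms unfolding Phi_def by blast
  show thesis
  proof (rule that[OF L(1)])
    fix q p :: "'n position"
    assume q: "q \<in> \<G> k" and p: "p \<in> \<G> k" and eq: "fst q = fst p"
    obtain t w w' where qp: "q = (t, w)" "p = (t, w')" using eq by (cases q, cases p) auto
    note pr = position_dn(3)[OF Gk_position[OF q]] position_dn(3)[OF Gk_position[OF p]]
    have "norm (prolong y K q T - prolong y K p T) +
        (LINT \<tau>|I0. norm (prolong y K q \<tau> - prolong y K p \<tau>) / (T - \<tau>) powr (1 - \<alpha>))
      = penalty 0 (\<lambda>u. arc (dn q) u - arc (dn p) u)"
      unfolding penalty_0_eq using T_pos pr
      by (intro arg_cong2[where f = "(+)"] Bochner_Integration.integral_cong) auto
    then show "\<bar>\<phi> q - \<phi> p\<bar> \<le> L * penalty 0 (\<lambda>u. arc (dn q) u - arc (dn p) u)"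
      using L(2)[of t w w'] q p unfolding qp by simp
  qed
qed

lemma Phi_tendsto:
  assumes "\<phi> \<in> Phi T y K c0 \<alpha>" "k \<ge> 1" "\<And>n. s n \<in> \<G> k" "q \<in> \<G> k" "pconv s q"
  shows "(\<lambda>n. \<phi> (s n)) \<longlonglongrightarrow> \<phi> q"
  by (rule pos_continuous_onD[of "\<G> k"]) (use assms Gk_position in \<open>auto simp: Phi_def\<close>)

lemma Gk_pair_compact:
  assumes "\<And>n. s n \<in> \<G> k" "\<And>n. r n \<in> \<G> k"
  obtains \<rho> q p where "strict_mono (\<rho> :: nat \<Rightarrow> nat)" "q \<in> \<G> k" "p \<in> \<G> k"
    "pconv (\<lambda>n. s (\<rho> n)) q" "pconv (\<lambda>n. r (\<rho> n)) p"
proof -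
  obtain r1 q where 1: "strict_mono r1" "q \<in> \<G> k" "pconv (\<lambda>n. s (r1 n)) q"
    using Gk_compact[of s k] assms(1) by blast
  obtain r2 p where 2: "strict_mono r2" "p \<in> \<G> k" "pconv (\<lambda>n. r (r1 (r2 n))) p"
    using Gk_compact[of "\<lambda>n. r (r1 n)" k] assms(2) by blast
  have "strict_mono (\<lambda>n. r1 (r2 n))" using 1(1) 2(1) by (simp add: strict_mono_def)
  from that[OF this 1(2) 2(2) pconv_subseq[OF 1(3) 2(1)] 2(3)] show thesis .
qed

text \<open>The functional of two positions that is maximized; \<open>N\<close> penalizes the difference of the times.\<close>
definition doubled ::
  "('n position \<Rightarrow> real) \<Rightarrow> ('n position \<Rightarrow> real) \<Rightarrow> real \<Rightarrow> real \<Rightarrow> real \<Rightarrow> real \<Rightarrow> 'n position \<Rightarrow> 'n position \<Rightarrow> real" where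
  "doubled \<phi>1 \<phi>2 A e N \<zeta> q p = \<phi>1 q - \<phi>2 p - A * penalty e (\<lambda>u. arc (dn q) u - arc (dn p) u)
     - N * (fst q - fst p)\<^sup>2 - \<zeta> * (T - fst q)"

lemma doubled_tendsto:
  assumes "\<phi>1 \<in> Phi T y K c0 \<alpha>" "\<phi>2 \<in> Phi T y K c0 \<alpha>" "k \<ge> 1" "e \<ge> 0"
    and "\<And>n. s n \<in> \<G> k" "q \<in> \<G> k" "pconv s q"
    and "\<And>n. r n \<in> \<G> k" "p \<in> \<G> k" "pconv r p"
  shows "(\<lambda>n. doubled \<phi>1 \<phi>2 A e N \<zeta> (s n) (r n)) \<longlonglongrightarrow> doubled \<phi>1 \<phi>2 A e N \<zeta> q p"
  unfolding doubled_def
  by (intro tendsto_intros Phi_tendsto[OF assms(1,3,5,6,7)] Phi_tendsto[OF assms(2,3,8,9,10)]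
      penalty_pair_tendsto[OF assms(5-10)] pconv_time assms)

lemma doubled_attains_max:
  assumes "\<phi>1 \<in> Phi T y K c0 \<alpha>" "\<phi>2 \<in> Phi T y K c0 \<alpha>" "k \<ge> 1" "e \<ge> 0" "q0 \<in> \<G> k"
  obtains q p where "q \<in> \<G> k" "p \<in> \<G> k"
    "\<And>q' p'. q' \<in> \<G> k \<Longrightarrow> p' \<in> \<G> k \<Longrightarrow> doubled \<phi>1 \<phi>2 A e N \<zeta> q' p' \<le> doubled \<phi>1 \<phi>2 A e N \<zeta> q p"
proof -
  let ?S = "\<G> k \<times> \<G> k" and ?f = "\<lambda>z. doubled \<phi>1 \<phi>2 A e N \<zeta> (fst z) (snd z)"
  have "\<exists>z\<in>?S. \<forall>z'\<in>?S. ?f z' \<le> ?f z"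
  proof (rule attains_max_of_seq_compact)
    show "?S \<noteq> {}" using assms(5) by blast
    fix s :: "nat \<Rightarrow> 'n position \<times> 'n position" assume s: "\<And>n. s n \<in> ?S"
    then have s1: "fst (s n) \<in> \<G> k" "snd (s n) \<in> \<G> k" for n by (auto simp: mem_Times_iff)
    obtain \<rho> q p where c: "strict_mono (\<rho> :: nat \<Rightarrow> nat)" "q \<in> \<G> k" "p \<in> \<G> k"
      "pconv (\<lambda>n. fst (s (\<rho> n))) q" "pconv (\<lambda>n. snd (s (\<rho> n))) p"
      by (rule Gk_pair_compact[of "\<lambda>n. fst (s n)" k "\<lambda>n. snd (s n)", OF s1])
    have "(\<lambda>n. ?f (s (\<rho> n))) \<longlonglongrightarrow> ?f (q, p)"
      using doubled_tendsto[OF assms(1-4) s1(1) c(2,4) s1(2) c(3,5)] by simp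
    then show "\<exists>r z. strict_mono r \<and> z \<in> ?S \<and> (\<lambda>n. ?f (s (r n))) \<longlonglongrightarrow> ?f z"
      using c(1-3) by blast
  qed
  then show thesis using that by force
qed

text \<open>Subtracting the viscosity inequalities for \<open>\<phi>1\<close> at \<open>q\<close> and \<open>\<phi>2\<close> at \<open>p\<close> cancels the derivatives of the
  time penalty.\<close>
lemma viscosity_doubling:
  assumes v: "viscosity_solution T y K c0 \<alpha> H \<sigma> \<phi>1" "viscosity_solution T y K c0 \<alpha> H \<sigma> \<phi>2"
    and k: "k \<ge> 1" and e: "e > 0"
    and q: "q \<in> \<G> k" "fst q < T" and p: "p \<in> \<G> k" "fst p < T"
    and max: "\<And>q' p'. q' \<in> \<G> k \<Longrightarrow> p' \<in> \<G> k \<Longrightarrow>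
      doubled \<phi>1 \<phi>2 A e N \<zeta> q' p' \<le> doubled \<phi>1 \<phi>2 A e N \<zeta> q p"
  shows "\<zeta> \<le> H (fst q) (arc (dn q) (fst q)) (A *\<^sub>R test_grad e (arc (dn p)) q)
    - H (fst p) (arc (dn p) (fst p)) ((- A) *\<^sub>R test_grad e (arc (dn q)) p)"
proof -
  have qo: "q \<in> open_positions T y K" and po: "p \<in> open_positions T y K"
    using q p Gk_position by (auto simp: open_positions_def case_prod_unfold)
  have c: "continuous_on {0..T} (arc (dn p))" "continuous_on {0..T} (arc (dn q))"
    by (intro arc_continuous Gk_dn[OF p(1)] Gk_dn[OF q(1)])+
  have val: "snd q (fst q) = arc (dn q) (fst q)" "snd p (fst p) = arc (dn p) (fst p)"
    using position_dn(2)[OF Gk_position[OF q(1)]] position_dn(2)[OF Gk_position[OF p(1)]]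
      position_time[OF Gk_position[OF q(1)]] position_time[OF Gk_position[OF p(1)]] by auto
  define \<theta>1 where "\<theta>1 t = N * (t - fst p)\<^sup>2 + \<zeta> * (T - t)" for t
  define \<theta>2 where "\<theta>2 t = - N * (fst q - t)\<^sup>2" for t
  define \<psi>1 where "\<psi>1 = (\<lambda>z. A * test e (arc (dn p)) z + \<theta>1 (fst z))"
  define \<psi>2 where "\<psi>2 = (\<lambda>z. (- A) * test e (arc (dn q)) z + \<theta>2 (fst z))"
  have d1: "(\<theta>1 has_real_derivative 2 * N * (t - fst p) - \<zeta>) (at t)" for t
    unfolding \<theta>1_def by (auto intro!: derivative_eq_intros)
  have d2: "(\<theta>2 has_real_derivative 2 * N * (fst q - t)) (at t)" for t
    unfolding \<theta>2_def by (auto intro!: derivative_eq_intros simp: algebra_simps)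
  note s1 = test_functional_smooth[where c = A, OF c(1) e d1, folded \<psi>1_def]
  note s2 = test_functional_smooth[where c = "- A", OF c(2) e d2, folded \<psi>2_def]
  have cont: "continuous_on UNIV (\<lambda>t. 2 * N * (t - fst p) - \<zeta>)" "continuous_on UNIV (\<lambda>t. 2 * N * (fst q - t))"
    by (intro continuous_intros)+
  have "\<forall>z\<in>\<G> k. \<phi>1 z - \<psi>1 z \<le> \<phi>1 q - \<psi>1 q"
  proof
    fix z assume "z \<in> \<G> k"
    from max[OF this p(1)] show "\<phi>1 z - \<psi>1 z \<le> \<phi>1 q - \<psi>1 q"
      by (simp add: doubled_def \<psi>1_def \<theta>1_def test_def)
  qed
  then have "ci_dt T y K \<psi>1 q + H (fst q) (snd q (fst q)) (ci_grad T y K \<psi>1 q) \<ge> 0"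
    using v(1) k s1(1)[OF cont(1)] q(1) qo unfolding viscosity_solution_def
    by (metis IntI prod.collapse)
  then have 1: "2 * N * (fst q - fst p) - \<zeta> + H (fst q) (arc (dn q) (fst q)) (A *\<^sub>R test_grad e (arc (dn p)) q) \<ge> 0"
    using s1(2,3)[OF cont(1) qo] val by simp
  have "\<forall>z\<in>\<G> k. \<phi>2 p - \<psi>2 p \<le> \<phi>2 z - \<psi>2 z"
  proof
    fix z assume "z \<in> \<G> k"
    from max[OF q(1) this] show "\<phi>2 p - \<psi>2 p \<le> \<phi>2 z - \<psi>2 z"
      by (simp add: doubled_def \<psi>2_def \<theta>2_def test_def penalty_minus_commute[of e "arc (dn q)"])
  qed
  then have "ci_dt T y K \<psi>2 p + H (fst p) (snd p (fst p)) (ci_grad T y K \<psi>2 p) \<le> 0"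
    using v(2) k s2(1)[OF cont(2)] p(1) po unfolding viscosity_solution_def
    by (metis IntI prod.collapse)
  then have 2: "2 * N * (fst q - fst p) + H (fst p) (arc (dn p) (fst p)) ((- A) *\<^sub>R test_grad e (arc (dn q)) p) \<le> 0"
    using s2(2,3)[OF cont(2) po] val by simp
  show ?thesis using 1 2 by linarith
qed

text \<open>Limit \<open>N \<rightarrow> \<infinity>\<close> with \<open>e\<close> fixed. The limit pair maximizes the functional without time penalty among
  pairs with equal times, and the gradients in the two viscosity inequalities have the same limit.\<close>
lemma equal_time_maximum:
  assumes v: "viscosity_solution T y K c0 \<alpha> H \<sigma> \<phi>1" "viscosity_solution T y K c0 \<alpha> H \<sigma> \<phi>2"
    and H: "continuous_on ({0..T} \<times> UNIV \<times> UNIV) (\<lambda>(t, x, s). H t x s)"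
    and k: "k \<ge> 1" and e: "e > 0" and q0: "q0 \<in> \<G> k"
  obtains q p where "q \<in> \<G> k" "p \<in> \<G> k" "fst q = fst p"
    "\<And>q' p'. q' \<in> \<G> k \<Longrightarrow> p' \<in> \<G> k \<Longrightarrow> fst q' = fst p' \<Longrightarrow>
      doubled \<phi>1 \<phi>2 A e 0 \<zeta> q' p' \<le> doubled \<phi>1 \<phi>2 A e 0 \<zeta> q p"
    "fst q < T \<Longrightarrow> \<zeta> \<le> H (fst q) (arc (dn q) (fst q)) (A *\<^sub>R test_grad e (arc (dn p)) q)
       - H (fst q) (arc (dn p) (fst q)) (A *\<^sub>R test_grad e (arc (dn p)) q)"
proof -
  have Ph: "\<phi>1 \<in> Phi T y K c0 \<alpha>" "\<phi>2 \<in> Phi T y K c0 \<alpha>" using v by (auto simp: viscosity_solution_def)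
  have e0: "e \<ge> 0" using e by simp
  let ?D = "doubled \<phi>1 \<phi>2 A e"
  have "\<exists>q p. q \<in> \<G> k \<and> p \<in> \<G> k \<and> (\<forall>q'\<in>\<G> k. \<forall>p'\<in>\<G> k.
      ?D (real n) \<zeta> q' p' \<le> ?D (real n) \<zeta> q p)" for n
    by (rule doubled_attains_max[OF Ph k e0 q0, of A "real n" \<zeta>]) blast
  then obtain s r where s: "\<And>n. s n \<in> \<G> k" "\<And>n. r n \<in> \<G> k"
    and mx: "\<And>n q' p'. q' \<in> \<G> k \<Longrightarrow> p' \<in> \<G> k \<Longrightarrow>
      ?D (real n) \<zeta> q' p' \<le> ?D (real n) \<zeta> (s n) (r n)" by metis
  obtain \<rho> q p where \<rho>: "strict_mono (\<rho> :: nat \<Rightarrow> nat)" and qp: "q \<in> \<G> k" "p \<in> \<G> k"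
    and c: "pconv (\<lambda>n. s (\<rho> n)) q" "pconv (\<lambda>n. r (\<rho> n)) p" by (rule Gk_pair_compact[OF s])
  have lim0: "(\<lambda>n. ?D 0 \<zeta> (s (\<rho> n)) (r (\<rho> n))) \<longlonglongrightarrow> ?D 0 \<zeta> q p"
    by (rule doubled_tendsto[OF Ph k e0 s(1) qp(1) c(1) s(2) qp(2) c(2)])
  have D0: "?D N \<zeta> z z' = ?D 0 \<zeta> z z' - N * (fst z - fst z')\<^sup>2" for N z z' by (simp add: doubled_def)
  have bnd: "?D 0 \<zeta> q' p' + real (\<rho> n) * (fst (s (\<rho> n)) - fst (r (\<rho> n)))\<^sup>2 \<le> ?D 0 \<zeta> (s (\<rho> n)) (r (\<rho> n))"
    if "q' \<in> \<G> k" "p' \<in> \<G> k" "fst q' = fst p'" for n q' p'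
    using mx[OF that(1,2), of "\<rho> n"] that(3) unfolding D0[of "real (\<rho> n)"] by simp
  have max0: "?D 0 \<zeta> q' p' \<le> ?D 0 \<zeta> q p"
    if "q' \<in> \<G> k" "p' \<in> \<G> k" "fst q' = fst p'" for q' p'
  proof (rule LIMSEQ_le_const[OF lim0], intro exI allI impI)
    fix n :: nat
    have "0 \<le> real (\<rho> n) * (fst (s (\<rho> n)) - fst (r (\<rho> n)))\<^sup>2" by simp
    then show "?D 0 \<zeta> q' p' \<le> ?D 0 \<zeta> (s (\<rho> n)) (r (\<rho> n))" using bnd[OF that, of n] by linarith
  qed
  have eqt: "fst q = fst p"
  proof -
    have tlim: "(\<lambda>n. (fst (s (\<rho> n)) - fst (r (\<rho> n)))\<^sup>2) \<longlonglongrightarrow> (fst q - fst p)\<^sup>2"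
      by (intro tendsto_intros pconv_time[OF c(1)] pconv_time[OF c(2)])
    have "(\<lambda>n. ?D 0 \<zeta> (s (\<rho> n)) (r (\<rho> n)) - ?D 0 \<zeta> q0 q0) \<longlonglongrightarrow> ?D 0 \<zeta> q p - ?D 0 \<zeta> q0 q0"
      by (intro tendsto_intros lim0)
    then have "Bseq (\<lambda>n. ?D 0 \<zeta> (s (\<rho> n)) (r (\<rho> n)) - ?D 0 \<zeta> q0 q0)"
      by (intro convergent_imp_Bseq convergentI)
    then obtain B where B: "\<And>n. \<bar>?D 0 \<zeta> (s (\<rho> n)) (r (\<rho> n)) - ?D 0 \<zeta> q0 q0\<bar> \<le> B"
      unfolding Bseq_def real_norm_def by (elim exE conjE) (rule that, blast)
    have "(fst (s (\<rho> n)) - fst (r (\<rho> n)))\<^sup>2 \<le> B * inverse (real n)" if "n \<ge> 1" for n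
    proof -
      have "real n * (fst (s (\<rho> n)) - fst (r (\<rho> n)))\<^sup>2 \<le> real (\<rho> n) * (fst (s (\<rho> n)) - fst (r (\<rho> n)))\<^sup>2"
        using seq_suble[OF \<rho>, of n] by (intro mult_right_mono) auto
      also have "\<dots> \<le> B" using bnd[OF q0 q0 refl, of n] B[of n] by linarith
      finally show ?thesis using that by (simp add: field_simps)
    qed
    moreover have "(\<lambda>n. B * inverse (real n)) \<longlonglongrightarrow> B * 0"
      by (intro tendsto_intros lim_inverse_n)
    ultimately have "(fst q - fst p)\<^sup>2 \<le> B * 0" using LIMSEQ_le[OF tlim] by blast
    then show ?thesis by simp
  qed
  have ineq: "\<zeta> \<le> H (fst q) (arc (dn q) (fst q)) (A *\<^sub>R test_grad e (arc (dn p)) q)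
       - H (fst q) (arc (dn p) (fst q)) (A *\<^sub>R test_grad e (arc (dn p)) q)" if qT: "fst q < T"
  proof -
    have pT: "fst p < T" using qT eqt by simp
    let ?s = "\<lambda>n. s (\<rho> n)" and ?r = "\<lambda>n. r (\<rho> n)"
    have ev: "eventually (\<lambda>n. fst (?s n) < T) sequentially" "eventually (\<lambda>n. fst (?r n) < T) sequentially"
      using order_tendstoD(2)[OF pconv_time[OF c(1)] qT] order_tendstoD(2)[OF pconv_time[OF c(2)] pT] by auto
    have tin: "fst (?s n) \<in> {0..T}" "fst (?r n) \<in> {0..T}" "fst q \<in> {0..T}" "fst p \<in> {0..T}" for n
      using position_time[OF Gk_position] s qp by blast+
    have g1: "(\<lambda>n. test_grad e (arc (dn (?r n))) (?s n)) \<longlonglongrightarrow> test_grad e (arc (dn p)) q"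
      by (rule test_grad_tendsto[OF s(1) qp(1) c(1) qT e arc_continuous[OF Gk_dn[OF s(2)]]
            arc_continuous[OF Gk_dn[OF qp(2)]] pconv_point[OF c(2)]])
    have g2: "(\<lambda>n. test_grad e (arc (dn (?s n))) (?r n)) \<longlonglongrightarrow> test_grad e (arc (dn q)) p"
      by (rule test_grad_tendsto[OF s(2) qp(2) c(2) pT e arc_continuous[OF Gk_dn[OF s(1)]]
            arc_continuous[OF Gk_dn[OF qp(1)]] pconv_point[OF c(1)]])
    have Hlim: "(\<lambda>n. H (u n) (x n) (g n)) \<longlonglongrightarrow> H u' x' g'"
      if "u \<longlonglongrightarrow> u'" "x \<longlonglongrightarrow> x'" "g \<longlonglongrightarrow> g'" "\<And>n. u n \<in> {0..T}" "u' \<in> {0..T}" for u x g u' x' g'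
      using continuous_on_tendsto_compose[OF H, of "\<lambda>n. (u n, x n, g n)" "(u', x', g')" sequentially] that
      by (simp add: tendsto_Pair)
    have "(\<lambda>n. H (fst (?s n)) (arc (dn (?s n)) (fst (?s n))) (A *\<^sub>R test_grad e (arc (dn (?r n))) (?s n))
        - H (fst (?r n)) (arc (dn (?r n)) (fst (?r n))) ((- A) *\<^sub>R test_grad e (arc (dn (?s n))) (?r n)))
      \<longlonglongrightarrow> H (fst q) (arc (dn q) (fst q)) (A *\<^sub>R test_grad e (arc (dn p)) q)
        - H (fst p) (arc (dn p) (fst p)) ((- A) *\<^sub>R test_grad e (arc (dn q)) p)"
      by (intro tendsto_diff Hlim tendsto_scaleR tendsto_const g1 g2 pconv_time c tin
          pconv_diag[OF c(1) Gk_position[OF qp(1)]] pconv_diag[OF c(2) Gk_position[OF qp(2)]])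
    moreover have "eventually (\<lambda>n. \<zeta> \<le> H (fst (?s n)) (arc (dn (?s n)) (fst (?s n))) (A *\<^sub>R test_grad e (arc (dn (?r n))) (?s n))
        - H (fst (?r n)) (arc (dn (?r n)) (fst (?r n))) ((- A) *\<^sub>R test_grad e (arc (dn (?s n))) (?r n))) sequentially"
      using ev by eventually_elim (rule viscosity_doubling[OF v k e s(1) _ s(2) _ mx])
    ultimately have "\<zeta> \<le> H (fst q) (arc (dn q) (fst q)) (A *\<^sub>R test_grad e (arc (dn p)) q)
        - H (fst p) (arc (dn p) (fst p)) ((- A) *\<^sub>R test_grad e (arc (dn q)) p)"
      by (intro tendsto_lowerbound[where F = sequentially]) auto
    then show ?thesis using test_grad_swap[OF eqt, of e] eqt by simp
  qed
  show thesis by (rule that[OF qp eqt max0 ineq])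
qed

text \<open>The weight is bounded below by \<open>rho T > 0\<close>.\<close>
lemma penalty_0_eq_0_imp:
  assumes h: "continuous_on {0..T} h" and p: "penalty 0 h \<le> 0" and t: "t \<in> {0..T}"
  shows "h t = 0"
proof -
  have s0: "smooth_norm 0 v = norm v" for v :: "real^'n" by (simp add: smooth_norm_def)
  have i: "integrable I0 (\<lambda>s. rho (T - s) * norm (h s))" using penalty_integrable[OF h, of 0] by (simp add: s0)
  have hn: "continuous_on {0..T} (\<lambda>s. norm (h s))" by (intro continuous_intros h)
  have hi: "integrable I0 (\<lambda>s. norm (h s))"
    using integrable_continuous_real[OF hn] hn by (intro continuous_imp_integrable_real)
  have "(LINT s|I0. rho (T - s) * norm (h s)) \<le> 0" using p norm_ge_zero[of "h T"] unfolding penalty_def s0 by linarith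
  moreover have "(LINT s|I0. rho T * norm (h s)) \<le> (LINT s|I0. rho (T - s) * norm (h s))"
  proof (rule integral_mono_AE)
    have "AE s in I0. s \<in> {0..T}" by (rule AE_I2) simp
    moreover have "AE s in I0. s \<noteq> T" by (rule AE_lebesgue_on_neq) simp
    ultimately show "AE s in I0. rho T * norm (h s) \<le> rho (T - s) * norm (h s)"
    proof eventually_elim
      case (elim s)
      then show ?case using rho_antimono[of "T - s" T] by (intro mult_right_mono) auto
    qed
  qed (use hi i in auto)
  ultimately have "rho T * (LINT s|I0. norm (h s)) \<le> 0" by simp
  then have "(LINT s|I0. norm (h s)) \<le> 0" using rho_pos[OF T_pos] by (simp add: mult_le_0_iff)
  moreover have "(LINT s|I0. norm (h s)) \<ge> 0" by (rule Bochner_Integration.integral_nonneg) simp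
  ultimately have "(LINT s|I0. norm (h s)) = 0" by simp
  then have "integral {0..T} (\<lambda>s. norm (h s)) = 0" using lebesgue_integral_eq_integral[OF hi] by simp
  then have "norm (h t) = 0"
    using integral_eq_0_iff[OF hn] T_pos t by auto
  then show ?thesis by simp
qed

lemma position_in_Gk:
  assumes "q \<in> positions T y K" obtains k where "k \<ge> 1" "q \<in> \<G> k"
proof -
  obtain M where M: "M > 0" "AE \<xi> in I0. norm (dn q \<xi>) \<le> M" using Linf_bound[OF position_dn(1)[OF assms]] .
  obtain k :: nat where k: "M / c0 < real k" using reals_Archimedean2 by blast
  then have Mk: "M \<le> real k * c0" using c0_pos by (simp add: field_simps)
  have kpos: "k \<ge> 1" using k M(1) c0_pos by (cases k) (auto simp: divide_less_0_iff)
  have "AE \<xi> in I0. norm (dn q \<xi>) \<le> real k * c0 * (1 + norm (arc (dn q) \<xi>))"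
    using M(2)
  proof eventually_elim
    case (elim \<xi>)
    have "real k * c0 * 1 \<le> real k * c0 * (1 + norm (arc (dn q) \<xi>))" using c0_pos by (intro mult_left_mono) auto
    then show ?case using elim Mk by linarith
  qed
  then show thesis using that kpos assms by (simp add: Gk_iff)
qed

theorem comparison:
  assumes v: "viscosity_solution T y K c0 \<alpha> H \<sigma> \<phi>1" "viscosity_solution T y K c0 \<alpha> H \<sigma> \<phi>2"
    and H: "continuous_on ({0..T} \<times> UNIV \<times> UNIV) (\<lambda>(t, x, s). H t x s)"
    and q0: "q0 \<in> positions T y K"
  shows "\<phi>1 q0 \<le> \<phi>2 q0"
proof (rule ccontr)
  assume "\<not> \<phi>1 q0 \<le> \<phi>2 q0"
  define \<kappa> where "\<kappa> = \<phi>1 q0 - \<phi>2 q0"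
  have \<kappa>: "\<kappa> > 0" using \<open>\<not> \<phi>1 q0 \<le> \<phi>2 q0\<close> by (simp add: \<kappa>_def)
  have Ph: "\<phi>1 \<in> Phi T y K c0 \<alpha>" "\<phi>2 \<in> Phi T y K c0 \<alpha>" using v by (auto simp: viscosity_solution_def)
  obtain k where k: "k \<ge> 1" "q0 \<in> \<G> k" using position_in_Gk[OF q0] .
  obtain L where L: "L > 0" "\<And>q p. q \<in> \<G> k \<Longrightarrow> p \<in> \<G> k \<Longrightarrow> fst q = fst p \<Longrightarrow>
    \<bar>\<phi>2 q - \<phi>2 p\<bar> \<le> L * penalty 0 (\<lambda>u. arc (dn q) u - arc (dn p) u)"
    using Phi_lipschitz[OF Ph(2) k(1)] by blast
  \<comment> \<open>Half of \<open>A\<close> is absorbed by the Lipschitz estimate; \<open>\<zeta>\<close> costs at most a quarter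
    of the gap \<open>\<kappa>\<close>.\<close>
  define A where "A = 2 * L"
  define \<zeta> where "\<zeta> = \<kappa> / (4 * T)"
  have A: "A > 0" and \<zeta>: "\<zeta> > 0" "\<zeta> * T = \<kappa> / 4" using L(1) \<kappa> T_pos by (auto simp: A_def \<zeta>_def)
  define C where "C = 1 + Rho T"
  define e where "e n = inverse (real (Suc n))" for n
  have e: "e n > 0" for n by (simp add: e_def)
  have elim: "e \<longlonglongrightarrow> 0" unfolding e_def[abs_def] by (rule LIMSEQ_inverse_real_of_nat)
  let ?pen = "\<lambda>e q p. penalty e (\<lambda>u. arc (dn q) u - arc (dn p) u)"
  have cont: "continuous_on {0..T} (\<lambda>u. arc (dn q) u - arc (dn p) u)" if "q \<in> \<G> k" "p \<in> \<G> k" for q p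
    by (intro continuous_on_diff arc_continuous Gk_dn[OF that(1)] Gk_dn[OF that(2)])
  have pen_diag: "?pen (e n) q q \<le> e n * C" for n q
    using penalty_bounds(2)[of "\<lambda>_. 0" "e n"] e[of n] by (simp add: penalty_zero C_def)
  have "\<exists>q p. q \<in> \<G> k \<and> p \<in> \<G> k \<and> fst q = fst p \<and>
    (\<forall>q'\<in>\<G> k. \<forall>p'\<in>\<G> k. fst q' = fst p' \<longrightarrow>
      doubled \<phi>1 \<phi>2 A (e n) 0 \<zeta> q' p' \<le> doubled \<phi>1 \<phi>2 A (e n) 0 \<zeta> q p) \<and>
    (fst q < T \<longrightarrow> \<zeta> \<le> H (fst q) (arc (dn q) (fst q)) (A *\<^sub>R test_grad (e n) (arc (dn p)) q)
       - H (fst q) (arc (dn p) (fst q)) (A *\<^sub>R test_grad (e n) (arc (dn p)) q))" for n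
    by (rule equal_time_maximum[OF v H k(1) e k(2), of A n \<zeta>]) blast
  then obtain s r where s: "\<And>n. s n \<in> \<G> k" "\<And>n. r n \<in> \<G> k" "\<And>n. fst (s n) = fst (r n)"
    and mx: "\<And>n q' p'. q' \<in> \<G> k \<Longrightarrow> p' \<in> \<G> k \<Longrightarrow> fst q' = fst p' \<Longrightarrow>
      doubled \<phi>1 \<phi>2 A (e n) 0 \<zeta> q' p' \<le> doubled \<phi>1 \<phi>2 A (e n) 0 \<zeta> (s n) (r n)"
    and ineq: "\<And>n. fst (s n) < T \<Longrightarrow> \<zeta> \<le> H (fst (s n)) (arc (dn (s n)) (fst (s n))) (A *\<^sub>R test_grad (e n) (arc (dn (r n))) (s n))
       - H (fst (s n)) (arc (dn (r n)) (fst (s n))) (A *\<^sub>R test_grad (e n) (arc (dn (r n))) (s n))"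
    by metis
  have pb: "0 \<le> ?pen 0 (s n) (r n)" "?pen 0 (s n) (r n) \<le> ?pen (e n) (s n) (r n)" for n
    using penalty_bounds(1,3)[OF cont[OF s(1,2)] less_imp_le[OF e]] by auto
  \<comment> \<open>comparison of the maximizer with the pair \<open>(s n, s n)\<close>\<close>
  have small: "?pen 0 (s n) (r n) \<le> 2 * C * e n" for n
  proof -
    have "A * ?pen (e n) (s n) (r n) \<le> \<phi>2 (s n) - \<phi>2 (r n) + A * ?pen (e n) (s n) (s n)"
      using mx[OF s(1) s(1) refl, of n n] by (simp add: doubled_def)
    also have "\<dots> \<le> L * ?pen 0 (s n) (r n) + A * (e n * C)"
      using L(2)[OF s(1) s(2) s(3), of n] pen_diag[of n "s n"] A by (intro add_mono mult_left_mono) auto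
    finally have "A * ?pen 0 (s n) (r n) \<le> L * ?pen 0 (s n) (r n) + A * (e n * C)"
      using mult_left_mono[OF pb(2)[of n], of A] A by linarith
    then have "L * ?pen 0 (s n) (r n) \<le> L * (2 * C * e n)" by (simp add: A_def algebra_simps)
    then show ?thesis using L(1) by simp
  qed
  \<comment> \<open>comparison of the maximizer with the pair \<open>(q0, q0)\<close>\<close>
  have gap: "3 * \<kappa> / 4 - A * (e n * C) \<le> \<phi>1 (s n) - \<phi>2 (r n)" for n
  proof -
    have "\<kappa> - A * ?pen (e n) q0 q0 - \<zeta> * (T - fst q0) \<le> \<phi>1 (s n) - \<phi>2 (r n) - A * ?pen (e n) (s n) (r n) - \<zeta> * (T - fst (s n))"
      using mx[OF k(2) k(2) refl, of n] by (simp add: doubled_def \<kappa>_def)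
    moreover have "A * ?pen (e n) q0 q0 \<le> A * (e n * C)" using pen_diag A by (intro mult_left_mono) auto
    moreover have "\<zeta> * (T - fst q0) \<le> \<zeta> * T" using position_time[OF q0] \<zeta>(1) by (intro mult_left_mono) auto
    moreover have "0 \<le> A * ?pen (e n) (s n) (r n)" using pb[of n] A by simp
    moreover have "0 \<le> \<zeta> * (T - fst (s n))" using position_time[OF Gk_position[OF s(1)]] \<zeta>(1) by simp
    ultimately show ?thesis using \<zeta>(2) by argo
  qed
  obtain \<rho> q p where \<rho>: "strict_mono (\<rho> :: nat \<Rightarrow> nat)" and qp: "q \<in> \<G> k" "p \<in> \<G> k"
    and c: "pconv (\<lambda>n. s (\<rho> n)) q" "pconv (\<lambda>n. r (\<rho> n)) p" by (rule Gk_pair_compact[OF s(1,2)])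
  have e\<rho>: "(\<lambda>n. e (\<rho> n)) \<longlonglongrightarrow> 0" using LIMSEQ_subseq_LIMSEQ[OF elim \<rho>] by (simp add: comp_def)
  have eqt: "fst q = fst p"
    using LIMSEQ_unique[OF pconv_time[OF c(1)]] pconv_time[OF c(2)] s(3) by simp
  have pen0: "?pen 0 q p \<le> 0"
  proof -
    have "(\<lambda>n. 2 * C * e (\<rho> n)) \<longlonglongrightarrow> 2 * C * 0" by (intro tendsto_intros e\<rho>)
    from LIMSEQ_le[OF penalty_pair_tendsto[OF s(1) qp(1) c(1) s(2) qp(2) c(2) order_refl] this] small
    show ?thesis by simp
  qed
  have eqa: "arc (dn q) u = arc (dn p) u" if "u \<in> {0..T}" for u
    using penalty_0_eq_0_imp[OF cont[OF qp] pen0 that] by simp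
  have gap0: "3 * \<kappa> / 4 \<le> \<phi>1 q - \<phi>2 p"
  proof -
    have "(\<lambda>n. 3 * \<kappa> / 4 - A * (e (\<rho> n) * C)) \<longlonglongrightarrow> 3 * \<kappa> / 4 - A * (0 * C)" by (intro tendsto_intros e\<rho>)
    moreover have "(\<lambda>n. \<phi>1 (s (\<rho> n)) - \<phi>2 (r (\<rho> n))) \<longlonglongrightarrow> \<phi>1 q - \<phi>2 p"
      by (intro tendsto_diff Phi_tendsto[OF Ph(1) k(1) s(1) qp(1) c(1)] Phi_tendsto[OF Ph(2) k(1) s(2) qp(2) c(2)])
    ultimately show ?thesis using LIMSEQ_le gap by fastforce
  qed
  have tq: "fst q \<in> {0..T}" by (rule position_time[OF Gk_position[OF qp(1)]])
  have "\<bar>\<phi>2 q - \<phi>2 p\<bar> \<le> L * ?pen 0 q p" by (rule L(2)[OF qp eqt])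
  also have "\<dots> \<le> 0" using pen0 L(1) by (simp add: mult_nonneg_nonpos)
  finally have \<phi>2qp: "\<phi>2 q = \<phi>2 p" by simp
  \<comment> \<open>otherwise the boundary condition gives \<open>\<phi>1 q = \<phi>2 q\<close>\<close>
  have qT: "fst q < T"
  proof (rule ccontr)
    assume "\<not> fst q < T"
    then have "fst q = T" using tq by simp
    then have "q = (T, snd q)" "snd q \<in> paths y K T"
      using Gk_position[OF qp(1)] by (auto simp: positions_def)
    then have "\<phi>1 q = \<phi>2 q" using v unfolding viscosity_solution_def by metis
    then show False using gap0 \<phi>2qp \<kappa> by simp
  qed
  define \<eta> where "\<eta> = (T - fst q) / 4"
  have \<eta>: "\<eta> > 0" "fst q < T - 2 * \<eta>" using qT unfolding \<eta>_def by argo+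
  obtain N where N: "\<And>n. n \<ge> N \<Longrightarrow> fst (s (\<rho> n)) < T - 2 * \<eta>"
    using order_tendstoD(2)[OF pconv_time[OF c(1)] \<eta>(2)] unfolding eventually_sequentially by blast
  define m where "m n = \<rho> (n + N)" for n
  have mT: "fst (s (m n)) \<le> T - 2 * \<eta>" "fst (s (m n)) < T" for n using N[of "n + N"] \<eta>(1) by (auto simp: m_def)
  have sh: "strict_mono (\<lambda>n::nat. n + N)" by (simp add: strict_mono_def)
  have cm: "pconv (\<lambda>n. s (m n)) q" "pconv (\<lambda>n. r (m n)) p"
    unfolding m_def by (rule pconv_subseq[OF c(1) sh], rule pconv_subseq[OF c(2) sh])
  define g where "g n = A *\<^sub>R test_grad (e (m n)) (arc (dn (r (m n)))) (s (m n))" for n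
  have "norm (g n) \<le> A * (CK * (rho \<eta> * (1 + 2 * Rho T)))" for n
  proof -
    note [measurable] = arc_measurable[OF Gk_dn[OF s(1)]] arc_measurable[OF Gk_dn[OF s(2)]]
    have "norm (test_grad (e (m n)) (arc (dn (r (m n)))) (s (m n))) \<le> CK * (rho \<eta> * (1 + 2 * Rho T))"
      unfolding test_grad_def
    proof (rule P_norm_le[OF _ _ \<eta>(1)])
      show "(\<lambda>u. norm_slope (e (m n)) (arc (dn (s (m n))) u - arc (dn (r (m n))) u) (arc (dn (s (m n))) u - arc (dn (r (m n))) u)) \<in> borel_measurable I0"
        by measurable
      show "norm (norm_slope (e (m n)) (arc (dn (s (m n))) u - arc (dn (r (m n))) u) (arc (dn (s (m n))) u - arc (dn (r (m n))) u)) \<le> 1" for u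
        by (rule norm_slope_le[OF e])
    qed (use mT position_time[OF Gk_position[OF s(1)]] in auto)
    then show ?thesis using A by (simp add: g_def mult_left_mono)
  qed
  then have "bounded (range g)" unfolding bounded_iff by blast
  then obtain g' \<mu> where \<mu>: "strict_mono (\<mu> :: nat \<Rightarrow> nat)" "(g \<circ> \<mu>) \<longlonglongrightarrow> g'"
    using bounded_imp_convergent_subsequence by blast
  have c\<mu>: "pconv (\<lambda>n. s (m (\<mu> n))) q" "pconv (\<lambda>n. r (m (\<mu> n))) p"
    using pconv_subseq[OF cm(1) \<mu>(1)] pconv_subseq[OF cm(2) \<mu>(1)] by auto
  let ?t = "\<lambda>n. fst (s (m (\<mu> n)))"
  have tin: "?t n \<in> {0..T}" for n by (rule position_time[OF Gk_position[OF s(1)]])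
  have Hlim: "(\<lambda>n. H (?t n) (x n) (g (\<mu> n))) \<longlonglongrightarrow> H (fst q) x' g'" if "x \<longlonglongrightarrow> x'" for x x'
    using continuous_on_tendsto_compose[OF H, of "\<lambda>n. (?t n, x n, g (\<mu> n))" "(fst q, x', g')" sequentially]
      that tin tq pconv_time[OF c\<mu>(1)] \<mu>(2) by (simp add: tendsto_Pair comp_def)
  have "(\<lambda>n. H (?t n) (arc (dn (s (m (\<mu> n)))) (?t n)) (g (\<mu> n)) - H (?t n) (arc (dn (r (m (\<mu> n)))) (?t n)) (g (\<mu> n)))
    \<longlonglongrightarrow> H (fst q) (arc (dn q) (fst q)) g' - H (fst q) (arc (dn p) (fst q)) g'"
    by (intro tendsto_diff Hlim pconv_diag[OF c\<mu>(1) Gk_position[OF qp(1)] tin pconv_time[OF c\<mu>(1)]]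
        pconv_diag[OF c\<mu>(2) Gk_position[OF qp(2)] tin pconv_time[OF c\<mu>(1)]])
  moreover have "\<zeta> \<le> H (?t n) (arc (dn (s (m (\<mu> n)))) (?t n)) (g (\<mu> n)) - H (?t n) (arc (dn (r (m (\<mu> n)))) (?t n)) (g (\<mu> n))" for n
    using ineq[OF mT(2)] by (simp add: g_def)
  ultimately have "\<zeta> \<le> H (fst q) (arc (dn q) (fst q)) g' - H (fst q) (arc (dn p) (fst q)) g'"
    by (intro LIMSEQ_le_const) auto
  then show False using eqa[OF tq] \<zeta>(1) by simp
qed

end

theorem theorem9p2:
  fixes T c0 \<alpha> :: real
    and y :: "real \<Rightarrow> real ^ 'n"
    and K Kst :: "real \<Rightarrow> real \<Rightarrow> real ^ 'n ^ 'n"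
    and H :: "real \<Rightarrow> real ^ 'n \<Rightarrow> real ^ 'n \<Rightarrow> real"
    and \<sigma> :: "(real \<Rightarrow> real ^ 'n) \<Rightarrow> real"
  assumes "T > 0" and "c0 > 0"
    and "continuous_on {0..T} y"
    and "0 < \<alpha>" and "\<alpha> < 1"
    and "\<And>\<tau> \<xi>. (\<tau>, \<xi>) \<in> open_triangle T \<Longrightarrow>
           K \<tau> \<xi> = (1 / (\<tau> - \<xi>) powr (1 - \<alpha>)) *\<^sub>R Kst \<tau> \<xi>"
    and "continuous_on (closed_triangle T) (\<lambda>(\<tau>, \<xi>). Kst \<tau> \<xi>)"
    and "\<exists>\<beta> L. 0 < \<beta> \<and> \<beta> \<le> 1 \<and> 0 < L \<and>
           (\<forall>\<tau> \<xi> \<xi>'. (\<tau>, \<xi>) \<in> closed_triangle T \<longrightarrow> (\<tau>, \<xi>') \<in> closed_triangle T \<longrightarrow>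
              onorm ((*v) (Kst \<tau> \<xi> - Kst \<tau> \<xi>')) \<le> L * \<bar>\<xi> - \<xi>'\<bar> powr \<beta>)"
    and "\<And>t l. 0 < t \<Longrightarrow> t \<le> T \<Longrightarrow> l \<in> Linf t \<Longrightarrow>
           (\<forall>\<tau>\<in>{0..t}. volterra K l \<tau> \<tau> = 0) \<Longrightarrow> (AE \<xi> in lebesgue_on {0..t}. l \<xi> = 0)"
    and "continuous_on ({0..T} \<times> UNIV \<times> UNIV) (\<lambda>(t, x, s). H t x s)"
    and "\<exists>c>0. \<forall>t\<in>{0..T}. \<forall>x s s'.
           \<bar>H t x s - H t x s'\<bar> \<le> c * (1 + norm x) * norm (s - s')"
  shows "\<forall>\<phi>\<^sub>1 \<phi>\<^sub>2.
           viscosity_solution T y K c0 \<alpha> H \<sigma> \<phi>\<^sub>1 \<longrightarrow> viscosity_solution T y K c0 \<alpha> H \<sigma> \<phi>\<^sub>2 \<longrightarrow>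
           (\<forall>p \<in> positions T y K. \<phi>\<^sub>1 p = \<phi>\<^sub>2 p)"
proof -
  interpret volterra_problem T \<alpha> K Kst c0 y
    by unfold_locales (fact assms)+
  show ?thesis
    using comparison assms(10) by (blast intro: antisym)
qed

end
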